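(* Assume $\mu\ge 2$. Let $H$ be the nonrandom function defined in the context; $H$ is continuous and multiplicatively periodic with period $a/\mu$ (that is, $H(\varepsilon a/\mu)=H(\varepsilon)$). For small $\varepsilon>0$ put $$\gamma(\varepsilon):=\frac{\log(1/\varepsilon)}{\log(a/\mu)}-\frac{\log\log(1/\varepsilon)}{\log\mu}+H(\varepsilon).$$ Then $$\lim_{\varepsilon\downarrow 0}\ \mathbb{P}\big(K=\lceil\gamma(\varepsilon)\rceil\ \text{ or }\ K=\lceil\gamma(\varepsilon)\rceil+1\,\big|\,W<\varepsilon\big)=1.$$
   Context: $(Z_n)_{n\ge 0}$ is the sequence of generation sizes of a Galton–Watson tree with $Z_0=1$ whose offspring variable $N$ is nondegenerate (not almost surely constant), with $P(N=0)=0$ and $E[N\log N]<\infty$. Put $p_n:=P(N=n)$, $a:=E[N]\in(1,\infty)$, $\mu:=\min\{n\in\mathbb{N}:p_n>0\}$, assumed $\ge 2$, and $\lambda:=\min\{n>\mu:p_n>0\}$. The martingale limit $W:=\lim_{n\to\infty}Z_n/a^n$ exists and is strictly positive almost surely. Let $K:=\min\{k\in\mathbb{N}:Z_k>\mu^k\}$. Definition of $H$. Let $\beta:=\log\mu/\log a$, $\alpha:=\beta/(1-\beta)$, $\kappa(\varepsilon):=\lfloor\log(1/\varepsilon)/\log(a/\mu)\rfloor$, $y=y(\varepsilon):=\varepsilon(a/\mu)^{\kappa(\varepsilon)}\in(\mu/a,1]$. Let $\phi(z):=\mathbb{E}e^{-zW}$ be the Laplace transform of $W$, $f(s):=\sum_j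 p_js^j$, $f_0(s):=s$, $f_m:=f\circ f_{m-1}$, and let $b(s):=\lim_{m\to\infty}\mu^{-m}\log f_m(s)$ for $s\in(0,1]$ (logarithmic Böttcher function; the limit exists). One has $b\circ\phi<0$ on $(0,\infty)$, and $(b\circ\phi)'$ increases from $-\infty$ to $0$ on $(0,\infty)$, so there is a unique $u_1=u_1(\varepsilon)>0$ with $(b\circ\phi)'(u_1)=-y(\varepsilon)$. Then $$H(\varepsilon):=\frac{1}{\log\mu}\log\Big(-\frac{b(\phi(u_1))\,y^{\alpha}(\lambda-\mu)}{\alpha}\Big).$$ *)

theory Defs
  imports "HOL-Probability.Probability"
begin

(* Generation sizes, where X n i is the number of children of the i-th individual
   of generation n. *)
primrec gw_size :: "(nat \<Rightarrow> nat \<Rightarrow> 'w \<Rightarrow> nat) \<Rightarrow> nat \<Rightarrow> 'w \<Rightarrow> nat" where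
  "gw_size X 0 \<omega> = 1"
| "gw_size X (Suc n) \<omega> = (\<Sum>i<gw_size X n \<omega>. X n i \<omega>)"

definition off_mean :: "nat pmf \<Rightarrow> real" where
  "off_mean p = measure_pmf.expectation p real"

definition off_min :: "nat pmf \<Rightarrow> nat" where
  "off_min p = (LEAST n. pmf p n > 0)"

definition off_next :: "nat pmf \<Rightarrow> nat" where
  "off_next p = (LEAST n. n > off_min p \<and> pmf p n > 0)"

(* Any value that lim takes off the convergence set is irrelevant here: under the
   hypotheses of the theorem that set has full measure. *)
definition gw_limit :: "nat pmf \<Rightarrow> (nat \<Rightarrow> nat \<Rightarrow> 'w \<Rightarrow> nat) \<Rightarrow> 'w \<Rightarrow> real" where
  "gw_limit p X \<omega> = lim (\<lambda>n. real (gw_size X n \<omega>) / off_mean p ^ n)"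

(* Under the hypotheses of the theorem such a k exists almost surely; LEAST is
   unspecified on the remaining null set. *)
definition first_excess :: "nat pmf \<Rightarrow> (nat \<Rightarrow> nat \<Rightarrow> 'w \<Rightarrow> nat) \<Rightarrow> 'w \<Rightarrow> nat" where
  "first_excess p X \<omega> = (LEAST k. gw_size X k \<omega> > off_min p ^ k)"

definition gw_laplace ::
    "'w measure \<Rightarrow> nat pmf \<Rightarrow> (nat \<Rightarrow> nat \<Rightarrow> 'w \<Rightarrow> nat) \<Rightarrow> real \<Rightarrow> real" where
  "gw_laplace M p X z = (\<integral>\<omega>. exp (- z * gw_limit p X \<omega>) \<partial>M)"

definition off_pgf :: "nat pmf \<Rightarrow> real \<Rightarrow> real" where
  "off_pgf p s = (\<Sum>j. pmf p j * s ^ j)"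

(* Logarithmic Boettcher function; only arguments in (0,1] are meaningful. *)
definition log_boettcher :: "nat pmf \<Rightarrow> real \<Rightarrow> real" where
  "log_boettcher p s = lim (\<lambda>m. ln ((off_pgf p ^^ m) s) / real (off_min p) ^ m)"

definition gw_beta :: "nat pmf \<Rightarrow> real" where
  "gw_beta p = ln (real (off_min p)) / ln (off_mean p)"

definition gw_alpha :: "nat pmf \<Rightarrow> real" where
  "gw_alpha p = gw_beta p / (1 - gw_beta p)"

definition gw_kappa :: "nat pmf \<Rightarrow> real \<Rightarrow> int" where
  "gw_kappa p \<epsilon> = \<lfloor>ln (1 / \<epsilon>) / ln (off_mean p / real (off_min p))\<rfloor>"

(* gw_kappa is negative for large arguments, hence the integer power. *)
definition gw_y :: "nat pmf \<Rightarrow> real \<Rightarrow> real" where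
  "gw_y p \<epsilon> = \<epsilon> * (off_mean p / real (off_min p)) powi gw_kappa p \<epsilon>"

definition gw_u1 ::
    "'w measure \<Rightarrow> nat pmf \<Rightarrow> (nat \<Rightarrow> nat \<Rightarrow> 'w \<Rightarrow> nat) \<Rightarrow> real \<Rightarrow> real" where
  "gw_u1 M p X \<epsilon> =
     (THE u. u > 0 \<and> deriv (log_boettcher p \<circ> gw_laplace M p X) u = - gw_y p \<epsilon>)"

definition gw_H ::
    "'w measure \<Rightarrow> nat pmf \<Rightarrow> (nat \<Rightarrow> nat \<Rightarrow> 'w \<Rightarrow> nat) \<Rightarrow> real \<Rightarrow> real" where
  "gw_H M p X \<epsilon> = 1 / ln (real (off_min p)) *
     ln (- (log_boettcher p (gw_laplace M p X (gw_u1 M p X \<epsilon>)) * gw_y p \<epsilon> powr gw_alpha p *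
            (real (off_next p) - real (off_min p)) / gw_alpha p))"

definition gw_gamma ::
    "'w measure \<Rightarrow> nat pmf \<Rightarrow> (nat \<Rightarrow> nat \<Rightarrow> 'w \<Rightarrow> nat) \<Rightarrow> real \<Rightarrow> real" where
  "gw_gamma M p X \<epsilon> = ln (1 / \<epsilon>) / ln (off_mean p / real (off_min p))
     - ln (ln (1 / \<epsilon>)) / ln (real (off_min p)) + gw_H M p X \<epsilon>"

end

theory Submission
  imports Defs "HOL-Real_Asymp.Real_Asymp"
begin

text \<open>
  Let \<open>\<phi>\<close> be the Laplace transform of \<open>W\<close> and \<open>f\<^sub>k\<close> the \<open>k\<close>-th iterate of the
  offspring generating function. Put \<open>\<kappa> = \<kappa>(\<epsilon>)\<close> and \<open>u = u\<^sub>1(\<epsilon>)\<close>, which ranges over a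
  compact interval. Given \<open>Z\<^sub>\<kappa> = n\<close>, the variable \<open>a\<^sup>\<kappa> W\<close> is a sum of \<open>n\<close> independent copies
  of \<open>W\<close>, and after tilting by \<open>exp (- u a\<^sup>\<kappa> W)\<close> the event \<open>W < \<epsilon>\<close> becomes a typical one. A
  concentration inequality and a matching local lower bound, both proved with a Fejer kernel, give
  \<open>P(W < \<epsilon>, A) \<le> C exp (u a\<^sup>\<kappa> \<epsilon>) \<mu> powr (- \<kappa>/2) E(\<phi>(u) ^ Z\<^sub>\<kappa>; A)\<close> for events \<open>A\<close> of the
  first \<open>\<kappa>\<close> generations, with equality up to a constant if \<open>A\<close> is the whole space. Hence
  \<open>P(A | W < \<epsilon>)\<close> is at most a constant times the tilted probability of \<open>A\<close>. For
  \<open>A = {Z\<^sub>k = \<mu> ^ k}\<close> the tilted probability is \<open>exp (- G\<^sub>k)\<close>, where \<open>G\<^sub>k\<close> is comparable to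
  \<open>\<mu>\<^sup>k s ^ (\<lambda> - \<mu>)\<close> with \<open>s = f\<^bsub>\<kappa>-k\<^esub>(\<phi>(u))\<close>. Since \<open>log s\<close> equals \<open>\<mu> ^ (\<kappa> - k) b(\<phi>(u))\<close> up to
  a bounded error, \<open>G\<^sub>k\<close> is of order at most \<open>1 / log (1/\<epsilon>)\<close> for \<open>k \<le> \<gamma>(\<epsilon>)\<close> and tends to
  infinity for \<open>k \<ge> \<gamma>(\<epsilon>) + 1\<close>. The monotonicity of \<open>(b \<circ> \<phi>)'\<close> and the periodicity of \<open>H\<close>
  follow from \<open>\<phi>(a z) = f(\<phi>(z))\<close>.

  Generating functions are used in logarithmic coordinates: \<open>Lam\<close> is
  \<open>z \<mapsto> - log f(exp (- z))\<close>, \<open>om\<close> is \<open>- log \<phi>\<close>, and \<open>bt z\<close> is \<open>- b(exp (- z))\<close>.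
\<close>

section \<open>Local estimates for characteristic functions\<close>

text \<open>The equation for \<open>u\<close> is a saddle-point equation: under the tilt the mean of
  a^\<kappa> W is close to \<mu>^\<kappa> y, and this number is a^\<kappa> \<epsilon>. A plain
  Chernoff bound would miss the factor \<mu>^(-\<kappa>/2) that appears in the lower bound, so
  estimates on the local scale are required from both sides. Constant factors are harmless, because
  both failure probabilities tend to 0. This is why the Fejer kernel suffices: it uses the
  characteristic function only on a fixed interval around 0, where a third moment controls it
  uniformly in \<open>u\<close>.

  The position of \<gamma> comes from an exact cancellation. With L = log (1/\<epsilon>) the
  constants in H make (\<lambda> - \<mu>) \<mu>^\<kappa> |b(\<phi>(u))| equal to \<alpha> L
  \<mu>^\<gamma>, so that G_k is comparable to exp (k log \<mu> - \<alpha> L \<mu>^(\<gamma>-k)). At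
  k = \<gamma> the terms of order L cancel and - log L is left, up to a bounded term; one generation
  later the second term is divided by \<mu> \<ge> 2 and the first one wins. Between \<gamma> and
  \<gamma> + 1 nothing is claimed, hence the two possible values of K.\<close>

definition fejer :: "real \<Rightarrow> real \<Rightarrow> real" where
  "fejer d y = (if y = 0 then d else 2 * (1 - cos (d * y)) / (d * y\<^sup>2))"

lemma fejer_measurable [measurable]: "fejer d \<in> borel_measurable borel"
  unfolding fejer_def by measurable

lemma fejer_nonneg: "d > 0 \<Longrightarrow> 0 \<le> fejer d y"
  by (auto simp: fejer_def intro!: divide_nonneg_nonneg)

lemma one_minus_cos_le: "1 - cos x \<le> x\<^sup>2 / (2::real)"
proof -
  have "1 - cos x = 2 * (sin (x/2))\<^sup>2"
    using cos_double_sin[of "x/2"] by simp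
  also have "(sin (x/2))\<^sup>2 \<le> (x/2)\<^sup>2"
    using abs_sin_x_le_abs_x[of "x/2"] by (simp only: abs_le_square_iff)
  finally show ?thesis by (simp add: power2_eq_square)
qed

lemma fejer_le: assumes "d > 0" shows "fejer d y \<le> d"
proof (cases "y = 0")
  case False
  have "2 * (1 - cos (d * y)) \<le> (d * y)\<^sup>2" using one_minus_cos_le[of "d*y"] by simp
  then show ?thesis using False assms
    unfolding fejer_def
    by (subst if_not_P, simp, subst pos_divide_le_eq) (auto simp: power2_eq_square algebra_simps zero_less_mult_iff)
qed (simp add: fejer_def)

lemma fejer_le_tail: assumes "d > 0" "y \<noteq> 0" shows "fejer d y \<le> 4 / (d * y\<^sup>2)"
proof -
  have "2 * (1 - cos (d * y)) \<le> 4" using cos_ge_minus_one[of "d*y"] by argo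
  then show ?thesis using assms by (auto simp: fejer_def intro!: divide_right_mono)
qed

text \<open>The kernel is the Fourier transform of the triangle function on [-d, d]. Being
  nonnegative with a compactly supported transform, it tests a law through its characteristic
  function near 0 alone. The value at \<open>y = 0\<close> in the definition is the limit, so the
  identity persists there.\<close>

lemma fejer_integral:
  assumes d: "d > 0"
  shows "has_bochner_integral lborel (\<lambda>s. indicator {-d..d} s * (1 - \<bar>s\<bar> / d) * cos (s * y)) (fejer d y)"
proof -
  define f where "f s = (1 - s / d) * cos (s * y)" for s
  have "has_bochner_integral lborel (\<lambda>s. f s * indicator {0..d} s) (fejer d y / 2)"
  proof (cases "y = 0")
    case True
    have "has_bochner_integral lborel (\<lambda>s. f s * indicator {0..d} s) ((d - d\<^sup>2 / (2*d)) - (0 - 0\<^sup>2 / (2*d)))"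
      by (rule has_bochner_integral_FTC_Icc_real)
         (use d True in \<open>auto intro!: derivative_eq_intros continuous_intros simp: f_def field_simps power2_eq_square\<close>)
    then show ?thesis using d True by (simp add: fejer_def field_simps power2_eq_square)
  next
    case False
    define F where "F s = (1 - s/d) * sin (s*y) / y - cos (s*y) / (d * y\<^sup>2)" for s
    have "has_bochner_integral lborel (\<lambda>s. f s * indicator {0..d} s) (F d - F 0)"
    proof (rule has_bochner_integral_FTC_Icc_real)
      show "DERIV F x :> f x" for x
        unfolding F_def f_def using d False
        by (auto intro!: derivative_eq_intros simp: field_simps power2_eq_square)
      show "isCont f x" for x unfolding f_def using d by (auto intro!: continuous_intros)
    qed (use d in auto)
    moreover have "F d - F 0 = fejer d y / 2"
      using d False by (simp add: F_def fejer_def field_simps)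
    ultimately show ?thesis by simp
  qed
  then have "has_bochner_integral lborel (\<lambda>s. indicator {0..} s *\<^sub>R (indicator {-d..d} s * (1 - \<bar>s\<bar> / d) * cos (s * y))) (fejer d y / 2)"
    by (rule has_bochner_integral_cong[THEN iffD1, rotated 3]) (auto simp: f_def indicator_def)
  then have "has_bochner_integral lborel (\<lambda>s. indicator {-d..d} s * (1 - \<bar>s\<bar> / d) * cos (s * y)) (2 *\<^sub>R (fejer d y / 2))"
    by (rule has_bochner_integral_even_function) (auto simp: indicator_def)
  then show ?thesis by simp
qed

text \<open>The zeros of the Fejer kernel are filled in by a translate; the sum dominates a positive
  function with quadratic decay, which serves for one-sided exponentials and for tails alike.\<close>

lemma fejer_pair_ge:
  assumes "d > 0"
  shows "4 / d * (1 / (\<bar>y\<bar> + pi / d)\<^sup>2) \<le> fejer d y + fejer d (y + pi / d)"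
proof -
  \<comment> \<open>\<open>q\<close> bounds the squares of both arguments, so both fractions get the
    denominator \<open>d * q\<close>. The shift by \<open>pi / d\<close> reverses the sign of the
    cosine, and the numerators add up to a constant.\<close>
  define q where "q = (\<bar>y\<bar> + pi / d)\<^sup>2"
  have q: "q > 0" unfolding q_def using assms by (intro zero_less_power add_nonneg_pos) auto
  have 1: "fejer d z \<ge> 2 * (1 - cos (d * z)) / (d * q)" if "z\<^sup>2 \<le> q" for z
  proof (cases "z = 0")
    case False
    then show ?thesis unfolding fejer_def using that assms q
      by (auto intro!: divide_left_mono mult_left_mono mult_pos_pos)
  qed (use assms in \<open>simp add: fejer_def\<close>)
  have "y\<^sup>2 \<le> q" unfolding q_def using assms
    by (metis abs_ge_zero add_increasing2 divide_nonneg_pos order_refl pi_ge_zero power2_abs power_mono)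
  moreover have "(y + pi/d)\<^sup>2 \<le> q" unfolding q_def
  proof (subst abs_le_square_iff[symmetric])
    have "pi / d > 0" using assms by simp
    then show "\<bar>y + pi/d\<bar> \<le> \<bar>\<bar>y\<bar> + pi/d\<bar>" by arith
  qed
  moreover have "d * (y + pi / d) = d * y + pi" using assms by (simp add: field_simps)
  ultimately have "fejer d y + fejer d (y + pi / d) \<ge> 2 * (1 - cos (d * y)) / (d * q) + 2 * (1 + cos (d * y)) / (d * q)"
    using 1[of y] 1[of "y + pi/d"] by simp
  also have "2 * (1 - cos (d * y)) / (d * q) + 2 * (1 + cos (d * y)) / (d * q) = 4 / d * (1 / q)"
    by (simp add: add_divide_distrib[symmetric] algebra_simps)
  finally show ?thesis unfolding q_def .
qed

section \<open>Gaussian integrals with which characteristic functions are compared\<close>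

lemma gauss_integral:
  fixes \<tau> :: real
  assumes "\<tau> > 0"
  shows "has_bochner_integral lborel (\<lambda>s. exp (-\<tau> * s\<^sup>2)) (sqrt (pi / \<tau>))"
proof -
  define \<sigma> where "\<sigma> = sqrt (1 / (2 * \<tau>))"
  have s: "\<sigma> > 0" "\<sigma>\<^sup>2 = 1 / (2*\<tau>)" using assms by (auto simp: \<sigma>_def)
  have "has_bochner_integral lborel (\<lambda>s. sqrt (pi/\<tau>) * normal_density 0 \<sigma> s) (sqrt (pi/\<tau>) * 1)"
    using s by (intro has_bochner_integral_mult_right) (auto simp: has_bochner_integral_iff)
  moreover have "sqrt (pi/\<tau>) * normal_density 0 \<sigma> s = exp (-\<tau> * s\<^sup>2)" for s
    using assms unfolding normal_density_def s by (simp add: field_simps)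
  ultimately show ?thesis by simp
qed

lemma gauss_abs_integral:
  fixes \<tau> :: real
  assumes "\<tau> > 0"
  shows "has_bochner_integral lborel (\<lambda>s. \<bar>s\<bar> * exp (-\<tau> * s\<^sup>2)) (1 / \<tau>)"
proof -
  define \<sigma> where "\<sigma> = sqrt (1 / (2 * \<tau>))"
  have s: "\<sigma> > 0" "\<sigma>\<^sup>2 = 1 / (2*\<tau>)" using assms by (auto simp: \<sigma>_def)
  have "has_bochner_integral lborel (\<lambda>s. sqrt (pi/\<tau>) * (normal_density 0 \<sigma> s * \<bar>s - 0\<bar> ^ (2 * 0 + 1)))
     (sqrt (pi/\<tau>) * (2 ^ 0 * \<sigma> ^ (2 * 0 + 1) * fact 0 * sqrt (2 / pi)))"
    using s by (intro has_bochner_integral_mult_right normal_moment_abs_odd) auto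
  moreover have "sqrt (pi/\<tau>) * (normal_density 0 \<sigma> s * \<bar>s - 0\<bar> ^ (2 * 0 + 1)) = \<bar>s\<bar> * exp (-\<tau> * s\<^sup>2)" for s
    using assms unfolding normal_density_def s by (simp add: field_simps)
  moreover have "sqrt (pi/\<tau>) * (2 ^ 0 * \<sigma> ^ (2 * 0 + 1) * fact 0 * sqrt (2 / pi)) = 1 / \<tau>"
  proof -
    have "sqrt (pi/\<tau>) * (2 ^ 0 * \<sigma> ^ (2 * 0 + 1) * fact 0 * sqrt (2 / pi)) = sqrt (pi/\<tau> * (1 / (2 * \<tau>)) * (2 / pi))"
      by (simp only: \<sigma>_def real_sqrt_mult) simp
    also have "pi/\<tau> * (1 / (2 * \<tau>)) * (2 / pi) = (1 / \<tau>)\<^sup>2"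
      by (simp add: power2_eq_square)
    finally show ?thesis using assms by simp
  qed
  ultimately show ?thesis by (simp only:)
qed

text \<open>Fourier inversion of a Gaussian: it is the characteristic function of the standard
  normal law at \<open>t = \<xi> / sqrt V\<close>, after substituting \<open>sqrt V * x\<close> for
  the variable.\<close>

lemma gauss_cos_integral:
  fixes V \<xi> :: real
  assumes "V > 0"
  shows "has_bochner_integral lborel (\<lambda>s. cos (s * \<xi>) * exp (-(V/2) * s\<^sup>2))
     (sqrt (2 * pi / V) * exp (- \<xi>\<^sup>2 / (2 * V)))"
proof -
  define t where "t = \<xi> / sqrt V"
  interpret N: real_distribution std_normal_distribution by (rule real_dist_normal_dist)
  have "Re (char std_normal_distribution t) = (LINT x|std_normal_distribution. cos (t * x))"
    unfolding char_def by (subst integral_Re[symmetric]) (auto simp: N.integrable_iexp intro!: N.integrable_iexp simp: Re_exp)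
  also have "\<dots> = (LINT x|lborel. std_normal_density x * cos (t * x))"
    by (subst integral_density) (auto simp: normal_density_nonneg)
  finally have 1: "(LINT x|lborel. std_normal_density x * cos (t * x)) = exp (- t\<^sup>2 / 2)"
    by (simp add: char_std_normal_distribution)
  have i: "integrable lborel (\<lambda>x. std_normal_density x * cos (t * x))"
    by (rule Bochner_Integration.integrable_bound[OF integrable_normal_density[of 1 0]])
       (auto simp: abs_mult normal_density_nonneg intro!: mult_left_le)
  have "has_bochner_integral lborel (\<lambda>x. std_normal_density (0 + sqrt V * x) * cos (t * (0 + sqrt V * x)))
          (exp (- t\<^sup>2 / 2) /\<^sub>R \<bar>sqrt V\<bar>)"
    using 1 i by (subst lborel_has_bochner_integral_real_affine_iff[of "sqrt V" "\<lambda>x. std_normal_density x * cos (t * x)" _ 0, symmetric])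
      (use assms in \<open>auto simp: has_bochner_integral_iff\<close>)
  then have "has_bochner_integral lborel (\<lambda>x. sqrt (2*pi) * (std_normal_density (0 + sqrt V * x) * cos (t * (0 + sqrt V * x))))
          (sqrt (2*pi) * (exp (- t\<^sup>2 / 2) /\<^sub>R \<bar>sqrt V\<bar>))"
    by (rule has_bochner_integral_mult_right)
  moreover have "sqrt (2*pi) * (std_normal_density (0 + sqrt V * x) * cos (t * (0 + sqrt V * x)))
      = cos (x * \<xi>) * exp (-(V/2) * x\<^sup>2)" for x
    using assms by (simp add: std_normal_density_def t_def power_mult_distrib mult.commute)
  moreover have "sqrt (2*pi) * (exp (- t\<^sup>2 / 2) /\<^sub>R \<bar>sqrt V\<bar>) = sqrt (2 * pi / V) * exp (- \<xi>\<^sup>2 / (2 * V))"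
    using assms by (simp add: t_def power_divide real_sqrt_divide field_simps)
  ultimately show ?thesis by simp
qed

section \<open>Smoothing a probability law with the Fejer kernel\<close>

context real_distribution
begin

lemma integrable_fejer [simp]: "d > 0 \<Longrightarrow> integrable M (\<lambda>x. fejer d (x - \<xi>))"
  by (rule integrable_const_bound[where B = d]) (auto simp: fejer_le fejer_nonneg)

text \<open>Fubini's theorem for the triangle representation of the kernel; from here on the law
  enters only through its characteristic function on [-d, d].\<close>

lemma expectation_fejer:
  assumes d: "d > 0"
  shows "(\<integral>x. fejer d (x - \<xi>) \<partial>M) =
     (\<integral>s. indicator {-d..d} s * (1 - \<bar>s\<bar> / d) * Re (iexp (- s * \<xi>) * char M s) \<partial>lborel)"
proof -
  interpret P: pair_sigma_finite M lborel ..
  define g where "g s = indicator {-d..d} s * (1 - \<bar>s\<bar> / d)" for s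
  have [measurable]: "g \<in> borel_measurable borel" unfolding g_def by measurable
  have gi: "integrable lborel g"
    using fejer_integral[OF d, of 0] unfolding g_def by (simp add: has_bochner_integral_iff)
  have g0: "g s \<ge> 0" for s using d by (auto simp: g_def indicator_def)
  have int: "integrable (M \<Otimes>\<^sub>M lborel) (\<lambda>(x,s). g s * cos (s * (x - \<xi>)))"
  proof (rule P.Fubini_integrable)
    have *: "(LINT s|lborel. norm (g s * cos (s * (x - \<xi>)))) \<le> (LINT s|lborel. g s)" for x
      by (rule integral_mono') (use g0 gi in \<open>auto simp: abs_mult intro!: mult_left_le\<close>)
    show "integrable M (\<lambda>x. LINT s|lborel. norm (case (x, s) of (x, s) \<Rightarrow> g s * cos (s * (x - \<xi>))))"
      by (rule integrable_const_bound[where B = "LINT s|lborel. g s"]) (use * in auto)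
    show "AE x in M. integrable lborel (\<lambda>s. case (x, s) of (x, s) \<Rightarrow> g s * cos (s * (x - \<xi>)))"
      by (rule AE_I2, simp, rule Bochner_Integration.integrable_bound[OF gi])
         (use g0 in \<open>auto simp: abs_mult intro!: mult_left_le\<close>)
  qed simp
  have "(\<integral>x. fejer d (x - \<xi>) \<partial>M) = (\<integral>x. (\<integral>s. g s * cos (s * (x - \<xi>)) \<partial>lborel) \<partial>M)"
    using fejer_integral[OF d] by (simp add: g_def has_bochner_integral_iff)
  also have "\<dots> = (\<integral>s. (\<integral>x. g s * cos (s * (x - \<xi>)) \<partial>M) \<partial>lborel)"
    using P.Fubini_integral[OF int] by simp
  also have "\<dots> = (\<integral>s. g s * Re (iexp (- s * \<xi>) * char M s) \<partial>lborel)"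
  proof (rule Bochner_Integration.integral_cong[OF refl])
    fix s :: real
    have ii: "integrable M (\<lambda>x. iexp (s * x))"
      using integrable_iexp[of "\<lambda>x. complex_of_real (s * x)"] by simp
    have "iexp (- s * \<xi>) * char M s = (CLINT x|M. iexp (- s * \<xi>) * iexp (s * x))"
      unfolding char_def using ii by simp
    also have "(\<lambda>x. iexp (- s * \<xi>) * iexp (s * x)) = (\<lambda>x. iexp (s * (x - \<xi>)))"
      by (simp add: exp_add[symmetric] algebra_simps)
    finally have "Re (iexp (- s * \<xi>) * char M s) = Re (CLINT x|M. iexp (s * (x - \<xi>)))"
      by simp
    also have "\<dots> = (\<integral>x. Re (iexp (s * (x - \<xi>))) \<partial>M)"
      by (rule integral_Re[symmetric])
         (use integrable_iexp[of "\<lambda>x. complex_of_real (s * (x - \<xi>))"] in simp)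
    also have "\<dots> = (\<integral>x. cos (s * (x - \<xi>)) \<partial>M)" by (simp add: Re_exp)
    finally show "(\<integral>x. g s * cos (s * (x - \<xi>)) \<partial>M) = g s * Re (iexp (- s * \<xi>) * char M s)" by simp
  qed
  finally show ?thesis unfolding g_def .
qed

lemma expectation_fejer_le:
  assumes d: "d > 0" and \<tau>: "\<tau> > 0" and le: "\<And>t. \<bar>t\<bar> \<le> d \<Longrightarrow> cmod (char M t) \<le> exp (-\<tau> * t\<^sup>2)"
  shows "(\<integral>x. fejer d (x - \<xi>) \<partial>M) \<le> sqrt (pi / \<tau>)"
proof -
  have "(\<integral>x. fejer d (x - \<xi>) \<partial>M) \<le> (\<integral>s. exp (-\<tau> * s\<^sup>2) \<partial>lborel)"
    unfolding expectation_fejer[OF d]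
  proof (rule integral_mono')
    fix s :: real
    have "Re (iexp (- s * \<xi>) * char M s) \<le> cmod (iexp (- s * \<xi>) * char M s)" by (rule complex_Re_le_cmod)
    also have "\<dots> = cmod (char M s)" unfolding norm_mult by simp
    finally have 1: "Re (iexp (- s * \<xi>) * char M s) \<le> cmod (char M s)" .
    show "indicator {-d..d} s * (1 - \<bar>s\<bar> / d) * Re (iexp (- s * \<xi>) * char M s) \<le> exp (-\<tau> * s\<^sup>2)"
    proof (cases "\<bar>s\<bar> \<le> d")
      case True
      then have "(1 - \<bar>s\<bar> / d) * Re (iexp (- s * \<xi>) * char M s) \<le> (1 - \<bar>s\<bar> / d) * exp (-\<tau> * s\<^sup>2)"
        using 1 le[of s] d by (intro mult_left_mono) auto
      also have "\<dots> \<le> 1 * exp (-\<tau> * s\<^sup>2)" using d by (intro mult_right_mono) auto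
      finally show ?thesis using True by (simp add: indicator_def)
    qed (auto simp: indicator_def)
  qed (use gauss_integral[OF \<tau>] in \<open>auto simp: has_bochner_integral_iff\<close>)
  then show ?thesis using gauss_integral[OF \<tau>] by (simp add: has_bochner_integral_iff)
qed

text \<open>A concentration inequality of Esseen type: with \<tau> proportional to a number n of
  summands, the mass near any point \<xi> is bounded by a multiple of n^(-1/2). The test function is
  the one dominated by a pair of Fejer kernels.\<close>

lemma concentration:
  assumes d: "d > 0" and \<tau>: "\<tau> > 0" and le: "\<And>t. \<bar>t\<bar> \<le> d \<Longrightarrow> cmod (char M t) \<le> exp (-\<tau> * t\<^sup>2)"
  shows "(\<integral>x. 1 / (\<bar>x - \<xi>\<bar> + pi / d)\<^sup>2 \<partial>M) \<le> d / 2 * sqrt (pi / \<tau>)"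
proof -
  have "(\<integral>x. 1 / (\<bar>x - \<xi>\<bar> + pi / d)\<^sup>2 \<partial>M) \<le> (\<integral>x. d / 4 * (fejer d (x - \<xi>) + fejer d (x - (\<xi> - pi / d))) \<partial>M)"
  proof (rule integral_mono')
    fix x show "1 / (\<bar>x - \<xi>\<bar> + pi / d)\<^sup>2 \<le> d / 4 * (fejer d (x - \<xi>) + fejer d (x - (\<xi> - pi / d)))"
    proof -
      have "d / 4 * (4 / d * (1 / (\<bar>x - \<xi>\<bar> + pi / d)\<^sup>2)) \<le> d / 4 * (fejer d (x - \<xi>) + fejer d (x - \<xi> + pi / d))"
        using fejer_pair_ge[OF d, of "x - \<xi>"] d by (intro mult_left_mono) auto
      moreover have "x - \<xi> + pi / d = x - (\<xi> - pi / d)" by simp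
      ultimately show ?thesis using d by simp
    qed
  qed (use d in \<open>auto simp: fejer_nonneg\<close>)
  also have "\<dots> = d / 4 * ((\<integral>x. fejer d (x - \<xi>) \<partial>M) + (\<integral>x. fejer d (x - (\<xi> - pi / d)) \<partial>M))"
    using d integrable_fejer[of d "\<xi> - pi/d"] integrable_fejer[of d "\<xi>"]
    by (subst integral_mult_right_zero) (subst Bochner_Integration.integral_add, auto)
  also have "\<dots> \<le> d / 4 * (sqrt (pi / \<tau>) + sqrt (pi / \<tau>))"
    using d by (intro mult_left_mono add_mono expectation_fejer_le[OF d \<tau> le]) auto
  finally show ?thesis by simp
qed

text \<open>Comparison with a centred Gaussian of variance V. In the application V and \<tau> are of
  order n while d and K are fixed, so the main term is of order n^(-1/2) and both error terms are of
  order 1/n.\<close>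

lemma expectation_fejer_ge:
  assumes d: "d > 0" and \<tau>: "\<tau> > 0" and V: "V > 0" and K: "K \<ge> 0"
    and le: "\<And>t. \<bar>t\<bar> \<le> d \<Longrightarrow> cmod (char M t - exp (- (V/2) * t\<^sup>2)) \<le> K * \<bar>t\<bar> * exp (-\<tau> * t\<^sup>2)"
  shows "(\<integral>x. fejer d (x - \<xi>) \<partial>M) \<ge> sqrt (2 * pi / V) * exp (- \<xi>\<^sup>2 / (2 * V)) - 2 / (d * V) - K / \<tau>"
proof -
  \<comment> \<open>The second term pays for two things at once: inside [-d, d] for the triangular
    weight, and outside for the truncation, since there |s| / d exceeds 1 and \<open>?L\<close> is
    nonpositive.\<close>
  let ?L = "\<lambda>s. cos (s * \<xi>) * exp (-(V/2) * s\<^sup>2) - 1 / d * (\<bar>s\<bar> * exp (-(V/2) * s\<^sup>2)) - K * (\<bar>s\<bar> * exp (-\<tau> * s\<^sup>2))"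
  have L: "has_bochner_integral lborel ?L
     (sqrt (2 * pi / V) * exp (- \<xi>\<^sup>2 / (2 * V)) - 1 / d * (1 / (V/2)) - K * (1 / \<tau>))"
    by (intro has_bochner_integral_diff gauss_cos_integral has_bochner_integral_mult_right gauss_abs_integral)
       (use V \<tau> in auto)
  have "sqrt (2 * pi / V) * exp (- \<xi>\<^sup>2 / (2 * V)) - 2 / (d * V) - K / \<tau> = (\<integral>s. ?L s \<partial>lborel)"
    using L by (simp add: has_bochner_integral_iff field_simps)
  also have "\<dots> \<le> (\<integral>x. fejer d (x - \<xi>) \<partial>M)"
    unfolding expectation_fejer[OF d]
  proof (rule integral_mono)
    show "integrable lborel ?L" using L by (simp add: has_bochner_integral_iff)
    have gi: "integrable lborel (\<lambda>s. indicator {-d..d} s * (1 - \<bar>s\<bar> / d))"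
      using fejer_integral[OF d, of 0] by (simp add: has_bochner_integral_iff)
    show "integrable lborel (\<lambda>s. indicator {-d..d} s * (1 - \<bar>s\<bar> / d) * Re (iexp (- s * \<xi>) * char M s))"
    proof (rule Bochner_Integration.integrable_bound[OF gi])
      show "AE s in lborel. norm (indicator {-d..d} s * (1 - \<bar>s\<bar> / d) * Re (iexp (- s * \<xi>) * char M s))
         \<le> norm (indicator {-d..d} s * (1 - \<bar>s\<bar> / d))"
      proof (rule AE_I2)
        fix s
        have "\<bar>Re (iexp (- s * \<xi>) * char M s)\<bar> \<le> cmod (iexp (- s * \<xi>) * char M s)" by (rule abs_Re_le_cmod)
        also have "\<dots> \<le> 1" unfolding norm_mult using cmod_char_le_1[of s] by simp
        finally have 1: "\<bar>Re (iexp (- s * \<xi>) * char M s)\<bar> \<le> 1" .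
        show "norm (indicator {-d..d} s * (1 - \<bar>s\<bar> / d) * Re (iexp (- s * \<xi>) * char M s))
         \<le> norm (indicator {-d..d} s * (1 - \<bar>s\<bar> / d))"
          unfolding real_norm_def abs_mult[of _ "Re _"] by (rule mult_left_le[OF 1]) simp
      qed
    qed measurable
    fix s :: real
    define e where "e = exp (-(V/2) * s\<^sup>2)"
    have e: "0 < e" "e \<le> 1" using V by (auto simp: e_def)
    have ce: "\<bar>cos (s * \<xi>) * e\<bar> \<le> e" using e by (auto simp: abs_mult intro!: mult_left_le_one_le)
    show "?L s \<le> indicator {-d..d} s * (1 - \<bar>s\<bar> / d) * Re (iexp (- s * \<xi>) * char M s)"
    proof (cases "\<bar>s\<bar> \<le> d")
      case False
      have "1 * e \<le> \<bar>s\<bar> / d * e" using False d e by (intro mult_right_mono) auto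
      moreover have "0 \<le> K * (\<bar>s\<bar> * exp (-\<tau> * s\<^sup>2))" using K by simp
      moreover have "indicator {-d..d} s = (0::real)" using False by (auto simp: indicator_def)
      ultimately show ?thesis using ce unfolding e_def[symmetric] by (simp add: abs_if split: if_splits)
    next
      case True
      define z where "z = iexp (- s * \<xi>)"
      have "cmod (z * char M s - z * e) = cmod (char M s - e)"
        unfolding right_diff_distrib[symmetric] norm_mult by (simp add: z_def)
      also have "\<dots> \<le> K * \<bar>s\<bar> * exp (-\<tau> * s\<^sup>2)" using le[OF True] by (simp add: e_def)
      finally have "\<bar>Re (z * char M s - z * e)\<bar> \<le> K * \<bar>s\<bar> * exp (-\<tau> * s\<^sup>2)"
        using abs_Re_le_cmod order_trans by blast
      moreover have "Re (z * e) = cos (s * \<xi>) * e" by (simp add: z_def Re_exp)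
      ultimately have 1: "Re (z * char M s) \<ge> cos (s * \<xi>) * e - K * \<bar>s\<bar> * exp (-\<tau> * s\<^sup>2)" by auto
      define h where "h = 1 - \<bar>s\<bar> / d"
      have h: "0 \<le> h" "h \<le> 1" using True d by (auto simp: h_def)
      have "h * Re (z * char M s) \<ge> h * (cos (s * \<xi>) * e) - h * (K * \<bar>s\<bar> * exp (-\<tau> * s\<^sup>2))"
        using mult_left_mono[OF 1 h(1)] by (simp add: right_diff_distrib)
      moreover have "h * (K * \<bar>s\<bar> * exp (-\<tau> * s\<^sup>2)) \<le> K * \<bar>s\<bar> * exp (-\<tau> * s\<^sup>2)"
        using h K by (intro mult_left_le_one_le) auto
      moreover have "h * (cos (s * \<xi>) * e) \<ge> cos (s * \<xi>) * e - \<bar>s\<bar> / d * e"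
      proof -
        have "\<bar>s\<bar> / d * (cos (s * \<xi>) * e) \<le> \<bar>s\<bar> / d * e"
          using ce d by (intro mult_left_mono) auto
        then show ?thesis by (simp add: h_def left_diff_distrib)
      qed
      ultimately have "cos (s * \<xi>) * e - \<bar>s\<bar> / d * e - K * \<bar>s\<bar> * exp (-\<tau> * s\<^sup>2) \<le> h * Re (z * char M s)"
        by linarith
      moreover have "indicator {-d..d} s = (1::real)" using True by (auto simp: indicator_def)
      ultimately show ?thesis unfolding h_def z_def e_def by (simp only: mult.assoc mult_1 times_divide_eq_left)
    qed
  qed
  finally show ?thesis .
qed

end


text \<open>The two bounds on |t| have separate purposes. The first gives
  \<open>v * t\<^sup>2 \<le> 1\<close>, so that the quadratic approximation is a positive real
  number; the second makes the cubic error at most half of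
  \<open>v0 * t\<^sup>2 / 2\<close>.\<close>

lemma char_quadratic_decay:
  fixes \<psi> :: "real \<Rightarrow> complex"
  assumes v: "0 < v0" "v0 \<le> v" "v \<le> v1" and \<rho>: "0 \<le> \<rho>"
    and \<psi>: "\<And>t. cmod (\<psi> t - complex_of_real (1 - v * t\<^sup>2 / 2)) \<le> \<rho> * \<bar>t\<bar> ^ 3"
    and t: "\<bar>t\<bar> \<le> min (1 / (v1 + 1)) (v0 / (4 * (\<rho> + 1)))"
  shows "cmod (\<psi> t) \<le> exp (- (v0/4) * t\<^sup>2)"
    and "cmod (\<psi> t - complex_of_real (exp (- v * t\<^sup>2 / 2))) \<le> (\<rho> + v1\<^sup>2) * \<bar>t\<bar> ^ 3"
proof -
  have v1: "v1 > 0" using v by simp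
  have t1: "\<bar>t\<bar> \<le> 1 / (v1 + 1)" and t2: "\<bar>t\<bar> \<le> v0 / (4 * (\<rho> + 1))" using t by auto
  have tle1: "\<bar>t\<bar> \<le> 1" using t1 v1 by (smt (verit) divide_le_eq_1)
  have "v * t\<^sup>2 \<le> v1 * (\<bar>t\<bar> * \<bar>t\<bar>)" using v by (simp add: power2_eq_square mult_right_mono)
  also have "\<dots> \<le> v1 * (\<bar>t\<bar> * 1)" using v1 tle1 by (intro mult_left_mono) auto
  also have "\<dots> \<le> v1 * (1 / (v1 + 1))" using v1 t1 by (intro mult_left_mono) auto
  also have "\<dots> \<le> 1" using v1 by (simp add: divide_le_eq)
  finally have vt: "v * t\<^sup>2 \<le> 1" .
  have "\<bar>t\<bar> * (\<rho> + 1) \<le> v0 / (4 * (\<rho> + 1)) * (\<rho> + 1)" using t2 \<rho> by (intro mult_right_mono) auto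
  also have "\<dots> = v0 / 4" using \<rho> by (simp add: field_simps)
  finally have "\<rho> * \<bar>t\<bar> \<le> v0 / 4" by (simp add: algebra_simps)
  then have "\<rho> * \<bar>t\<bar> * t\<^sup>2 \<le> v0 / 4 * t\<^sup>2" by (intro mult_right_mono) auto
  then have r: "\<rho> * \<bar>t\<bar> ^ 3 \<le> v0 / 4 * t\<^sup>2" by (simp add: power3_eq_cube power2_eq_square mult_ac abs_mult_self_eq)
  have "cmod (\<psi> t) \<le> cmod (complex_of_real (1 - v * t\<^sup>2 / 2)) + cmod (\<psi> t - complex_of_real (1 - v * t\<^sup>2 / 2))"
    using norm_triangle_ineq[of "complex_of_real (1 - v * t\<^sup>2 / 2)" "\<psi> t - complex_of_real (1 - v * t\<^sup>2 / 2)"] by simp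
  also have "cmod (complex_of_real (1 - v * t\<^sup>2 / 2)) = 1 - v * t\<^sup>2 / 2"
    using vt by (simp only: norm_of_real)
  also have "1 - v * t\<^sup>2 / 2 + cmod (\<psi> t - complex_of_real (1 - v * t\<^sup>2 / 2)) \<le> 1 - v0 * t\<^sup>2 / 2 + v0 / 4 * t\<^sup>2"
    using \<psi>[of t] r mult_right_mono[OF v(2), of "t\<^sup>2"] by simp
  also have "\<dots> = 1 + (- (v0/4) * t\<^sup>2)" by simp
  also have "\<dots> \<le> exp (- (v0/4) * t\<^sup>2)" by (rule exp_ge_add_one_self)
  finally show "cmod (\<psi> t) \<le> exp (- (v0/4) * t\<^sup>2)" .
  define x where "x = v * t\<^sup>2 / 2"
  have x: "0 \<le> x" "x \<le> 1/2" using vt v by (auto simp: x_def)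
  have "exp (-x) \<le> 1 - x + x\<^sup>2"
  proof -
    have "exp (-x) = inverse (exp x)" by (rule exp_minus)
    also have "\<dots> \<le> inverse (1 + x)"
      using x exp_ge_add_one_self[of x] by (intro le_imp_inverse_le) auto
    also have "\<dots> \<le> 1 - x + x\<^sup>2"
    proof -
      have "1 \<le> 1 + x ^ 3" using x by simp
      also have "\<dots> = (1 - x + x\<^sup>2) * (1 + x)" by (simp add: algebra_simps power2_eq_square power3_eq_cube)
      finally show ?thesis using x by (simp add: inverse_eq_divide divide_le_eq)
    qed
    finally show ?thesis .
  qed
  moreover have "1 - x \<le> exp (-x)" using exp_ge_add_one_self[of "-x"] by simp
  ultimately have e: "\<bar>(1 - x) - exp (-x)\<bar> \<le> x\<^sup>2" by auto
  have "x\<^sup>2 = (v / 2)\<^sup>2 * \<bar>t\<bar> ^ 4" by (simp add: x_def power2_eq_square power4_eq_xxxx abs_mult_self_eq)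
  also have "\<dots> \<le> v1\<^sup>2 * \<bar>t\<bar> ^ 3"
    using v tle1 by (intro mult_mono power_mono power_decreasing) auto
  finally have x2: "x\<^sup>2 \<le> v1\<^sup>2 * \<bar>t\<bar> ^ 3" .
  have "cmod (\<psi> t - complex_of_real (exp (- x))) \<le> cmod (\<psi> t - complex_of_real (1 - v * t\<^sup>2 / 2)) + \<bar>(1 - x) - exp (-x)\<bar>"
    using norm_triangle_ineq[of "\<psi> t - complex_of_real (1 - x)" "complex_of_real ((1 - x) - exp (-x))"]
    unfolding norm_of_real x_def by (simp add: algebra_simps)
  also have "\<dots> \<le> \<rho> * \<bar>t\<bar> ^ 3 + v1\<^sup>2 * \<bar>t\<bar> ^ 3" using \<psi>[of t] e x2 by linarith
  finally show "cmod (\<psi> t - complex_of_real (exp (- v * t\<^sup>2 / 2))) \<le> (\<rho> + v1\<^sup>2) * \<bar>t\<bar> ^ 3"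
    by (simp add: x_def distrib_right)
qed

text \<open>Scaling by \<open>r\<close> reduces the claim to the unit disc. The factor
  \<open>r ^ (n - 1)\<close> preserves the decay of the powers.\<close>

lemma norm_power_diff_le:
  fixes z w :: complex
  assumes "cmod z \<le> r" "cmod w \<le> r" "r > 0" "n \<ge> 1"
  shows "cmod (z ^ n - w ^ n) \<le> n * r ^ (n - 1) * cmod (z - w)"
proof -
  have "cmod ((z / r) ^ n - (w / r) ^ n) \<le> n * cmod (z / r - w / r)"
    using assms by (intro norm_power_diff) (auto simp: norm_divide)
  moreover have "(z / r) ^ n - (w / r) ^ n = (z ^ n - w ^ n) / complex_of_real (r ^ n)"
    by (simp add: power_divide diff_divide_distrib)
  moreover have "z / r - w / r = (z - w) / complex_of_real r" by (simp add: diff_divide_distrib)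
  ultimately have "cmod (z ^ n - w ^ n) / r ^ n \<le> n * (cmod (z - w) / r)"
    using assms by (simp only: norm_divide norm_of_real) simp
  then have "cmod (z ^ n - w ^ n) \<le> n * (cmod (z - w) / r) * r ^ n"
    using assms by (simp add: divide_le_eq)
  also have "r ^ n = r * r ^ (n - 1)" using assms by (metis Suc_diff_1 less_le_trans power_Suc zero_less_one)
  finally show ?thesis using assms by (simp add: mult_ac)
qed

text \<open>The Fejer average with cutoff d is at least 3/4 of g / sqrt n. Its part from outside the
  window is estimated by \<open>concentration\<close> with the smaller cutoff \<open>1 / A\<close>,
  which makes it a multiple of 1/A. For large A at most a third of the average is lost; the rest
  comes from the window, where the kernel is at most d. The constants depend on v0, v1, \<rho> and D
  alone, so they serve all laws of the family at once.\<close>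

lemma local_lower_bound:
  fixes v0 v1 \<rho> D :: real
  assumes v0: "0 < v0" and v01: "v0 \<le> v1" and \<rho>: "0 \<le> \<rho>"
  obtains A c n0 where "A > 0" "c > 0"
    "\<And>Q n \<xi> v \<psi>. real_distribution Q \<Longrightarrow> n \<ge> (n0::nat) \<Longrightarrow> v0 \<le> v \<Longrightarrow> v \<le> v1
      \<Longrightarrow> (\<And>t. cmod (\<psi> t - complex_of_real (1 - v * t\<^sup>2 / 2)) \<le> \<rho> * \<bar>t\<bar> ^ 3)
      \<Longrightarrow> (\<And>t. char Q t = \<psi> t ^ n) \<Longrightarrow> \<bar>\<xi>\<bar> \<le> D * sqrt n
      \<Longrightarrow> measure Q {\<xi> - A..\<xi> + A} \<ge> c / sqrt n"
proof -
  define d where "d = min (1 / (v1 + 1)) (v0 / (4 * (\<rho> + 1)))"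
  have v1: "v1 > 0" using v0 v01 by simp
  have d: "d > 0" using v0 v1 \<rho> by (auto simp: d_def intro!: divide_pos_pos)
  define K where "K = (\<rho> + v1\<^sup>2) * (16 / v0)"
  have K: "K \<ge> 0" using \<rho> v0 by (auto simp: K_def)
  define g where "g = sqrt (2 * pi / v1) * exp (- D\<^sup>2 / (2 * v0))"
  have g: "g > 0" using v1 by (auto simp: g_def)
  define C1 where "C1 = 2 / (d * v0) + 16 * K / v0"
  have C1: "C1 \<ge> 0" using d v0 K by (auto simp: C1_def)
  define C2 where "C2 = 4 / d * (1 + pi)\<^sup>2 * (1 / 2 * sqrt (4 * pi / v0))"
  have C2: "C2 > 0" unfolding C2_def using d v0 by (intro mult_pos_pos divide_pos_pos zero_less_power add_pos_pos) auto
  \<comment> \<open>Two demands on \<open>A\<close>: \<open>1 / A \<le> d\<close>, so that the decay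
    of the characteristic function holds up to the cutoff \<open>1 / A\<close>, and
    \<open>C2 / A \<le> g / 4\<close> for the loss outside the window.\<close>
  define A where "A = max (1 / d) (4 * C2 / g)"
  have A: "A > 0" "1 / A \<le> d" "C2 / A \<le> g / 4"
  proof -
    show A0: "A > 0" using d by (auto simp: A_def less_max_iff_disj)
    have "1 / d \<le> A" "4 * C2 / g \<le> A" by (auto simp: A_def)
    then show "1 / A \<le> d" "C2 / A \<le> g / 4" using A0 d g by (auto simp: field_simps)
  qed
  obtain n0 :: nat where n0: "n0 \<ge> 2" "real n0 \<ge> (4 * C1 / g)\<^sup>2"
  proof -
    obtain m :: nat where "real m \<ge> (4 * C1 / g)\<^sup>2" using real_arch_simple by blast
    then show ?thesis by (intro that[of "m + 2"]) auto
  qed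
  show ?thesis
  proof (rule that[of A "g / (2 * d)" n0])
    show "A > 0" by fact
    show "g / (2 * d) > 0" using g d by simp
    fix Q n \<xi> v \<psi>
    assume Q: "real_distribution Q" and n: "n \<ge> n0" and v: "v0 \<le> v" "v \<le> v1"
      and \<psi>: "\<And>t. cmod (\<psi> t - complex_of_real (1 - v * t\<^sup>2 / 2)) \<le> \<rho> * \<bar>t\<bar> ^ 3"
      and ch: "\<And>t. char Q t = \<psi> t ^ n" and \<xi>: "\<bar>\<xi>\<bar> \<le> D * sqrt n"
    interpret real_distribution Q by (rule Q)
    have n2: "n \<ge> 2" using n n0 by simp
    note dec = char_quadratic_decay[OF v0 v \<rho> \<psi>, folded d_def]
    have vp: "v > 0" using v v0 by simp
    have up: "cmod (char Q t) \<le> exp (- (v0 * n / 4) * t\<^sup>2)" if "\<bar>t\<bar> \<le> d" for t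
    proof -
      have "cmod (char Q t) \<le> exp (- (v0/4) * t\<^sup>2) ^ n"
        unfolding ch norm_power using dec(1)[OF that] by (intro power_mono) auto
      then show ?thesis by (simp add: exp_of_nat_mult[symmetric] mult_ac)
    qed
    have "(\<integral>x. fejer d (x - \<xi>) \<partial>Q) \<ge> sqrt (2 * pi / (v * n)) * exp (- \<xi>\<^sup>2 / (2 * (v * n))) - 2 / (d * (v * n)) - K / (v0 * n / 16)"
    proof (rule expectation_fejer_ge[OF d])
      show "v0 * n / 16 > 0" "v * n > 0" using v0 vp n2 by auto
      fix t :: real assume t: "\<bar>t\<bar> \<le> d"
      have e: "exp (- v * t\<^sup>2 / 2) \<le> exp (- (v0/4) * t\<^sup>2)"
      proof -
        have "v0 * t\<^sup>2 \<le> v * t\<^sup>2" using v by (intro mult_right_mono) auto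
        moreover have "0 \<le> v0 * t\<^sup>2" using v0 by simp
        ultimately show ?thesis by simp
      qed
      have "cmod (char Q t - exp (- ((v * n)/2) * t\<^sup>2)) = cmod (\<psi> t ^ n - complex_of_real (exp (- v * t\<^sup>2 / 2)) ^ n)"
        unfolding ch by (simp add: exp_of_nat_mult[symmetric] of_real_power[symmetric] mult_ac del: of_real_power)
      also have "\<dots> \<le> n * exp (- (v0/4) * t\<^sup>2) ^ (n - 1) * cmod (\<psi> t - complex_of_real (exp (- v * t\<^sup>2 / 2)))"
        using dec(1)[OF t] e n2 by (intro norm_power_diff_le) auto
      also have "\<dots> \<le> n * exp (- (v0 * n / 8) * t\<^sup>2) * ((\<rho> + v1\<^sup>2) * \<bar>t\<bar> ^ 3)"
      proof -
      have "exp (- (v0/4) * t\<^sup>2) ^ (n - 1) \<le> exp (- (v0 * n / 8) * t\<^sup>2)"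
      proof -
        have "exp (- (v0/4) * t\<^sup>2) ^ (n - 1) = exp (- (real (n - 1) * (v0 * t\<^sup>2 / 4)))"
          by (simp add: exp_of_nat_mult[symmetric])
        moreover have "real n / 2 * (v0 * t\<^sup>2 / 4) \<le> real (n - 1) * (v0 * t\<^sup>2 / 4)"
          using v0 n2 by (intro mult_right_mono) auto
        ultimately show ?thesis by (simp add: mult_ac)
      qed
      then show ?thesis using dec(2)[OF t] by (intro mult_mono) auto
      qed
      \<comment> \<open>Half of the remaining decay absorbs n t^2, because x exp (- x) is at most 1.
        One factor |t| is left, with a constant \<open>K\<close> that does not depend on n.\<close>
      also have "exp (- (v0 * n / 8) * t\<^sup>2) = exp (- (v0 * n / 16) * t\<^sup>2) * exp (- (v0 * n / 16) * t\<^sup>2)"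
        unfolding exp_add[symmetric] by (simp add: field_simps)
      also have "n * (exp (- (v0 * n / 16) * t\<^sup>2) * exp (- (v0 * n / 16) * t\<^sup>2)) * ((\<rho> + v1\<^sup>2) * \<bar>t\<bar> ^ 3)
          = K * \<bar>t\<bar> * exp (- (v0 * n / 16) * t\<^sup>2) * ((v0 * n / 16) * t\<^sup>2 * exp (- (v0 * n / 16) * t\<^sup>2))"
        using v0 by (simp add: K_def power3_eq_cube power2_eq_square abs_mult_self_eq mult_ac)
      also have "\<dots> \<le> K * \<bar>t\<bar> * exp (- (v0 * n / 16) * t\<^sup>2) * 1"
      proof (rule mult_left_mono)
        have "(v0 * n / 16) * t\<^sup>2 \<le> exp ((v0 * n / 16) * t\<^sup>2)"
          using exp_ge_add_one_self[of "(v0 * n / 16) * t\<^sup>2"] by linarith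
        then show "(v0 * n / 16) * t\<^sup>2 * exp (- (v0 * n / 16) * t\<^sup>2) \<le> 1" by (simp add: exp_minus field_simps)
      qed (use K in simp)
      finally show "cmod (char Q t - complex_of_real (exp (- ((v * n)/2) * t\<^sup>2))) \<le> K * \<bar>t\<bar> * exp (- (v0 * n / 16) * t\<^sup>2)"
        by simp
    qed (use K in auto)
    moreover have "sqrt (2 * pi / (v * n)) * exp (- \<xi>\<^sup>2 / (2 * (v * n))) \<ge> g / sqrt n"
    proof -
      have "sqrt (2 * pi / (v1 * n)) \<le> sqrt (2 * pi / (v * n))"
        using vp v n2 by (intro real_sqrt_le_mono divide_left_mono mult_right_mono) auto
      moreover have "\<xi>\<^sup>2 \<le> D\<^sup>2 * n"
      proof -
        have "\<xi>\<^sup>2 \<le> (D * sqrt n)\<^sup>2" using \<xi> by (metis abs_ge_zero power2_abs power_mono)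
        then show ?thesis by (simp add: power_mult_distrib)
      qed
      then have "\<xi>\<^sup>2 / (2 * (v * n)) \<le> D\<^sup>2 * n / (2 * (v0 * n))"
        using v0 v n2 by (intro frac_le) auto
      then have "exp (- D\<^sup>2 / (2 * v0)) \<le> exp (- \<xi>\<^sup>2 / (2 * (v * n)))" using n2 by simp
      ultimately have "sqrt (2 * pi / (v1 * n)) * exp (- D\<^sup>2 / (2 * v0)) \<le> sqrt (2 * pi / (v * n)) * exp (- \<xi>\<^sup>2 / (2 * (v * n)))"
        using v1 vp by (intro mult_mono) auto
      then show ?thesis by (simp add: g_def real_sqrt_divide real_sqrt_mult)
    qed
    moreover have "2 / (d * (v * n)) + K / (v0 * n / 16) \<le> C1 / n"
    proof -
      have "2 / (d * (v * n)) \<le> 2 / (d * (v0 * n))"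
        using v v0 d n2 by (intro divide_left_mono mult_left_mono mult_right_mono) auto
      moreover have "C1 / n = 2 / (d * (v0 * n)) + K / (v0 * n / 16)"
        unfolding C1_def by (simp add: add_divide_distrib mult_ac)
      ultimately show ?thesis by linarith
    qed
    moreover have "C1 / n \<le> g / 4 / sqrt n"
    proof -
      have "(4 * C1 / g)\<^sup>2 \<le> real n" using n0 n by simp
      then have "4 * C1 / g \<le> sqrt n" by (rule real_le_rsqrt)
      then have "g / 4 * (4 * C1 / g) \<le> g / 4 * sqrt n" using g by (intro mult_left_mono) auto
      then have "C1 \<le> g / 4 * sqrt n" using g by simp
      then have "C1 / n \<le> g / 4 * sqrt n / n" by (intro divide_right_mono) auto
      also have "g / 4 * sqrt n / n = g / 4 * inverse (sqrt n)"
        unfolding times_divide_eq_right[symmetric] sqrt_divide_self_eq[OF of_nat_0_le_iff] ..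
      also have "\<dots> = g / 4 / sqrt n" by (rule divide_inverse[symmetric])
      finally show ?thesis .
    qed
    moreover have "g / 4 / sqrt n = (g / sqrt n) / 4" "3 / 4 * g / sqrt n = 3 / 4 * (g / sqrt n)" by simp_all
    ultimately have 1: "(\<integral>x. fejer d (x - \<xi>) \<partial>Q) \<ge> 3 / 4 * g / sqrt n" by linarith
    \<comment> \<open>In the window the kernel is at most \<open>d\<close>. Outside, its tail is
      comparable to the test function of \<open>concentration\<close> with cutoff
      \<open>1 / A\<close>: for \<open>y > A\<close> one has
      \<open>y + pi * A \<le> (1 + pi) * y\<close>, the origin of the factor
      \<open>(1 + pi)\<^sup>2\<close>.\<close>
    have "(\<integral>x. fejer d (x - \<xi>) \<partial>Q) \<le> (\<integral>x. d * indicator {\<xi> - A..\<xi> + A} x + 4 / d * (1 + pi)\<^sup>2 * (1 / (\<bar>x - \<xi>\<bar> + pi * A)\<^sup>2) \<partial>Q)"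
    proof (rule integral_mono)
      have "1 / (\<bar>x - \<xi>\<bar> + pi * A)\<^sup>2 \<le> 1 / (pi * A)\<^sup>2" for x
        using A by (intro divide_left_mono power_mono mult_pos_pos zero_less_power add_nonneg_pos) auto
      then have "integrable Q (\<lambda>x. 1 / (\<bar>x - \<xi>\<bar> + pi * A)\<^sup>2)"
        by (intro integrable_const_bound[where B = "1 / (pi * A)\<^sup>2"]) auto
      then show "integrable Q (\<lambda>x. d * indicator {\<xi> - A..\<xi> + A} x + 4 / d * (1 + pi)\<^sup>2 * (1 / (\<bar>x - \<xi>\<bar> + pi * A)\<^sup>2))"
        by (intro Bochner_Integration.integrable_add integrable_mult_right integrable_real_indicator)
           (auto simp: emeasure_eq_measure)
      fix x
      have pos: "0 \<le> 4 / d * (1 + pi)\<^sup>2 * (1 / (\<bar>x - \<xi>\<bar> + pi * A)\<^sup>2)"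
        using d by (intro mult_nonneg_nonneg) auto
      show "fejer d (x - \<xi>) \<le> d * indicator {\<xi> - A..\<xi> + A} x + 4 / d * (1 + pi)\<^sup>2 * (1 / (\<bar>x - \<xi>\<bar> + pi * A)\<^sup>2)"
      proof (cases "\<bar>x - \<xi>\<bar> \<le> A")
        case True
        then have "indicator {\<xi> - A..\<xi> + A} x = (1::real)" by (auto simp: indicator_def)
        then show ?thesis using fejer_le[OF d, of "x - \<xi>"] pos by simp
      next
        case False
        define y where "y = \<bar>x - \<xi>\<bar>"
        have y: "y > A" "y > 0" using False A by (auto simp: y_def)
        have "(y + pi * A)\<^sup>2 \<le> ((1 + pi) * y)\<^sup>2"
          using y A by (intro power_mono) (auto simp: distrib_right)
        then have "1 / ((1 + pi) * y)\<^sup>2 \<le> 1 / (y + pi * A)\<^sup>2"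
          using y A by (intro divide_left_mono mult_pos_pos zero_less_power add_pos_pos) auto
        then have "(1 + pi)\<^sup>2 * (1 / ((1 + pi) * y)\<^sup>2) \<le> (1 + pi)\<^sup>2 * (1 / (y + pi * A)\<^sup>2)"
          by (intro mult_left_mono) auto
        moreover have "(1 + pi)\<^sup>2 * (1 / ((1 + pi) * y)\<^sup>2) = 1 / y\<^sup>2"
          using pi_gt_zero by (simp add: power_mult_distrib add_nonneg_eq_0_iff)
        ultimately have "1 / y\<^sup>2 \<le> (1 + pi)\<^sup>2 * (1 / (y + pi * A)\<^sup>2)" by simp
        then have "4 / d * (1 / y\<^sup>2) \<le> 4 / d * ((1 + pi)\<^sup>2 * (1 / (y + pi * A)\<^sup>2))"
          using d by (intro mult_left_mono) auto
        moreover have "fejer d (x - \<xi>) \<le> 4 / d * (1 / y\<^sup>2)"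
          using fejer_le_tail[OF d, of "x - \<xi>"] y by (simp add: y_def)
        moreover have "0 \<le> d * indicator {\<xi> - A..\<xi> + A} x" using d by simp
        ultimately show ?thesis unfolding y_def by (simp add: mult.assoc)
      qed
    qed (use d in simp)
    also have "\<dots> = d * measure Q {\<xi> - A..\<xi> + A} + 4 / d * (1 + pi)\<^sup>2 * (\<integral>x. 1 / (\<bar>x - \<xi>\<bar> + pi * A)\<^sup>2 \<partial>Q)"
    proof -
      have "1 / (\<bar>x - \<xi>\<bar> + pi * A)\<^sup>2 \<le> 1 / (pi * A)\<^sup>2" for x
        using A by (intro divide_left_mono power_mono mult_pos_pos zero_less_power add_nonneg_pos) auto
      then have "integrable Q (\<lambda>x. 1 / (\<bar>x - \<xi>\<bar> + pi * A)\<^sup>2)"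
        by (intro integrable_const_bound[where B = "1 / (pi * A)\<^sup>2"]) auto
      then have "integrable Q (\<lambda>x. 4 / d * (1 + pi)\<^sup>2 * (1 / (\<bar>x - \<xi>\<bar> + pi * A)\<^sup>2))" by (rule integrable_mult_right)
      moreover have "integrable Q (\<lambda>x. d * indicator {\<xi> - A..\<xi> + A} x)"
        by (intro integrable_mult_right integrable_real_indicator) (auto simp: emeasure_eq_measure)
      ultimately show ?thesis
        by (subst Bochner_Integration.integral_add) (simp_all only: integral_mult_right_zero, simp)
    qed
    also have "\<dots> \<le> d * measure Q {\<xi> - A..\<xi> + A} +
        4 / d * (1 + pi)\<^sup>2 * ((1 / A) / 2 * sqrt (pi / (v0 * n / 4)))"
    proof -
      have "(\<integral>x. 1 / (\<bar>x - \<xi>\<bar> + pi * A)\<^sup>2 \<partial>Q) \<le> (1 / A) / 2 * sqrt (pi / (v0 * n / 4))"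
        using concentration[of "1 / A" "v0 * n / 4" \<xi>] up A v0 n2 by auto
      then show ?thesis using d by (intro add_left_mono mult_left_mono) auto
    qed
    also have "4 / d * (1 + pi)\<^sup>2 * ((1 / A) / 2 * sqrt (pi / (v0 * n / 4))) = C2 / A / sqrt n"
    proof -
      have "pi / (v0 * n / 4) = (4 * pi / v0) / n" by simp
      then have "sqrt (pi / (v0 * n / 4)) = sqrt (4 * pi / v0) / sqrt n" by (simp only: real_sqrt_divide)
      then show ?thesis unfolding C2_def by (simp only:) simp
    qed
    also have "C2 / A / sqrt n \<le> g / 4 / sqrt n" using A(3) by (rule divide_right_mono) simp
    finally have "d * measure Q {\<xi> - A..\<xi> + A} \<ge> 3 / 4 * g / sqrt n - g / 4 / sqrt n" using 1 by linarith
    also have "3 / 4 * g / sqrt n - g / 4 / sqrt n = g / 2 / sqrt n"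
      by (simp add: diff_divide_distrib[symmetric])
    finally have "d * measure Q {\<xi> - A..\<xi> + A} \<ge> g / 2 / sqrt n" by simp
    then have "g / 2 / sqrt n / d \<le> measure Q {\<xi> - A..\<xi> + A}" using d by (simp only: pos_divide_le_eq mult.commute)
    then show "g / (2 * d) / sqrt n \<le> measure Q {\<xi> - A..\<xi> + A}" by (simp add: mult_ac)
  qed
qed

section \<open>Laplace transforms of nonnegative random variables\<close>

text \<open>Up to the sign (-1)^k the k-th derivative of the Laplace transform. Accordingly
  \<open>tmean\<close> and \<open>tvar\<close> are mean and variance of Y under the tilted law,
  whose density is proportional to \<open>exp (- z * Y)\<close>.\<close>

definition lap :: "'a measure \<Rightarrow> ('a \<Rightarrow> real) \<Rightarrow> nat \<Rightarrow> real \<Rightarrow> real" where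
  "lap M Y k z = (\<integral>\<omega>. Y \<omega> ^ k * exp (- z * Y \<omega>) \<partial>M)"

definition tmean :: "'a measure \<Rightarrow> ('a \<Rightarrow> real) \<Rightarrow> real \<Rightarrow> real" where
  "tmean M Y z = lap M Y 1 z / lap M Y 0 z"

definition tvar :: "'a measure \<Rightarrow> ('a \<Rightarrow> real) \<Rightarrow> real \<Rightarrow> real" where
  "tvar M Y z = lap M Y 2 z / lap M Y 0 z - (tmean M Y z)\<^sup>2"

lemma power_le_fact_exp:
  fixes x :: real assumes "x \<ge> 0" shows "x ^ k \<le> fact k * exp x"
proof -
  have "x ^ k /\<^sub>R fact k = (\<Sum>i\<in>{k}. x ^ i /\<^sub>R fact i)" by simp
  also have "\<dots> \<le> (\<Sum>i. x ^ i /\<^sub>R fact i)"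
    using assms by (intro sum_le_suminf summable_exp_generic) auto
  finally show ?thesis by (simp add: exp_def field_simps)
qed

lemma exp_remainder_le:
  fixes x :: real shows "\<bar>exp x - 1 - x\<bar> \<le> x\<^sup>2 * exp \<bar>x\<bar>"
proof -
  have 0: "exp x - 1 - x \<ge> 0" using exp_ge_add_one_self[of x] by linarith
  have "exp x * (1 - x) \<le> exp x * exp (- x)"
    using exp_ge_add_one_self[of "-x"] by (intro mult_left_mono) auto
  then have 1: "exp x - 1 - x \<le> x * (exp x - 1)" by (simp add: exp_minus algebra_simps)
  have "x * (exp x - 1) \<le> x\<^sup>2 * exp \<bar>x\<bar>"
  proof (cases "x \<ge> 0")
    case True
    have "exp x - 1 \<le> x * exp x" using 1 by (simp add: algebra_simps)
    then have "x * (exp x - 1) \<le> x * (x * exp x)" using True by (intro mult_left_mono) auto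
    then show ?thesis using True by (simp add: power2_eq_square)
  next
    case False
    have "(- x) * (1 - exp x) \<le> (- x) * (- x)"
    proof (rule mult_left_mono)
      show "1 - exp x \<le> - x" using exp_ge_add_one_self[of x] by linarith
    qed (use False in simp)
    also have "\<dots> \<le> x\<^sup>2 * exp \<bar>x\<bar>"
      using mult_left_mono[of 1 "exp \<bar>x\<bar>" "x\<^sup>2"] by (simp add: power2_eq_square)
    finally show ?thesis by (simp add: algebra_simps)
  qed
  with 0 1 show ?thesis by auto
qed

lemma mult_exp_minus_le: fixes x :: real shows "x * exp (- x) \<le> 1"
proof -
  have "x \<le> exp x" using exp_ge_add_one_self[of x] by linarith
  then show ?thesis by (simp add: exp_minus field_simps)
qed

locale nonneg_rv = prob_space M for M :: "'a measure" +
  fixes Y :: "'a \<Rightarrow> real"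
  assumes Y_measurable [measurable]: "Y \<in> borel_measurable M"
    and Y_nonneg: "AE \<omega> in M. 0 \<le> Y \<omega>"
begin

lemma integrable_lap [simp]:
  assumes "z > 0" shows "integrable M (\<lambda>\<omega>. Y \<omega> ^ k * exp (- z * Y \<omega>))"
proof (rule integrable_const_bound[where B = "fact k / z ^ k"])
  show "AE \<omega> in M. norm (Y \<omega> ^ k * exp (- z * Y \<omega>)) \<le> fact k / z ^ k"
    using Y_nonneg
  proof eventually_elim
    case (elim \<omega>)
    then have "(z * Y \<omega>) ^ k \<le> fact k * exp (z * Y \<omega>)"
      using assms by (intro power_le_fact_exp) auto
    then show ?case using elim assms
      by (simp add: power_mult_distrib exp_minus field_simps)
  qed
qed measurable

lemma integrable_lap0 [simp]: "z > 0 \<Longrightarrow> integrable M (\<lambda>\<omega>. exp (- (z * Y \<omega>)))"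
  using integrable_lap[of z 0] by simp

lemma lap_nonneg: "lap M Y k z \<ge> 0"
  unfolding lap_def using Y_nonneg by (intro integral_nonneg_AE) (auto elim: eventually_mono)

lemma lap0_le_1: "z > 0 \<Longrightarrow> lap M Y 0 z \<le> 1"
proof -
  assume z: "z > 0"
  have "lap M Y 0 z \<le> (\<integral>\<omega>. 1 \<partial>M)"
    unfolding lap_def by (rule integral_mono_AE) (use z Y_nonneg in \<open>auto elim: eventually_mono\<close>)
  then show ?thesis by (simp add: prob_space)
qed

lemma lap0_pos: assumes "z > 0" shows "lap M Y 0 z > 0"
proof -
  have "lap M Y 0 z \<noteq> 0"
  proof
    assume "lap M Y 0 z = 0"
    then have "AE \<omega> in M. exp (- z * Y \<omega>) = 0"
      using assms integral_nonneg_eq_0_iff_AE[of M "\<lambda>\<omega>. exp (- z * Y \<omega>)"] by (simp add: lap_def)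
    then have "AE \<omega> in M. False" by simp
    then show False by simp
  qed
  with lap_nonneg[of 0 z] show ?thesis by simp
qed

text \<open>Differentiation under the integral with an explicit remainder: for |h| \<le> z/2 the
  second-order term is at most h^2 Y^(k+2) exp (- z Y / 2), which is integrable because all moments
  are finite after tilting.\<close>

lemma DERIV_lap:
  assumes z: "z > 0"
  shows "(lap M Y k has_real_derivative - lap M Y (Suc k) z) (at z)"
  unfolding DERIV_def
proof -
  let ?C = "lap M Y (k + 2) (z / 2)"
  have bnd: "\<bar>(lap M Y k (z + h) - lap M Y k z) / h - (- lap M Y (Suc k) z)\<bar> \<le> \<bar>h\<bar> * ?C"
    if h: "h \<noteq> 0" "\<bar>h\<bar> \<le> z / 2" for h
  proof -
    have zh: "z + h > 0" using h z by (simp add: abs_if split: if_splits)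
    have eq: "lap M Y k (z + h) - lap M Y k z + h * lap M Y (Suc k) z =
      (\<integral>\<omega>. Y \<omega> ^ k * exp (- z * Y \<omega>) * (exp (- h * Y \<omega>) - 1 - (- h * Y \<omega>)) \<partial>M)"
    proof -
      have "lap M Y k (z + h) - lap M Y k z + h * lap M Y (Suc k) z =
        (\<integral>\<omega>. Y \<omega> ^ k * exp (- (z + h) * Y \<omega>) - Y \<omega> ^ k * exp (- z * Y \<omega>) + h * (Y \<omega> ^ Suc k * exp (- z * Y \<omega>)) \<partial>M)"
        unfolding lap_def using integrable_lap[OF z] integrable_lap[OF zh]
        by (simp del: power_Suc)
      also have "\<dots> = (\<integral>\<omega>. Y \<omega> ^ k * exp (- z * Y \<omega>) * (exp (- h * Y \<omega>) - 1 - (- h * Y \<omega>)) \<partial>M)"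
        by (intro Bochner_Integration.integral_cong refl)
           (simp add: algebra_simps exp_add[symmetric])
      finally show ?thesis .
    qed
    have "\<bar>lap M Y k (z + h) - lap M Y k z + h * lap M Y (Suc k) z\<bar> \<le> (\<integral>\<omega>. h\<^sup>2 * (Y \<omega> ^ (k + 2) * exp (- (z / 2) * Y \<omega>)) \<partial>M)"
      unfolding eq
    proof (rule integral_abs_bound[THEN order_trans], rule integral_mono_AE')
      show "integrable M (\<lambda>\<omega>. h\<^sup>2 * (Y \<omega> ^ (k + 2) * exp (- (z / 2) * Y \<omega>)))"
        using z integrable_lap[of "z/2" "k+2"] by (intro integrable_mult_right) auto
      show "AE \<omega> in M. \<bar>Y \<omega> ^ k * exp (- z * Y \<omega>) * (exp (- h * Y \<omega>) - 1 - (- h * Y \<omega>))\<bar>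
          \<le> h\<^sup>2 * (Y \<omega> ^ (k + 2) * exp (- (z / 2) * Y \<omega>))"
        using Y_nonneg
      proof eventually_elim
        case (elim \<omega>)
        have "\<bar>exp (- h * Y \<omega>) - 1 - (- h * Y \<omega>)\<bar> \<le> (- h * Y \<omega>)\<^sup>2 * exp \<bar>- h * Y \<omega>\<bar>"
          by (rule exp_remainder_le)
        also have "\<dots> \<le> (- h * Y \<omega>)\<^sup>2 * exp (z / 2 * Y \<omega>)"
        proof -
          have "\<bar>h\<bar> * Y \<omega> \<le> z / 2 * Y \<omega>" using h elim by (intro mult_right_mono) auto
          then show ?thesis using elim by (intro mult_left_mono) (auto simp: abs_mult)
        qed
        finally have "Y \<omega> ^ k * exp (- z * Y \<omega>) * \<bar>exp (- h * Y \<omega>) - 1 - (- h * Y \<omega>)\<bar>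
           \<le> Y \<omega> ^ k * exp (- z * Y \<omega>) * ((- h * Y \<omega>)\<^sup>2 * exp (z / 2 * Y \<omega>))"
          using elim by (intro mult_left_mono) auto
        also have "\<dots> = h\<^sup>2 * (Y \<omega> ^ (k + 2) * (exp (- z * Y \<omega>) * exp (z / 2 * Y \<omega>)))"
          by (simp add: power_add power2_eq_square mult_ac)
        also have "exp (- z * Y \<omega>) * exp (z / 2 * Y \<omega>) = exp (- (z / 2) * Y \<omega>)"
          unfolding exp_add[symmetric] by (simp add: algebra_simps)
        finally show ?case using elim by (simp add: abs_mult)
      qed
    qed (use Y_nonneg in \<open>auto elim: eventually_mono\<close>)
    also have "\<dots> = h\<^sup>2 * ?C" unfolding lap_def by simp
    finally have "\<bar>lap M Y k (z + h) - lap M Y k z + h * lap M Y (Suc k) z\<bar> \<le> h\<^sup>2 * ?C" .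
    moreover have "(lap M Y k (z + h) - lap M Y k z) / h - (- lap M Y (Suc k) z) =
      (lap M Y k (z + h) - lap M Y k z + h * lap M Y (Suc k) z) / h" using h by (simp add: field_simps)
    ultimately have "\<bar>(lap M Y k (z + h) - lap M Y k z) / h - (- lap M Y (Suc k) z)\<bar> \<le> h\<^sup>2 * ?C / \<bar>h\<bar>"
      by (simp add: abs_divide divide_right_mono)
    also have "h\<^sup>2 * ?C / \<bar>h\<bar> = \<bar>h\<bar> * ?C" using h by (simp add: power2_eq_square abs_if)
    finally show ?thesis .
  qed
  have "((\<lambda>h. (lap M Y k (z + h) - lap M Y k z) / h - (- lap M Y (Suc k) z)) \<longlongrightarrow> 0) (at 0)"
  proof (rule Lim_null_comparison)
    show "\<forall>\<^sub>F h in at 0. norm ((lap M Y k (z + h) - lap M Y k z) / h - (- lap M Y (Suc k) z)) \<le> \<bar>h\<bar> * ?C"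
      unfolding eventually_at using z bnd by (intro exI[of _ "z/2"]) (auto simp: dist_real_def)
    show "((\<lambda>h. \<bar>h\<bar> * ?C) \<longlongrightarrow> 0) (at 0)"
      by (auto intro!: tendsto_eq_intros)
  qed
  then show "(\<lambda>h. (lap M Y k (z + h) - lap M Y k z) / h) \<midarrow>0\<rightarrow> - lap M Y (Suc k) z"
    by (rule LIM_zero_cancel)
qed

lemma DERIV_log_lap: "z > 0 \<Longrightarrow> ((\<lambda>z. - ln (lap M Y 0 z)) has_real_derivative tmean M Y z) (at z)"
  using lap0_pos[of z] by (auto intro!: derivative_eq_intros DERIV_lap[of z 0] simp: tmean_def field_simps)

lemma DERIV_tmean: "z > 0 \<Longrightarrow> (tmean M Y has_real_derivative - tvar M Y z) (at z)"
proof -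
  assume z: "z > 0"
  have "((\<lambda>z. lap M Y 1 z / lap M Y 0 z) has_real_derivative - tvar M Y z) (at z)"
    using lap0_pos[OF z]
    by (auto intro!: derivative_eq_intros DERIV_lap[OF z] simp: tvar_def tmean_def numeral_2_eq_2 field_simps power2_eq_square)
  then show ?thesis unfolding tmean_def[abs_def] .
qed

text \<open>The decomposition into variance and squared bias under the tilted law. Every centre c
  bounds the variance from above; the choice \<open>c = mu\<close> later removes the main
  atom.\<close>

lemma second_moment_tilted:
  assumes z: "z > 0"
  shows "integrable M (\<lambda>\<omega>. (Y \<omega> - c)\<^sup>2 * exp (- z * Y \<omega>))"
    and "(\<integral>\<omega>. (Y \<omega> - c)\<^sup>2 * exp (- z * Y \<omega>) \<partial>M) = lap M Y 0 z * (tvar M Y z + (tmean M Y z - c)\<^sup>2)"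
proof -
  have eq: "(Y \<omega> - c)\<^sup>2 * exp (- z * Y \<omega>) = Y \<omega> ^ 2 * exp (- z * Y \<omega>) - 2 * c * (Y \<omega> ^ 1 * exp (- z * Y \<omega>)) + c\<^sup>2 * (Y \<omega> ^ 0 * exp (- z * Y \<omega>))" for \<omega>
    by (simp add: power2_eq_square algebra_simps)
  show "integrable M (\<lambda>\<omega>. (Y \<omega> - c)\<^sup>2 * exp (- z * Y \<omega>))"
    unfolding eq using integrable_lap[OF z]
    by (intro Bochner_Integration.integrable_add Bochner_Integration.integrable_diff integrable_mult_right)
  have "(\<integral>\<omega>. (Y \<omega> - c)\<^sup>2 * exp (- z * Y \<omega>) \<partial>M) = lap M Y 2 z - 2 * c * lap M Y 1 z + c\<^sup>2 * lap M Y 0 z"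
    unfolding eq lap_def using integrable_lap[OF z, of 0] integrable_lap[OF z, of 1] integrable_lap[OF z, of 2]
    by (simp del: power_0 power_one_right)
  also have "\<dots> = lap M Y 0 z * (tvar M Y z + (tmean M Y z - c)\<^sup>2)"
    using lap0_pos[OF z] by (simp add: tvar_def tmean_def field_simps power2_eq_square)
  finally show "(\<integral>\<omega>. (Y \<omega> - c)\<^sup>2 * exp (- z * Y \<omega>) \<partial>M) = lap M Y 0 z * (tvar M Y z + (tmean M Y z - c)\<^sup>2)" .
qed

lemma tvar_eq: "z > 0 \<Longrightarrow> tvar M Y z = (\<integral>\<omega>. (Y \<omega> - tmean M Y z)\<^sup>2 * exp (- z * Y \<omega>) \<partial>M) / lap M Y 0 z"
  using second_moment_tilted(2)[of z "tmean M Y z"] lap0_pos[of z] by (simp add: field_simps)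

lemma tvar_nonneg: "z > 0 \<Longrightarrow> tvar M Y z \<ge> 0"
  using tvar_eq[of z] lap0_pos[of z] by (auto intro!: divide_nonneg_pos integral_nonneg_AE)

lemma tvar_le: "z > 0 \<Longrightarrow> tvar M Y z \<le> (\<integral>\<omega>. (Y \<omega> - c)\<^sup>2 * exp (- z * Y \<omega>) \<partial>M) / lap M Y 0 z"
  using second_moment_tilted(2)[of z c] lap0_pos[of z] by (simp add: field_simps)

lemma tvar_pos:
  assumes z: "z > 0" and nd: "\<And>c. \<not> (AE \<omega> in M. Y \<omega> = c)"
  shows "tvar M Y z > 0"
proof -
  have "tvar M Y z \<noteq> 0"
  proof
    assume "tvar M Y z = 0"
    then have "(\<integral>\<omega>. (Y \<omega> - tmean M Y z)\<^sup>2 * exp (- z * Y \<omega>) \<partial>M) = 0"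
      using tvar_eq[OF z] lap0_pos[OF z] by simp
    then have "AE \<omega> in M. (Y \<omega> - tmean M Y z)\<^sup>2 * exp (- z * Y \<omega>) = 0"
      using integral_nonneg_eq_0_iff_AE[OF second_moment_tilted(1)[OF z]] by simp
    then have "AE \<omega> in M. Y \<omega> = tmean M Y z" by simp
    then show False using nd by blast
  qed
  with tvar_nonneg[OF z] show ?thesis by simp
qed

lemma tmean_antimono: "0 < x \<Longrightarrow> x \<le> y \<Longrightarrow> tmean M Y y \<le> tmean M Y x"
  by (rule DERIV_nonpos_imp_nonincreasing[of x y])
     (auto intro!: exI[of _ "- tvar M Y _"] DERIV_tmean tvar_nonneg)

lemma tmean_strict_antimono:
  assumes "0 < x" "x < y" "\<And>c. \<not> (AE \<omega> in M. Y \<omega> = c)"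
  shows "tmean M Y y < tmean M Y x"
  using assms by (intro DERIV_neg_imp_decreasing[of x y])
     (auto intro!: exI[of _ "- tvar M Y _"] DERIV_tmean tvar_pos)

lemma tilted_chebyshev:
  assumes z: "z > 0" and D: "D > 0" and c: "2 * (tvar M Y z) \<le> D\<^sup>2"
  shows "(\<integral>\<omega>. exp (- z * Y \<omega>) * indicator {\<omega>. \<bar>Y \<omega> - tmean M Y z\<bar> \<le> D} \<omega> \<partial>M) \<ge> lap M Y 0 z / 2"
proof -
  let ?m = "tmean M Y z"
  have "lap M Y 0 z - (\<integral>\<omega>. (Y \<omega> - ?m)\<^sup>2 * exp (- z * Y \<omega>) \<partial>M) / D\<^sup>2
    = (\<integral>\<omega>. exp (- z * Y \<omega>) - (Y \<omega> - ?m)\<^sup>2 * exp (- z * Y \<omega>) / D\<^sup>2 \<partial>M)"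
    unfolding lap_def using second_moment_tilted(1)[OF z, of ?m] z by simp
  also have "\<dots> \<le> (\<integral>\<omega>. exp (- z * Y \<omega>) * indicator {\<omega>. \<bar>Y \<omega> - ?m\<bar> \<le> D} \<omega> \<partial>M)"
  proof (rule integral_mono_AE)
    show "integrable M (\<lambda>\<omega>. exp (- z * Y \<omega>) - (Y \<omega> - ?m)\<^sup>2 * exp (- z * Y \<omega>) / D\<^sup>2)"
      using second_moment_tilted(1)[OF z, of ?m] z by simp
    have "integrable M (\<lambda>\<omega>. exp (- (z * Y \<omega>)) * indicator {\<omega>\<in>space M. \<bar>Y \<omega> - ?m\<bar> \<le> D} \<omega>)"
      using z by (intro integrable_real_mult_indicator) auto
    then show "integrable M (\<lambda>\<omega>. exp (- z * Y \<omega>) * indicator {\<omega>. \<bar>Y \<omega> - ?m\<bar> \<le> D} \<omega>)"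
      by (rule Bochner_Integration.integrable_cong[THEN iffD1, rotated 2]) (auto simp: indicator_def)
    show "AE \<omega> in M. exp (- z * Y \<omega>) - (Y \<omega> - ?m)\<^sup>2 * exp (- z * Y \<omega>) / D\<^sup>2 \<le> exp (- z * Y \<omega>) * indicator {\<omega>. \<bar>Y \<omega> - ?m\<bar> \<le> D} \<omega>"
    proof (rule AE_I2)
      fix \<omega>
      show "exp (- z * Y \<omega>) - (Y \<omega> - ?m)\<^sup>2 * exp (- z * Y \<omega>) / D\<^sup>2 \<le> exp (- z * Y \<omega>) * indicator {\<omega>. \<bar>Y \<omega> - ?m\<bar> \<le> D} \<omega>"
      proof (cases "\<bar>Y \<omega> - ?m\<bar> \<le> D")
        case False
        then have "D\<^sup>2 \<le> (Y \<omega> - ?m)\<^sup>2" using D by (simp add: abs_le_square_iff[symmetric])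
        then have "1 * exp (- z * Y \<omega>) \<le> (Y \<omega> - ?m)\<^sup>2 / D\<^sup>2 * exp (- z * Y \<omega>)"
          using D by (intro mult_right_mono) auto
        then show ?thesis using False by simp
      qed simp
    qed
  qed
  finally have "lap M Y 0 z - lap M Y 0 z * tvar M Y z / D\<^sup>2 \<le> (\<integral>\<omega>. exp (- z * Y \<omega>) * indicator {\<omega>. \<bar>Y \<omega> - ?m\<bar> \<le> D} \<omega> \<partial>M)"
    using second_moment_tilted(2)[OF z, of ?m] by simp
  moreover have "lap M Y 0 z * tvar M Y z / D\<^sup>2 \<le> lap M Y 0 z / 2"
  proof -
    have "lap M Y 0 z * (2 * tvar M Y z) \<le> lap M Y 0 z * D\<^sup>2"
      using c lap_nonneg by (intro mult_left_mono) auto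
    then show ?thesis using D by (simp add: field_simps)
  qed
  ultimately show ?thesis by simp
qed

end

section \<open>Iterates of the offspring Laplace exponent\<close>

locale offspring =
  fixes p :: "nat pmf" and mu la :: nat and a :: real
  defines "mu \<equiv> off_min p" and "la \<equiv> off_next p" and "a \<equiv> off_mean p"
  assumes nondegenerate: "\<not> (\<exists>c. AE n in measure_pmf p. n = c)"
    and mu_ge_2: "2 \<le> mu"
    and integrable_mean: "integrable (measure_pmf p) real"
begin

sublocale P: nonneg_rv "measure_pmf p" real
  by unfold_locales auto

lemma pmf_mu_pos: "pmf p mu > 0" and pmf_pos_imp_ge_mu: "pmf p n > 0 \<Longrightarrow> n \<ge> mu"
proof -
  obtain n where "n \<in> set_pmf p" using set_pmf_not_empty[of p] by blast
  then have "pmf p n > 0" by (simp add: pmf_positive)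
  then show "pmf p mu > 0" unfolding mu_def off_min_def by (rule LeastI)
  show "pmf p n > 0 \<Longrightarrow> n \<ge> mu" for n unfolding mu_def off_min_def by (rule Least_le)
qed

lemma la_properties: "la > mu" "pmf p la > 0" "pmf p n > 0 \<Longrightarrow> n > mu \<Longrightarrow> n \<ge> la"
proof -
  have "\<exists>n. n > mu \<and> pmf p n > 0"
  proof (rule ccontr)
    assume none: "\<not> ?thesis"
    have "n = mu" if "pmf p n > 0" for n
    proof (rule ccontr)
      assume "n \<noteq> mu"
      then have "n > mu" using pmf_pos_imp_ge_mu[OF that] by simp
      with that none show False by blast
    qed
    then have "AE n in measure_pmf p. n = mu"
      by (auto simp: AE_measure_pmf_iff set_pmf_iff pmf_positive_iff dest: pmf_positive)
    then show False using nondegenerate by blast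
  qed
  then have "la > mu \<and> pmf p la > 0" unfolding la_def off_next_def mu_def by (rule LeastI_ex)
  then show "la > mu" "pmf p la > 0" by auto
  show "pmf p n > 0 \<Longrightarrow> n > mu \<Longrightarrow> n \<ge> la"
    unfolding la_def off_next_def mu_def by (rule Least_le) auto
qed

lemma AE_ge_mu: "AE n in measure_pmf p. n \<ge> mu"
  by (auto simp: AE_measure_pmf_iff intro!: pmf_pos_imp_ge_mu pmf_positive)

lemma AE_mu_or_ge_la: "AE n in measure_pmf p. n = mu \<or> n \<ge> la"
proof -
  have "n = mu \<or> n \<ge> la" if "n \<in> set_pmf p" for n
    using pmf_pos_imp_ge_mu[OF pmf_positive[OF that]] la_properties(3)[OF pmf_positive[OF that]] by fastforce
  then show ?thesis by (auto simp: AE_measure_pmf_iff)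
qed

lemma mu_pos: "real mu > 0" "real mu \<ge> 2" "real mu > 1" using mu_ge_2 by auto

lemma expectation_ge_two_atoms:
  fixes g :: "nat \<Rightarrow> real"
  assumes "integrable (measure_pmf p) g" "AE n in measure_pmf p. g n \<ge> 0"
  shows "measure_pmf.expectation p g \<ge> g mu * pmf p mu + g la * pmf p la"
proof -
  have "measure_pmf.expectation p (\<lambda>n. g mu * indicator {mu} n + g la * indicator {la} n) \<le> measure_pmf.expectation p g"
  proof (rule integral_mono_AE)
    show "AE n in measure_pmf p. g mu * indicator {mu} n + g la * indicator {la} n \<le> g n"
      using assms(2)
    proof eventually_elim
      case (elim n)
      then show ?case using la_properties(1) by (auto simp: indicator_def)
    qed
  qed (use assms in \<open>auto intro!: Bochner_Integration.integrable_add integrable_mult_right integrable_real_indicator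
      simp: measure_pmf.emeasure_eq_measure\<close>)
  moreover have "measure_pmf.expectation p (\<lambda>n. g mu * indicator {mu} n + g la * indicator {la} n) = g mu * pmf p mu + g la * pmf p la"
    by (subst Bochner_Integration.integral_add)
       (auto simp: measure_pmf_single measure_pmf.emeasure_eq_measure intro!: integrable_mult_right integrable_real_indicator)
  ultimately show ?thesis by simp
qed

lemma mean_gt_mu: "a > mu"
proof -
  have i: "integrable (measure_pmf p) (\<lambda>n. real n - mu)"
    using integrable_mean by simp
  have "a - mu = measure_pmf.expectation p (\<lambda>n. real n - mu)"
    unfolding a_def off_mean_def using integrable_mean by simp
  also have "\<dots> \<ge> (real mu - mu) * pmf p mu + (real la - mu) * pmf p la"
    by (rule expectation_ge_two_atoms[OF i]) (use AE_ge_mu in \<open>auto elim: eventually_mono\<close>)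
  finally have "a - mu \<ge> (real la - mu) * pmf p la" by simp
  moreover have "(real la - mu) * pmf p la > 0" using la_properties by simp
  ultimately show ?thesis by simp
qed

lemma a_gt_1: "a > 1" "a > 0" "a / mu > 1" using mean_gt_mu mu_pos by auto

section \<open>The logarithmic generating function and its affine asymptote\<close>

definition "Lam z = - ln (lap (measure_pmf p) real 0 z)"
abbreviation "Dm \<equiv> tmean (measure_pmf p) real"
abbreviation "Dv \<equiv> tvar (measure_pmf p) real"

lemma expectation_eq_suminf:
  fixes g :: "nat \<Rightarrow> 'b::{banach, second_countable_topology, real_normed_field}"
  assumes "\<And>n. norm (g n) \<le> 1"
  shows "measure_pmf.expectation p g = (\<Sum>n. pmf p n *\<^sub>R g n)"
proof -
  have int: "integrable (count_space UNIV) (\<lambda>n. pmf p n *\<^sub>R g n)"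
    by (rule Bochner_Integration.integrable_bound[OF integrable_pmf[of UNIV p]])
       (use assms in \<open>auto intro!: mult_left_le\<close>)
  have "measure_pmf.expectation p g = (\<integral>n. pmf p n *\<^sub>R g n \<partial>count_space UNIV)"
    by (subst measure_pmf_eq_density) (rule integral_density, auto)
  also have "\<dots> = (\<Sum>n. pmf p n *\<^sub>R g n)"
    by (rule integral_count_space_nat[OF int])
  finally show ?thesis .
qed

lemma off_pgf_exp: "z > 0 \<Longrightarrow> off_pgf p (exp (- z)) = exp (- Lam z)"
proof -
  assume z: "z > 0"
  have "lap (measure_pmf p) real 0 z = measure_pmf.expectation p (\<lambda>n. exp (- z) ^ n)"
    unfolding lap_def by (simp add: exp_of_nat_mult[symmetric] mult.commute)
  also have "\<dots> = (\<Sum>n. pmf p n *\<^sub>R exp (- z) ^ n)"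
    using z by (intro expectation_eq_suminf) (auto simp: norm_power intro!: power_le_one)
  finally show ?thesis using P.lap0_pos[OF z] by (simp add: Lam_def off_pgf_def)
qed

text \<open>The constant term of the asymptote: for large z the atom at \<mu> dominates and
  \<open>Lam z\<close> approaches \<open>mu * z + C0\<close>.\<close>

definition "C0 = - ln (pmf p mu)"

lemma C0_nonneg: "C0 \<ge> 0" unfolding C0_def using pmf_mu_pos pmf_le_1[of p mu] by simp

lemma exp_C0: "exp (- C0) = pmf p mu" "exp C0 = 1 / pmf p mu"
  unfolding C0_def using pmf_mu_pos by (auto simp: exp_minus inverse_eq_divide)

lemma exp_Lam: "z > 0 \<Longrightarrow> exp (- Lam z) = lap (measure_pmf p) real 0 z"
  unfolding Lam_def using P.lap0_pos[of z] by simp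

lemma lap0_ge: "z > 0 \<Longrightarrow> lap (measure_pmf p) real 0 z \<ge> pmf p mu * exp (- (real mu * z)) + pmf p la * exp (- (real la * z))"
  using expectation_ge_two_atoms[of "\<lambda>n. exp (- z * real n)"] P.integrable_lap[of z 0]
  unfolding lap_def by (simp add: mult_ac)

lemma lap0_ge_mu: "z > 0 \<Longrightarrow> lap (measure_pmf p) real 0 z \<ge> pmf p mu * exp (- (real mu * z))"
  using lap0_ge[of z] pmf_nonneg[of p la] exp_ge_zero[of "-(la*z)"]
  by (smt (verit) mult_nonneg_nonneg)

lemma Lam_ge: "z > 0 \<Longrightarrow> Lam z \<ge> real mu * z"
proof -
  assume z: "z > 0"
  have "lap (measure_pmf p) real 0 z \<le> (\<integral>n. exp (- (real mu * z)) \<partial>measure_pmf p)"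
    unfolding lap_def
  proof (rule integral_mono_AE)
    show "AE n in measure_pmf p. real n ^ 0 * exp (- z * real n) \<le> exp (- (real mu * z))"
      using AE_ge_mu by eventually_elim (use z in \<open>auto simp: mult.commute\<close>)
  qed (use P.integrable_lap[OF z, of 0] in auto)
  then have "exp (- Lam z) \<le> exp (- (real mu * z))" using exp_Lam[OF z] by simp
  then show ?thesis by simp
qed

lemma Lam_pos: "z > 0 \<Longrightarrow> Lam z > 0"
  using Lam_ge[of z] mu_pos by (smt (verit) mult_pos_pos)

lemma DERIV_Lam: "z > 0 \<Longrightarrow> (Lam has_real_derivative Dm z) (at z)"
  unfolding Lam_def[abs_def] by (rule P.DERIV_log_lap)

text \<open>Under the offspring law tilted by exp (- x n) the value \<mu> has probability
  \<open>exp (- Lgap x)\<close>.\<close>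

definition "Lgap x = C0 + real mu * x - Lam x"

text \<open>The second smallest atom \<lambda> determines the distance to the asymptote, hence the
  rate \<open>la - mu\<close> in both directions: for the lower bound only the atoms \<mu> and
  \<lambda> are kept, for the upper bound all other atoms are at least \<lambda>.\<close>

lemma Lgap_bounds:
  assumes x: "x > 0"
  shows "Lgap x \<ge> ln (1 + pmf p la / pmf p mu * exp (- ((real la - mu) * x)))"
    and "Lgap x \<le> exp (- ((real la - mu) * x)) / pmf p mu"
    and "Lgap x \<ge> 0"
proof -
  define r where "r = pmf p la / pmf p mu"
  have r: "r > 0" using la_properties pmf_mu_pos by (auto simp: r_def)
  have eL: "exp (Lgap x) = lap (measure_pmf p) real 0 x * exp (real mu * x) / pmf p mu"
    unfolding exp_Lam[OF x, symmetric] Lgap_def exp_add exp_diff exp_C0 by (simp add: exp_minus field_simps)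
  have em: "exp (- (real la * x)) * exp (real mu * x) = exp (- ((real la - mu) * x))"
    by (simp add: exp_add[symmetric] algebra_simps)
  have "1 + r * exp (- ((real la - mu) * x)) = (pmf p mu * exp (- (real mu * x)) + pmf p la * exp (- (real la * x))) * exp (real mu * x) / pmf p mu"
  proof -
    have "(pmf p mu * exp (- (real mu * x)) + pmf p la * exp (- (real la * x))) * exp (real mu * x) / pmf p mu
      = (pmf p mu * (exp (- (real mu * x)) * exp (real mu * x)) + pmf p la * (exp (- (real la * x)) * exp (real mu * x))) / pmf p mu"
      by (simp add: algebra_simps)
    then show ?thesis unfolding em using pmf_mu_pos by (simp add: r_def exp_minus add_divide_distrib)
  qed
  also have "\<dots> \<le> exp (Lgap x)"
    unfolding eL using lap0_ge[OF x] pmf_mu_pos by (intro divide_right_mono mult_right_mono) auto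
  finally have ge: "1 + r * exp (- ((real la - mu) * x)) \<le> exp (Lgap x)" .
  have p1: "1 + r * exp (- ((real la - mu) * x)) > 0" using r by (intro add_pos_pos) auto
  have "ln (1 + r * exp (- ((real la - mu) * x))) \<le> ln (exp (Lgap x))"
    using ge p1 by (subst ln_le_cancel_iff) auto
  then show 1: "Lgap x \<ge> ln (1 + pmf p la / pmf p mu * exp (- ((real la - mu) * x)))" by (simp add: r_def)
  have "ln (1 + r * exp (- ((real la - mu) * x))) \<ge> 0" using r by (intro ln_ge_zero) auto
  with 1 show "Lgap x \<ge> 0" unfolding r_def by linarith
  have "lap (measure_pmf p) real 0 x \<le> (\<integral>n. exp (- (real mu * x)) * indicator {mu} n + exp (- (real la * x)) \<partial>measure_pmf p)"
    unfolding lap_def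
  proof (rule integral_mono_AE)
    show "AE n in measure_pmf p. real n ^ 0 * exp (- x * real n) \<le> exp (- (real mu * x)) * indicator {mu} n + exp (- (real la * x))"
      using AE_mu_or_ge_la by eventually_elim (use x in \<open>auto simp: mult.commute indicator_def\<close>)
  qed (use P.integrable_lap[OF x, of 0] in \<open>auto intro!: Bochner_Integration.integrable_add integrable_mult_right integrable_real_indicator
      simp: measure_pmf.emeasure_eq_measure\<close>)
  also have "\<dots> = exp (- (real mu * x)) * pmf p mu + exp (- (real la * x))"
    by (subst Bochner_Integration.integral_add)
       (auto simp: measure_pmf_single measure_pmf.emeasure_eq_measure intro!: integrable_mult_right integrable_real_indicator)
  finally have "lap (measure_pmf p) real 0 x * exp (real mu * x) / pmf p mu \<le> (exp (- (real mu * x)) * pmf p mu + exp (- (real la * x))) * exp (real mu * x) / pmf p mu"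
    using pmf_mu_pos by (intro divide_right_mono mult_right_mono) auto
  also have "\<dots> = 1 + exp (- ((real la - mu) * x)) / pmf p mu"
  proof -
    have "(exp (- (real mu * x)) * pmf p mu + exp (- (real la * x))) * exp (real mu * x) / pmf p mu
      = (pmf p mu * (exp (- (real mu * x)) * exp (real mu * x)) + (exp (- (real la * x)) * exp (real mu * x))) / pmf p mu"
      by (simp add: algebra_simps)
    then show ?thesis unfolding em using pmf_mu_pos by (simp add: exp_minus add_divide_distrib)
  qed
  also have "\<dots> \<le> exp (exp (- ((real la - mu) * x)) / pmf p mu)" by (rule exp_ge_add_one_self)
  finally show "Lgap x \<le> exp (- ((real la - mu) * x)) / pmf p mu"
    unfolding eL[symmetric] exp_le_cancel_iff .
qed

lemma Lam_le: "z > 0 \<Longrightarrow> Lam z \<le> real mu * z + C0"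
  using Lgap_bounds(3)[of z] by (simp add: Lgap_def)

lemma Dm_ge_mu: assumes z: "z > 0" shows "Dm z \<ge> mu"
proof -
  have "real mu * lap (measure_pmf p) real 0 z = (\<integral>n. real mu * exp (- z * real n) \<partial>measure_pmf p)" by (simp add: lap_def)
  also have "\<dots> \<le> lap (measure_pmf p) real 1 z" unfolding lap_def
  proof (rule integral_mono_AE)
    show "AE n in measure_pmf p. real mu * exp (- z * real n) \<le> real n ^ 1 * exp (- z * real n)"
      using AE_ge_mu by eventually_elim auto
  qed (use P.integrable_lap[OF z, of 0] P.integrable_lap[OF z, of 1] in auto)
  finally show ?thesis using P.lap0_pos[OF z] by (simp add: tmean_def field_simps)
qed

text \<open>The factor n - \<mu> removes the atom \<mu>, and on the other atoms n \<ge> \<mu> + 1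
  yields one factor exp (- z) more than the normalisation, which is at least p_\<mu> exp (- \<mu>
  z).\<close>

lemma Dm_le:
  assumes z: "z > 0" shows "Dm z \<le> mu + a / pmf p mu * exp (- z)"
proof -
  have "lap (measure_pmf p) real 1 z - real mu * lap (measure_pmf p) real 0 z = (\<integral>n. (real n - mu) * exp (- z * real n) \<partial>measure_pmf p)"
    unfolding lap_def using P.integrable_lap[OF z, of 0] P.integrable_lap[OF z, of 1]
    by (simp add: left_diff_distrib)
  also have "\<dots> \<le> (\<integral>n. real n * exp (- (real mu + 1) * z) \<partial>measure_pmf p)"
  proof (rule integral_mono_AE)
    show "integrable (measure_pmf p) (\<lambda>n. (real n - mu) * exp (- z * real n))"
      using P.integrable_lap[OF z, of 0] P.integrable_lap[OF z, of 1] by (simp add: left_diff_distrib)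
    show "integrable (measure_pmf p) (\<lambda>n. real n * exp (- (real mu + 1) * z))" using integrable_mean by simp
    show "AE n in measure_pmf p. (real n - mu) * exp (- z * real n) \<le> real n * exp (- (real mu + 1) * z)"
      using AE_ge_mu
    proof eventually_elim
      case (elim n)
      show ?case
      proof (cases "n = mu")
        case False
        then have "(real mu + 1) * z \<le> real n * z" using elim z by (intro mult_right_mono) auto
        then have "- z * real n \<le> - (real mu + 1) * z" by (simp add: algebra_simps)
        then show ?thesis using elim by (intro mult_mono) auto
      qed simp
    qed
  qed
  also have "\<dots> = a * exp (- (real mu + 1) * z)" using integrable_mean by (simp add: a_def off_mean_def)
  finally have "(lap (measure_pmf p) real 1 z - real mu * lap (measure_pmf p) real 0 z) / lap (measure_pmf p) real 0 z \<le> a * exp (- (real mu + 1) * z) / (pmf p mu * exp (- (real mu * z)))"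
    using lap0_ge_mu[OF z] P.lap0_pos[OF z] pmf_mu_pos a_gt_1
    by (intro frac_le) auto
  also have "exp (- (real mu + 1) * z) = exp (- (real mu * z)) * exp (- z)"
    unfolding exp_add[symmetric] by (simp add: algebra_simps)
  finally show ?thesis using P.lap0_pos[OF z] by (simp add: tmean_def diff_divide_distrib)
qed

text \<open>Centring at \<mu> removes the main atom as before. The offspring law may have an
  infinite second moment; a part exp (- z0 n) of the weight is therefore kept to make it finite, and
  the constant depends on z0.\<close>

lemma Dv_le:
  assumes z0: "z0 > 0"
  obtains C where "C > 0" "\<And>z. z \<ge> z0 \<Longrightarrow> Dv z \<le> C * exp (- z)"
proof -
  define C where "C = lap (measure_pmf p) real 2 z0 * exp ((real mu + 1) * z0) / pmf p mu"
  have "C \<ge> 0" unfolding C_def using P.lap_nonneg pmf_mu_pos by auto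
  show ?thesis
  proof (rule that[of "C + 1"])
    show "C + 1 > 0" using \<open>C \<ge> 0\<close> by simp
    fix z assume z: "z \<ge> z0"
    then have zp: "z > 0" using z0 by simp
    have "Dv z \<le> (\<integral>n. (real n - mu)\<^sup>2 * exp (- z * real n) \<partial>measure_pmf p) / lap (measure_pmf p) real 0 z"
      by (rule P.tvar_le[OF zp])
    also have "\<dots> \<le> (exp (- (real mu + 1) * (z - z0)) * lap (measure_pmf p) real 2 z0) / (pmf p mu * exp (- (real mu * z)))"
    proof (rule frac_le)
      have "(\<integral>n. (real n - mu)\<^sup>2 * exp (- z * real n) \<partial>measure_pmf p) \<le> (\<integral>n. exp (- (real mu + 1) * (z - z0)) * (real n ^ 2 * exp (- z0 * real n)) \<partial>measure_pmf p)"
      proof (rule integral_mono_AE)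
        show "AE n in measure_pmf p. (real n - mu)\<^sup>2 * exp (- z * real n) \<le> exp (- (real mu + 1) * (z - z0)) * (real n ^ 2 * exp (- z0 * real n))"
          using AE_ge_mu
        proof eventually_elim
          case (elim n)
          show ?case
          proof (cases "n = mu")
            case False
            have "(real mu + 1) * (z - z0) \<le> real n * (z - z0)" using elim z False by (intro mult_right_mono) auto
            then have "exp (- z * real n) \<le> exp (- (real mu + 1) * (z - z0)) * exp (- z0 * real n)"
              unfolding exp_add[symmetric] by (simp add: algebra_simps)
            moreover have "(real n - mu)\<^sup>2 \<le> (real n)\<^sup>2" using elim by (intro power_mono) auto
            ultimately have "(real n - mu)\<^sup>2 * exp (- z * real n) \<le> (real n)\<^sup>2 * (exp (- (real mu + 1) * (z - z0)) * exp (- z0 * real n))"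
              by (intro mult_mono) auto
            then show ?thesis by (simp add: mult_ac)
          qed simp
        qed
      qed (use P.second_moment_tilted(1)[OF zp] P.integrable_lap[OF z0, of 2] in auto)
      then show "(\<integral>n. (real n - mu)\<^sup>2 * exp (- z * real n) \<partial>measure_pmf p) \<le> exp (- (real mu + 1) * (z - z0)) * lap (measure_pmf p) real 2 z0"
        unfolding lap_def by simp
    qed (use lap0_ge_mu[OF zp] pmf_mu_pos P.lap_nonneg in auto)
    also have "\<dots> = C * exp (- z)"
    proof -
      have "exp (- (real mu + 1) * (z - z0)) = exp ((real mu + 1) * z0) * exp (- z) * exp (- (real mu * z))"
        unfolding exp_add[symmetric] by (simp add: algebra_simps)
      then show ?thesis by (simp add: C_def)
    qed
    also have "\<dots> \<le> (C + 1) * exp (- z)" by (intro mult_right_mono) auto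
    finally show "Dv z \<le> (C + 1) * exp (- z)" .
  qed
qed

section \<open>Iterates, their derivatives, and the limit of the normalised derivatives\<close>

definition "Lm m z = (Lam ^^ m) z"
text \<open>By the chain rule this product is the derivative of \<open>Lm m\<close>; the limit
  \<open>Pf\<close> of its normalisation \<open>Pm\<close> will be the derivative of
  \<open>bt\<close>.\<close>

definition "Mm m z = (\<Prod>i<m. Dm (Lm i z))"
definition "Pm m z = Mm m z / real mu ^ m"

lemma Lm_0 [simp]: "Lm 0 z = z" and Lm_Suc: "Lm (Suc m) z = Lam (Lm m z)"
  and Lm_Suc2: "Lm (Suc m) z = Lm m (Lam z)" and Lm_add: "Lm (m + k) z = Lm m (Lm k z)"
  by (auto simp: Lm_def funpow_swap1 funpow_add)

lemma Lm_pos: "z > 0 \<Longrightarrow> Lm m z > 0"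
  by (induction m) (auto simp: Lm_Suc Lam_pos)

lemma Lm_ge: "z > 0 \<Longrightarrow> Lm m z \<ge> real mu ^ m * z"
proof (induction m)
  case (Suc m)
  have "real mu * (real mu ^ m * z) \<le> real mu * Lm m z" using Suc by (intro mult_left_mono) auto
  also have "\<dots> \<le> Lm (Suc m) z" unfolding Lm_Suc by (rule Lam_ge[OF Lm_pos[OF Suc.prems]])
  finally show ?case by (simp add: mult_ac)
qed simp

lemma off_pgf_iterate: "z > 0 \<Longrightarrow> (off_pgf p ^^ m) (exp (- z)) = exp (- Lm m z)"
  by (induction m) (auto simp: Lm_Suc off_pgf_exp Lm_pos)

lemma DERIV_Lm: "z > 0 \<Longrightarrow> (Lm m has_real_derivative Mm m z) (at z)"
proof (induction m)
  case 0
  have "Lm 0 = (\<lambda>z. z)" by auto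
  then show ?case by (auto simp: Mm_def intro!: derivative_eq_intros)
next
  case (Suc m)
  have "((\<lambda>z. Lam (Lm m z)) has_real_derivative Dm (Lm m z) * Mm m z) (at z)"
    by (rule DERIV_chain2[OF DERIV_Lam Suc.IH]) (use Suc.prems Lm_pos in auto)
  then show ?case by (simp add: Lm_Suc[abs_def] Mm_def mult.commute)
qed

lemma Mm_ge: "z > 0 \<Longrightarrow> Mm m z \<ge> real mu ^ m"
proof (induction m)
  case (Suc m)
  have "real mu ^ m * real mu \<le> Mm m z * Dm (Lm m z)"
    using Suc by (intro mult_mono' Dm_ge_mu Lm_pos) auto
  then show ?case by (simp add: Mm_def mult.commute)
qed (simp add: Mm_def)

lemma Mm_pos: "z > 0 \<Longrightarrow> Mm m z > 0"
  using Mm_ge[of z m] mu_pos by (smt (verit) zero_less_power of_nat_power)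

lemma Lm_mono: "0 < x \<Longrightarrow> x \<le> y \<Longrightarrow> Lm m x \<le> Lm m y"
  by (rule DERIV_nonneg_imp_nondecreasing[of x y])
     (auto intro!: exI[of _ "Mm m _"] DERIV_Lm less_imp_le[OF Mm_pos])

lemma Mm_antimono: "0 < x \<Longrightarrow> x \<le> y \<Longrightarrow> Mm m y \<le> Mm m x"
  unfolding Mm_def
  by (intro prod_mono conjI P.tmean_antimono Lm_mono Lm_pos) (use Dm_ge_mu[OF Lm_pos] in \<open>auto intro: order_trans[OF _ Dm_ge_mu[OF Lm_pos]]\<close>)

text \<open>\<open>Mm m\<close> and \<open>Vm m\<close> will turn out to be the mean and variance of the \<open>m\<close>-th generation
  size under exponential tilting.\<close>

definition "Vm m z = (\<Sum>i<m. Dv (Lm i z) * (Mm i z)\<^sup>2 * (\<Prod>j\<in>{Suc i..<m}. Dm (Lm j z)))"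

lemma Vm_Suc: "Vm (Suc m) z = Dv (Lm m z) * (Mm m z)\<^sup>2 + Dm (Lm m z) * Vm m z"
proof -
  have "(\<Prod>j\<in>{Suc i..<Suc m}. Dm (Lm j z)) = (\<Prod>j\<in>{Suc i..<m}. Dm (Lm j z)) * Dm (Lm m z)" if "i < m" for i
    using that by (intro prod.atLeastLessThan_Suc) simp
  then show ?thesis unfolding Vm_def by (simp add: sum_distrib_left mult_ac)
qed

lemma DERIV_Mm: "z > 0 \<Longrightarrow> (Mm m has_real_derivative - Vm m z) (at z)"
proof (induction m)
  case 0
  have "Mm 0 = (\<lambda>z. 1)" by (auto simp: Mm_def)
  then show ?case by (simp add: Vm_def)
next
  case (Suc m)
  have "((\<lambda>z. Dm (Lm m z)) has_real_derivative - Dv (Lm m z) * Mm m z) (at z)"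
    by (rule DERIV_chain2[OF P.DERIV_tmean DERIV_Lm]) (use Suc.prems Lm_pos in auto)
  then have "((\<lambda>z. Mm m z * Dm (Lm m z)) has_real_derivative - Vm (Suc m) z) (at z)"
    using Suc by (auto intro!: derivative_eq_intros simp: Vm_Suc power2_eq_square algebra_simps)
  then show ?case by (simp add: Mm_def[abs_def])
qed


lemma two_power_le_mu: "2 ^ n \<le> real mu ^ n"
  using mu_pos by (intro power_mono) auto

lemma Suc_le_mu_power: "real (Suc i) \<le> real mu ^ i"
proof -
  have "Suc i \<le> 2 ^ i" using Suc_leI[OF less_exp[of i]] .
  then have "real (Suc i) \<le> 2 ^ i" by (metis of_nat_le_iff of_nat_numeral of_nat_power)
  also have "\<dots> \<le> real mu ^ i" by (rule two_power_le_mu)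
  finally show ?thesis .
qed

text \<open>The growth of the iterates is used only through \<mu>^i \<ge> i + 1: from generation m
  on, exp (- Lm) is dominated by a geometric sequence with ratio exp (- Lm m z). Tail sums are thus
  comparable to their first term.\<close>

lemma exp_Lm_add_le:
  assumes z: "z > 0" shows "exp (- Lm (m + i) z) \<le> exp (- Lm m z) ^ Suc i"
proof -
  have "real (Suc i) * Lm m z \<le> real mu ^ i * Lm m z"
    using Lm_pos[OF z, of m] Suc_le_mu_power[of i] by (intro mult_right_mono) auto
  also have "\<dots> \<le> Lm i (Lm m z)" by (rule Lm_ge[OF Lm_pos[OF z]])
  finally have "real (Suc i) * Lm m z \<le> Lm (m + i) z" by (simp add: Lm_add[symmetric] add.commute)
  then show ?thesis unfolding exp_of_nat_mult[symmetric] by simp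
qed

lemma sum_power_Suc_le:
  fixes x q :: real assumes "0 \<le> x" "x \<le> q" "q < 1"
  shows "(\<Sum>i<n. x ^ Suc i) \<le> x / (1 - q)"
proof -
  have s: "summable (\<lambda>i. x ^ i)" using assms by (intro summable_geometric) auto
  have "(\<Sum>i<n. x ^ Suc i) = x * (\<Sum>i<n. x ^ i)" by (simp add: sum_distrib_left)
  also have "\<dots> \<le> x * (\<Sum>i. x ^ i)" using assms s by (intro mult_left_mono sum_le_suminf) auto
  also have "\<dots> = x / (1 - x)" using assms by (subst suminf_geometric) auto
  also have "\<dots> \<le> x / (1 - q)" using assms by (intro divide_left_mono mult_pos_pos) auto
  finally show ?thesis .
qed

lemma exp_Lm_le: "z0 > 0 \<Longrightarrow> z \<ge> z0 \<Longrightarrow> exp (- Lm m z) \<le> exp (- z0) ^ Suc m"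
proof -
  assume "z0 > 0" "z \<ge> z0"
  then have "exp (- Lm m z) \<le> exp (- z) ^ Suc m" using exp_Lm_add_le[of z 0 m] by simp
  also have "\<dots> \<le> exp (- z0) ^ Suc m" using \<open>z \<ge> z0\<close> by (intro power_mono) auto
  finally show ?thesis .
qed

definition "Pf z = lim (\<lambda>m. Pm m z)"

lemma Pm_ge_1: "z > 0 \<Longrightarrow> Pm m z \<ge> 1"
  using Mm_ge[of z m] mu_pos by (simp add: Pm_def)

lemma Pm_Suc: "Pm (Suc m) z = Pm m z * (Dm (Lm m z) / mu)"
  by (simp add: Pm_def Mm_def)

lemma Dm_ratio:
  assumes "z > 0" shows "1 \<le> Dm z / mu" "Dm z / mu \<le> 1 + a / pmf p mu * exp (- z)"
proof -
  show "1 \<le> Dm z / mu" using Dm_ge_mu[OF assms] mu_pos by simp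
  have "Dm z / mu \<le> (mu + a / pmf p mu * exp (- z)) / mu" using Dm_le[OF assms] mu_pos by (intro divide_right_mono) auto
  also have "\<dots> = 1 + a / pmf p mu * exp (- z) / mu" using mu_pos by (simp add: add_divide_distrib)
  also have "\<dots> \<le> 1 + a / pmf p mu * exp (- z) / 1"
    using mu_pos a_gt_1 pmf_mu_pos by (intro add_left_mono divide_left_mono) auto
  finally show "Dm z / mu \<le> 1 + a / pmf p mu * exp (- z)" by simp
qed

lemma Pm_mono: "z > 0 \<Longrightarrow> incseq (\<lambda>m. Pm m z)"
proof (rule incseq_SucI)
  fix m assume z: "z > 0"
  have "Pm m z * 1 \<le> Pm m z * (Dm (Lm m z) / mu)"
    using Pm_ge_1[OF z, of m] Dm_ratio(1)[OF Lm_pos[OF z]] by (intro mult_left_mono) auto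
  then show "Pm m z \<le> Pm (Suc m) z" by (simp add: Pm_Suc)
qed

text \<open>Each factor of the product exceeds 1 by at most a multiple of exp (- Lm), and these
  excesses are summable uniformly in z \<ge> z0.\<close>

lemma Pm_bounded:
  assumes z0: "z0 > 0"
  obtains K where "K > 0" "\<And>z m. z \<ge> z0 \<Longrightarrow> Pm m z \<le> K"
proof (rule that[of "exp (a / pmf p mu * (exp (- z0) / (1 - exp (- z0))))"])
  fix z m assume z: "z \<ge> z0"
  then have zp: "z > 0" using z0 by simp
  have c: "a / pmf p mu \<ge> 0" using a_gt_1 pmf_mu_pos by simp
  have "Pm m z \<le> exp (a / pmf p mu * (\<Sum>i<m. exp (- z0) ^ Suc i))"
  proof (induction m)
    case (Suc m)
    have "Dm (Lm m z) / mu \<le> 1 + a / pmf p mu * exp (- Lm m z)" by (rule Dm_ratio[OF Lm_pos[OF zp]])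
    also have "\<dots> \<le> exp (a / pmf p mu * exp (- Lm m z))" by (rule exp_ge_add_one_self)
    also have "\<dots> \<le> exp (a / pmf p mu * exp (- z0) ^ Suc m)"
      unfolding exp_le_cancel_iff using c exp_Lm_le[OF z0 z, of m] by (intro mult_left_mono) auto
    finally have "Pm (Suc m) z \<le> exp (a / pmf p mu * (\<Sum>i<m. exp (- z0) ^ Suc i)) * exp (a / pmf p mu * exp (- z0) ^ Suc m)"
      unfolding Pm_Suc using Suc Dm_ratio(1)[OF Lm_pos[OF zp, of m]] by (intro mult_mono) auto
    then show ?case unfolding exp_add[symmetric] distrib_left[symmetric] sum.lessThan_Suc .
  qed (simp add: Pm_def Mm_def)
  also have "\<dots> \<le> exp (a / pmf p mu * (exp (- z0) / (1 - exp (- z0))))"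
    unfolding exp_le_cancel_iff using c z0 by (intro mult_left_mono sum_power_Suc_le) auto
  finally show "Pm m z \<le> exp (a / pmf p mu * (exp (- z0) / (1 - exp (- z0))))" .
qed simp

lemma Pm_tendsto: assumes z: "z > 0" shows "(\<lambda>m. Pm m z) \<longlonglongrightarrow> Pf z"
proof -
  obtain K where "K > 0" and K: "\<And>w m. w \<ge> z \<Longrightarrow> Pm m w \<le> K" using Pm_bounded[OF z] by blast
  obtain L where "(\<lambda>m. Pm m z) \<longlonglongrightarrow> L"
    by (rule incseq_convergent[OF Pm_mono[OF z], of K]) (use K that in auto)
  then show ?thesis unfolding Pf_def by (simp add: limI)
qed

lemma Pm_le_Pf: "z > 0 \<Longrightarrow> Pm m z \<le> Pf z"
  by (rule incseq_le[OF Pm_mono Pm_tendsto])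

lemma Pf_ge_1: "z > 0 \<Longrightarrow> Pf z \<ge> 1"
  using Pm_le_Pf[of z 0] Pm_ge_1[of z 0] by simp

text \<open>The error has the size of the first neglected factor minus 1, so it is doubly
  exponentially small in m. It must stay bounded, uniformly in z, after multiplication by \<mu>^m
  when \<open>Pm\<close> is replaced by \<open>Pf\<close> in the saddle-point equation.\<close>

lemma Pf_error:
  assumes z0: "z0 > 0"
  obtains C where "C > 0" "\<And>z m. z \<ge> z0 \<Longrightarrow> \<bar>Pf z - Pm m z\<bar> \<le> C * exp (- Lm m z)"
    "\<And>z m. z \<ge> z0 \<Longrightarrow> Pm m z \<le> C"
proof -
  obtain K where K: "K > 0" "\<And>z m. z \<ge> z0 \<Longrightarrow> Pm m z \<le> K" using Pm_bounded[OF z0] by blast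
  define c where "c = a / pmf p mu"
  have c: "c > 0" using a_gt_1 pmf_mu_pos by (simp add: c_def)
  define q where "q = exp (- z0)"
  have q: "0 < q" "q < 1" using z0 by (auto simp: q_def)
  define C where "C = K + K * c / (1 - q)"
  show ?thesis
  proof (rule that[of C])
    show "C > 0" unfolding C_def using K c q by (intro add_pos_pos divide_pos_pos mult_pos_pos) auto
    have KC: "K \<le> C" unfolding C_def using K c q by simp
    show "Pm m z \<le> C" if "z \<ge> z0" for z m using K(2)[OF that, of m] KC by simp
    fix z m assume z: "z \<ge> z0"
    then have zp: "z > 0" using z0 by simp
    define x where "x = exp (- Lm m z)"
    have "Lm m z \<ge> z0" using Lm_ge[OF zp, of m] Suc_le_mu_power[of m] mult_right_mono[of 1 "real mu ^ m" z] z zp by linarith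
    then have x: "0 < x" "x \<le> q" by (auto simp: x_def q_def)
    have inc: "Pm (m + n) z - Pm m z \<le> K * c * (\<Sum>i<n. x ^ Suc i)" for n
    proof (induction n)
      case (Suc n)
      have "Pm (Suc (m + n)) z - Pm (m + n) z = Pm (m + n) z * (Dm (Lm (m + n) z) / mu - 1)"
        by (simp add: Pm_Suc algebra_simps)
      also have "\<dots> \<le> K * (c * x ^ Suc n)"
      proof (intro mult_mono)
        have "Dm (Lm (m + n) z) / mu - 1 \<le> c * exp (- Lm (m + n) z)"
          using Dm_ratio(2)[OF Lm_pos[OF zp], of "m + n"] by (simp add: c_def)
        also have "\<dots> \<le> c * x ^ Suc n" unfolding x_def using c exp_Lm_add_le[OF zp, of m n] by (intro mult_left_mono) auto
        finally show "Dm (Lm (m + n) z) / mu - 1 \<le> c * x ^ Suc n" .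
        show "0 \<le> Dm (Lm (m + n) z) / mu - 1" using Dm_ratio(1)[OF Lm_pos[OF zp], of "m + n"] by simp
      qed (use K z in auto)
      finally show ?case using Suc by (simp add: algebra_simps del: power_Suc)
    qed simp
    have "Pm (m + n) z \<le> Pm m z + C * x" for n
    proof -
      have "K * c * (\<Sum>i<n. x ^ Suc i) \<le> K * c * (x / (1 - q))"
        using K c x q by (intro mult_left_mono sum_power_Suc_le) auto
      also have "\<dots> \<le> C * x" unfolding C_def using K x by (simp add: distrib_right)
      finally show ?thesis using inc[of n] by simp
    qed
    moreover have "(\<lambda>n. Pm (m + n) z) \<longlonglongrightarrow> Pf z"
      using LIMSEQ_ignore_initial_segment[OF Pm_tendsto[OF zp], of m] by (simp add: add.commute)
    ultimately have "Pf z \<le> Pm m z + C * x" by (intro LIMSEQ_le_const2) auto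
    then show "\<bar>Pf z - Pm m z\<bar> \<le> C * exp (- Lm m z)" using Pm_le_Pf[OF zp, of m] by (simp add: x_def)
  qed
qed

lemma Pf_antimono: "0 < x \<Longrightarrow> x \<le> y \<Longrightarrow> Pf y \<le> Pf x"
  by (rule LIMSEQ_le[OF Pm_tendsto Pm_tendsto])
     (auto simp: Pm_def intro!: divide_right_mono Mm_antimono)

lemma Pm_uniform_limit:
  assumes z0: "z0 > 0" and e: "e > 0"
  shows "\<forall>\<^sub>F m in sequentially. \<forall>z\<in>{z0<..}. \<bar>Pm m z - Pf z\<bar> < e"
proof -
  obtain C where C: "C > 0" "\<And>z m. z \<ge> z0 \<Longrightarrow> \<bar>Pf z - Pm m z\<bar> \<le> C * exp (- Lm m z)"
    by (rule Pf_error[OF z0]) (rule that, assumption+)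
  have "(\<lambda>m. C * exp (- z0) ^ Suc m) \<longlonglongrightarrow> C * 0"
    using z0 by (intro tendsto_mult tendsto_const LIMSEQ_Suc LIMSEQ_realpow_zero) auto
  then have "\<forall>\<^sub>F m in sequentially. C * exp (- z0) ^ Suc m < e" using e by (auto elim: order_tendstoD)
  then show ?thesis
  proof eventually_elim
    case (elim m)
    show ?case
    proof
      fix z assume "z \<in> {z0<..}"
      then have z: "z \<ge> z0" by simp
      have "\<bar>Pf z - Pm m z\<bar> \<le> C * exp (- Lm m z)" by (rule C(2)[OF z])
      also have "\<dots> \<le> C * exp (- z0) ^ Suc m" using C(1) exp_Lm_le[OF z0 z, of m] by (intro mult_left_mono) auto
      finally show "\<bar>Pm m z - Pf z\<bar> < e" using elim by simp
    qed
  qed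
qed

lemma isCont_Pf: assumes "z > 0" shows "isCont Pf z"
proof -
  have "continuous_on {z/2<..} Pf"
  proof (rule uniform_limit_theorem)
    show "uniform_limit {z/2<..} Pm Pf sequentially"
      unfolding uniform_limit_iff using Pm_uniform_limit[of "z/2"] assms by (auto simp: dist_real_def)
    show "\<forall>\<^sub>F m in sequentially. continuous_on {z/2<..} (Pm m)"
    proof (rule always_eventually, rule allI)
      fix m
      have "continuous_on {z/2<..} (Mm m)"
        by (rule continuous_at_imp_continuous_on, intro ballI DERIV_isCont[OF DERIV_Mm]) (use assms in auto)
      then show "continuous_on {z/2<..} (Pm m)"
        unfolding Pm_def[abs_def] using mu_pos by (intro continuous_intros) auto
    qed
  qed simp
  then show ?thesis using assms by (simp add: continuous_on_eq_continuous_at)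
qed

section \<open>The logarithmic Boettcher function and its derivative\<close>

definition "bt z = lim (\<lambda>m. Lm m z / real mu ^ m)"

lemma Lm_le: "z > 0 \<Longrightarrow> Lm m z \<le> real mu ^ m * z + C0 * (real mu ^ m - 1)"
proof (induction m)
  case (Suc m)
  have "Lm (Suc m) z \<le> real mu * Lm m z + C0" unfolding Lm_Suc by (rule Lam_le[OF Lm_pos[OF Suc.prems]])
  also have "\<dots> \<le> real mu * (real mu ^ m * z + C0 * (real mu ^ m - 1)) + C0" using Suc mu_pos by simp
  \<comment> \<open>The bound uses \<mu>^m - 1 where the recursion would give (\<mu>^m - 1) / (\<mu>
    - 1); the slack \<open>C0 * (mu - 2)\<close> is nonnegative because \<mu> \<ge> 2.\<close>
  also have "\<dots> = real mu ^ Suc m * z + C0 * (real mu ^ Suc m - 1) - C0 * (mu - 2)" using mu_ge_2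
    by (simp add: algebra_simps of_nat_diff)
  also have "\<dots> \<le> real mu ^ Suc m * z + C0 * (real mu ^ Suc m - 1)" using C0_nonneg by simp
  finally show ?case .
qed simp

lemma Lm_ratio_mono: "z > 0 \<Longrightarrow> incseq (\<lambda>m. Lm m z / real mu ^ m)"
proof (rule incseq_SucI)
  fix m assume z: "z > 0"
  have "Lm m z / real mu ^ m = real mu * Lm m z / real mu ^ Suc m" using mu_pos by simp
  also have "\<dots> \<le> Lm (Suc m) z / real mu ^ Suc m"
    unfolding Lm_Suc using Lam_ge[OF Lm_pos[OF z, of m]] by (intro divide_right_mono) auto
  finally show "Lm m z / real mu ^ m \<le> Lm (Suc m) z / real mu ^ Suc m" by simp
qed

lemma Lm_ratio_le: assumes "z > 0" shows "Lm m z / real mu ^ m \<le> z + C0"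
proof -
  have "Lm m z \<le> (z + C0) * real mu ^ m" using Lm_le[OF assms, of m] C0_nonneg by (simp add: algebra_simps)
  then show ?thesis using mu_pos by (simp add: divide_le_eq)
qed

lemma bt_tendsto: assumes z: "z > 0" shows "(\<lambda>m. Lm m z / real mu ^ m) \<longlonglongrightarrow> bt z"
proof -
  obtain L where "(\<lambda>m. Lm m z / real mu ^ m) \<longlonglongrightarrow> L"
    by (rule incseq_convergent[OF Lm_ratio_mono[OF z], of "z + C0"]) (use Lm_ratio_le[OF z] that in auto)
  then show ?thesis unfolding bt_def by (simp add: limI)
qed

text \<open>The distance from the identity is bounded uniformly in z. Since \<open>bt\<close> is
  exactly multiplicative along iterates, an iterate may be replaced by its \<open>bt\<close>; the
  cost is the constant \<open>C0\<close> in an exponent, that is, a bounded factor.\<close>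

lemma bt_bounds: assumes "z > 0" shows "z \<le> bt z" "bt z \<le> z + C0"
  using incseq_le[OF Lm_ratio_mono[OF assms] bt_tendsto[OF assms], of 0]
    LIMSEQ_le_const2[OF bt_tendsto[OF assms]] Lm_ratio_le[OF assms] by auto

lemma bt_Lam: assumes z: "z > 0" shows "bt (Lam z) = mu * bt z"
proof -
  have "(\<lambda>m. mu * (Lm (Suc m) z / real mu ^ Suc m)) \<longlonglongrightarrow> mu * bt z"
    by (intro tendsto_mult tendsto_const LIMSEQ_Suc[OF bt_tendsto[OF z]])
  moreover have "mu * (Lm (Suc m) z / real mu ^ Suc m) = Lm m (Lam z) / real mu ^ m" for m
    using mu_pos by (simp add: Lm_Suc2)
  ultimately show ?thesis using bt_tendsto[OF Lam_pos[OF z]] LIMSEQ_unique by simp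
qed

text \<open>Termwise differentiation, by uniform convergence of \<open>Pm\<close> to
  \<open>Pf\<close> on a half line around z. The theorem on sequences of derivatives provides only
  some limit function \<open>g\<close>, which is identified with \<open>bt\<close>
  afterwards.\<close>

lemma DERIV_bt: assumes z: "z > 0" shows "(bt has_real_derivative Pf z) (at z)"
proof -
  define S where "S = {z/2<..}"
  have "\<exists>g. \<forall>x\<in>S. (\<lambda>m. Lm m x / real mu ^ m) \<longlonglongrightarrow> g x \<and> (g has_derivative (\<lambda>h. Pf x * h)) (at x within S)"
  proof (rule has_derivative_sequence)
    show "convex S" unfolding S_def by (rule convex_real_interval)
    show "((\<lambda>x. Lm m x / real mu ^ m) has_derivative (\<lambda>h. Pm m x * h)) (at x within S)" if "x \<in> S" for m x
    proof -
      have "((\<lambda>x. Lm m x / real mu ^ m) has_real_derivative Pm m x) (at x within S)"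
        unfolding Pm_def using that z
        by (intro DERIV_cdivide has_field_derivative_at_within[OF DERIV_Lm]) (auto simp: S_def)
      then show ?thesis by (simp add: has_field_derivative_def)
    qed
    show "\<forall>\<^sub>F m in sequentially. \<forall>x\<in>S. \<forall>h. norm (Pm m x * h - Pf x * h) \<le> e * norm h" if "e > 0" for e
    proof (rule eventually_mono[OF Pm_uniform_limit[of "z/2" e]], goal_cases)
      case (3 m)
      have "\<bar>Pm m x - Pf x\<bar> * \<bar>h\<bar> \<le> e * \<bar>h\<bar>" if "x \<in> S" for x h
        using 3 that by (intro mult_right_mono) (auto simp: S_def intro: less_imp_le)
      then show ?case by (simp add: left_diff_distrib[symmetric] abs_mult)
    qed (use z that in auto)
    show "z \<in> S" using z by (simp add: S_def)
    show "(\<lambda>m. Lm m z / real mu ^ m) \<longlonglongrightarrow> bt z" by (rule bt_tendsto[OF z])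
  qed
  then obtain g where g: "\<And>x. x \<in> S \<Longrightarrow> (\<lambda>m. Lm m x / real mu ^ m) \<longlonglongrightarrow> g x"
     "\<And>x. x \<in> S \<Longrightarrow> (g has_derivative (\<lambda>h. Pf x * h)) (at x within S)" by blast
  have zS: "z \<in> S" "open S" using z by (auto simp: S_def)
  have eq: "g x = bt x" if "x \<in> S" for x
  proof (rule LIMSEQ_unique[OF g(1)[OF that]])
    show "(\<lambda>m. Lm m x / real mu ^ m) \<longlonglongrightarrow> bt x" using that z by (intro bt_tendsto) (simp add: S_def)
  qed
  have "at z within S = at z" by (rule at_within_open[OF zS])
  then have "(g has_real_derivative Pf z) (at z)"
    using g(2)[OF zS(1)] by (simp add: has_field_derivative_def)
  then show ?thesis by (rule has_field_derivative_transform_within_open[OF _ zS(2,1) eq])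
qed

text \<open>Under tilting by \<open>exp (- z)\<close> the \<open>k\<close>-th generation has minimal size with probability
  \<open>exp (- Ggap k z)\<close>.\<close>

definition "Ggap k z = C0 * (\<Sum>i<k. real mu ^ i) + real mu ^ k * z - Lm k z"

text \<open>Unfolded, \<open>Ggap k z\<close> is the sum over i < k of \<mu>^(k-1-i)
  \<open>Lgap (Lm i z)\<close>: each of the \<mu>^(k-1-i) individuals of generation k-1-i must have
  exactly \<mu> children, under an offspring law tilted by \<open>Lm i z\<close>.\<close>

lemma Ggap_Suc: "Ggap (Suc k) z = mu * Ggap k z + Lgap (Lm k z)"
proof -
  have "(\<Sum>i<Suc k. real mu ^ i) = 1 + mu * (\<Sum>i<k. real mu ^ i)"
    by (subst sum.lessThan_Suc_shift) (simp add: sum_distrib_left)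
  then show ?thesis by (simp add: Ggap_def Lgap_def Lm_Suc algebra_simps)
qed

lemma Lm_ge_self: assumes z: "z > 0" shows "Lm k z \<ge> z"
proof -
  have "1 * z \<le> real mu ^ k * z" using z Suc_le_mu_power[of k] by (intro mult_right_mono) auto
  then show ?thesis using Lm_ge[OF z, of k] by simp
qed

text \<open>Every iterate is at least z, so all terms are bounded through the argument z. The factor
  \<mu>^k - 1 in place of the geometric sum again uses \<mu> \<ge> 2.\<close>

lemma Ggap_upper:
  assumes z: "z > 0"
  shows "Ggap k z \<le> (real mu ^ k - 1) * (exp (- ((real la - mu) * z)) / pmf p mu)"
proof (induction k)
  case (Suc k)
  define E where "E = exp (- ((real la - mu) * z)) / pmf p mu"
  have E: "E \<ge> 0" using pmf_mu_pos by (simp add: E_def)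
  have "Lgap (Lm k z) \<le> exp (- ((real la - mu) * Lm k z)) / pmf p mu" by (rule Lgap_bounds[OF Lm_pos[OF z]])
  also have "\<dots> \<le> E" unfolding E_def
    using Lm_ge_self[OF z, of k] la_properties(1) pmf_mu_pos by (auto intro!: divide_right_mono mult_left_mono)
  finally have "Ggap (Suc k) z \<le> mu * ((real mu ^ k - 1) * E) + E"
    unfolding Ggap_Suc using Suc mu_pos by (intro add_mono mult_left_mono) (auto simp: E_def)
  also have "\<dots> = (real mu ^ Suc k - 1) * E - (mu - 2) * E" using mu_ge_2 by (simp add: algebra_simps of_nat_diff)
  also have "\<dots> \<le> (real mu ^ Suc k - 1) * E" using E by simp
  finally show ?case unfolding E_def .
qed (simp add: Ggap_def)

lemma Ggap_nonneg: "z > 0 \<Longrightarrow> Ggap k z \<ge> 0"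
  by (induction k) (auto simp: Ggap_Suc Lgap_bounds(3) Lm_pos, simp add: Ggap_def)

text \<open>Only the contribution of generation k is kept, the last one before generation k + 1. It
  has the largest multiplicity and the smallest argument, so it already has the order of the whole
  sum.\<close>

lemma Ggap_lower:
  assumes z: "z > 0" shows "Ggap (Suc k) z \<ge> real mu ^ k * Lgap z"
proof (induction k)
  case (Suc k)
  have "real mu * (real mu ^ k * Lgap z) \<le> mu * Ggap (Suc k) z" using Suc by (intro mult_left_mono) auto
  also have "\<dots> \<le> Ggap (Suc (Suc k)) z" unfolding Ggap_Suc[of "Suc k"] using Lgap_bounds(3)[OF Lm_pos[OF z]] by simp
  finally show ?case by (simp add: mult_ac)
qed (simp add: Ggap_def Lgap_def Lm_Suc[of 0])

text \<open>The ratio of \<open>Vm\<close> to \<open>Mm\<close> satisfies a recursion with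
  increments at most \<open>Dv (Lm m z) * Mm m z\<close>. Since \<open>Lm m z\<close> is at least
  \<mu>^m z0 and exp (- t) \<le> 2 / t^2, these are of order \<mu>^(-m), at most a multiple of
  2^(-m). Hence the ratio stays bounded.\<close>

lemma Vm_le:
  assumes z0: "z0 > 0"
  obtains C where "C > 0" "\<And>z m. z \<ge> z0 \<Longrightarrow> Vm m z \<le> C * real mu ^ m"
proof -
  obtain K where K: "K > 0" "\<And>z m. z \<ge> z0 \<Longrightarrow> Pm m z \<le> K" using Pm_bounded[OF z0] by blast
  obtain C1 where C1: "C1 > 0" "\<And>z. z \<ge> z0 \<Longrightarrow> Dv z \<le> C1 * exp (- z)" using Dv_le[OF z0] by blast
  have M: "Mm m z \<le> K * real mu ^ m" if "z \<ge> z0" for m z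
    using K(2)[OF that, of m] mu_pos by (simp add: Pm_def divide_le_eq)
  define C2 where "C2 = C1 * K * (2 / z0\<^sup>2)"
  have C2: "C2 > 0" using C1 K z0 by (simp add: C2_def)
  have R: "Vm m z \<le> Mm m z * (C2 * (\<Sum>i<m. (1/2) ^ i))" if z: "z \<ge> z0" for m z
  proof (induction m)
    case (Suc m)
    have zp: "z > 0" using z z0 by simp
    have L: "Lm m z \<ge> z0" using Lm_ge_self[OF zp, of m] z by simp
    define t where "t = real mu ^ m * z0"
    have t: "t > 0" using z0 mu_pos by (simp add: t_def)
    have "exp (- Lm m z) \<le> exp (- t)"
      using Lm_ge[OF zp, of m] mult_left_mono[OF z, of "real mu ^ m"] by (simp add: t_def)
    also have "\<dots> \<le> 2 / t\<^sup>2"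
      using power_le_fact_exp[of t 2] t by (simp add: exp_minus fact_2 field_simps)
    finally have "Dv (Lm m z) * Mm m z \<le> (C1 * (2 / t\<^sup>2)) * (K * real mu ^ m)"
      using C1 M[OF z, of m] P.tvar_nonneg[OF Lm_pos[OF zp, of m]] less_imp_le[OF Mm_pos[OF zp, of m]]
      by (intro mult_mono order_trans[OF C1(2)[OF L]] mult_left_mono) auto
    also have "\<dots> = C2 * (1 / mu) ^ m"
      using mu_pos z0 by (simp add: C2_def t_def power2_eq_square field_simps)
    also have "\<dots> \<le> C2 * (1/2) ^ m" using mu_pos C2 by (intro mult_left_mono power_mono) (auto simp: field_simps)
    finally have 1: "Dv (Lm m z) * Mm m z \<le> C2 * (1/2) ^ m" .
    have "Vm (Suc m) z = Mm m z * (Dv (Lm m z) * Mm m z) + Dm (Lm m z) * Vm m z"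
      by (simp add: Vm_Suc power2_eq_square mult_ac)
    also have "Mm m z * (Dv (Lm m z) * Mm m z) \<le> Mm m z * (C2 * (1/2) ^ m)"
      using 1 less_imp_le[OF Mm_pos[OF zp, of m]] by (intro mult_left_mono) auto
    also have "\<dots> \<le> Mm m z * Dm (Lm m z) * (C2 * (1/2) ^ m)"
    proof -
      have "1 \<le> Dm (Lm m z)" using Dm_ge_mu[OF Lm_pos[OF zp, of m]] mu_pos by linarith
      then have "Mm m z * 1 \<le> Mm m z * Dm (Lm m z)"
        using less_imp_le[OF Mm_pos[OF zp, of m]] by (intro mult_left_mono) auto
      then show ?thesis using C2 by (intro mult_right_mono) auto
    qed
    also have "Dm (Lm m z) * Vm m z \<le> Dm (Lm m z) * (Mm m z * (C2 * (\<Sum>i<m. (1/2) ^ i)))"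
      using Suc Dm_ge_mu[OF Lm_pos[OF zp, of m]] mu_pos by (intro mult_left_mono) auto
    also have "Mm m z * Dm (Lm m z) * (C2 * (1/2) ^ m) + Dm (Lm m z) * (Mm m z * (C2 * (\<Sum>i<m. (1/2) ^ i)))
      = Mm (Suc m) z * (C2 * (\<Sum>i<Suc m. (1/2) ^ i))"
      by (simp add: Mm_def algebra_simps)
    finally show ?case by simp
  qed (simp add: Vm_def Mm_def)
  show ?thesis
  proof (rule that[of "K * (C2 * 2)"])
    show "K * (C2 * 2) > 0" using K C2 by simp
    fix z m assume z: "z \<ge> z0"
    have "(\<Sum>i<m. (1/2::real) ^ i) \<le> 2"
      by (subst sum_gp_strict) (auto simp: field_simps)
    then have "Mm m z * (C2 * (\<Sum>i<m. (1/2) ^ i)) \<le> K * real mu ^ m * (C2 * 2)"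
      using M[OF z, of m] C2 z z0 less_imp_le[OF Mm_pos, of z m] by (intro mult_mono) (auto intro!: sum_nonneg mult_nonneg_nonneg)
    then show "Vm m z \<le> K * (C2 * 2) * real mu ^ m" using R[OF z, of m] by (simp add: mult_ac)
  qed
qed

end

section \<open>Independence of generations\<close>

lemma measurable_nat_add:
  fixes f g :: "'a \<Rightarrow> nat"
  assumes [measurable]: "f \<in> M \<rightarrow>\<^sub>M count_space UNIV" "g \<in> M \<rightarrow>\<^sub>M count_space UNIV"
  shows "(\<lambda>x. f x + g x) \<in> M \<rightarrow>\<^sub>M count_space UNIV"
  by (rule measurable_compose_countable[where f = "\<lambda>i x. i + g x" and g = f]) measurable

lemma measurable_nat_sum:
  fixes f :: "'i \<Rightarrow> 'a \<Rightarrow> nat"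
  assumes "finite I" "\<And>i. i \<in> I \<Longrightarrow> f i \<in> M \<rightarrow>\<^sub>M count_space UNIV"
  shows "(\<lambda>x. \<Sum>i\<in>I. f i x) \<in> M \<rightarrow>\<^sub>M count_space UNIV"
  using assms by (induction I rule: finite_induct) (auto intro!: measurable_nat_add)

locale galton_watson = prob_space M for M :: "'w measure" +
  fixes p :: "nat pmf" and X :: "nat \<Rightarrow> nat \<Rightarrow> 'w \<Rightarrow> nat" and mu la :: nat and a :: real
  defines "mu \<equiv> off_min p" and "la \<equiv> off_next p" and "a \<equiv> off_mean p"
  assumes indep: "indep_vars (\<lambda>_. count_space UNIV) (\<lambda>(n, i). X n i) UNIV"
    and distr_X: "\<And>n i. distr M (count_space UNIV) (X n i) = measure_pmf p"
    and nondegenerate: "\<not> (\<exists>c. AE n in measure_pmf p. n = c)"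
    and integrable_n_log_n: "integrable (measure_pmf p) (\<lambda>n. real n * ln (real n))"
    and mu_ge_2: "2 \<le> mu"
begin

lemma integrable_mean: "integrable (measure_pmf p) real"
proof (rule Bochner_Integration.integrable_bound)
  show "integrable (measure_pmf p) (\<lambda>n. real n * ln (real n) + 3)"
    using integrable_n_log_n by simp
  show "AE n in measure_pmf p. norm (real n) \<le> norm (real n * ln (real n) + 3)"
  proof (rule AE_I2)
    fix n :: nat
    show "norm (real n) \<le> norm (real n * ln (real n) + 3)"
    proof (cases "n \<le> 3")
      case True
      have "0 \<le> real n * ln (real n)" by (cases "n = 0") auto
      then show ?thesis using True by simp
    next
      case False
      have "exp 1 \<le> (3::real)" by (rule exp_le)
      then have "exp 1 \<le> real n" using False by linarith
      then have "1 \<le> ln (real n)" using False by (subst ln_ge_iff) auto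
      then have "real n * 1 \<le> real n * ln (real n)" by (intro mult_left_mono) auto
      then show ?thesis by simp
    qed
  qed
qed simp

sublocale offspring p mu la a
  unfolding mu_def la_def a_def
  by unfold_locales (use nondegenerate mu_ge_2 integrable_mean in \<open>auto simp: mu_def\<close>)

lemma X_measurable [measurable]: "X n i \<in> M \<rightarrow>\<^sub>M count_space UNIV"
  using indep unfolding indep_vars_def by (auto dest: bspec[of _ _ "(n,i)"])

lemma expectation_X:
  fixes g :: "nat \<Rightarrow> 'b::{banach, second_countable_topology}"
  shows "expectation (\<lambda>\<omega>. g (X n i \<omega>)) = measure_pmf.expectation p g"
  unfolding distr_X[of n i, symmetric] by (subst integral_distr) auto

lemma integrable_X:
  fixes g :: "nat \<Rightarrow> 'b::{banach, second_countable_topology}"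
  shows "integrable M (\<lambda>\<omega>. g (X n i \<omega>)) \<longleftrightarrow> integrable (measure_pmf p) g"
  unfolding distr_X[of n i, symmetric] by (subst integrable_distr_eq) auto

lemma AE_X: "(AE \<omega> in M. Q (X n i \<omega>)) \<longleftrightarrow> (AE k in measure_pmf p. Q k)"
  unfolding distr_X[of n i, symmetric] by (subst AE_distr_iff) auto

section \<open>Generation sizes as functions of the past, and independence of the next row\<close>

abbreviation "Z \<equiv> gw_size X"
abbreviation "W \<equiv> gw_limit p X"

text \<open>The generation size as a function of the array of offspring counts alone; in this form
  it factors through the projection to \<open>past n\<close>, to which independence of disjoint
  index blocks applies.\<close>

definition zf :: "nat \<Rightarrow> (nat \<times> nat \<Rightarrow> nat) \<Rightarrow> nat" where
  "zf n x = gw_size (\<lambda>m i x. x (m, i)) n x"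

lemma zf_0 [simp]: "zf 0 x = 1" and zf_Suc: "zf (Suc n) x = (\<Sum>i<zf n x. x (n, i))"
  by (auto simp: zf_def)

abbreviation "cs \<equiv> \<lambda>_::nat \<times> nat. count_space (UNIV :: nat set)"

lemma zf_measurable:
  "{..<n} \<times> UNIV \<subseteq> I \<Longrightarrow> zf n \<in> PiM I cs \<rightarrow>\<^sub>M count_space UNIV"
proof (induction n)
  case 0
  have "zf 0 = (\<lambda>_. 1)" by (simp add: fun_eq_iff)
  then show ?case by simp
next
  case (Suc n)
  have [measurable]: "zf n \<in> PiM I cs \<rightarrow>\<^sub>M count_space UNIV" using Suc by force
  have "(\<lambda>x. \<Sum>i<l. x (n, i)) \<in> PiM I cs \<rightarrow>\<^sub>M count_space UNIV" for l
    using Suc.prems by (intro measurable_nat_sum measurable_component_singleton) auto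
  then have "(\<lambda>x. \<Sum>i<zf n x. x (n, i)) \<in> PiM I cs \<rightarrow>\<^sub>M count_space UNIV"
    by (rule measurable_compose_countable[where g = "zf n"]) measurable
  then show ?case by (simp add: zf_Suc[abs_def])
qed

definition "past n = {..<n::nat} \<times> (UNIV::nat set)"
definition "proj I \<omega> = restrict (\<lambda>(m, i). X m i \<omega>) I"

lemma proj_measurable [measurable]: "proj I \<in> M \<rightarrow>\<^sub>M PiM I cs"
  unfolding proj_def by (intro measurable_restrict) auto

lemma Z_eq_zf: "past n \<subseteq> I \<Longrightarrow> Z n \<omega> = zf n (proj I \<omega>)"
proof (induction n)
  case (Suc n)
  then have "Z n \<omega> = zf n (proj I \<omega>)" by (force simp: past_def)
  moreover have "X n i \<omega> = proj I \<omega> (n, i)" for i using Suc.prems by (auto simp: proj_def past_def)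
  ultimately show ?case by (simp add: zf_Suc)
qed simp

lemma Z_measurable [measurable]: "Z n \<in> M \<rightarrow>\<^sub>M count_space UNIV"
proof -
  have "(\<lambda>\<omega>. zf n (proj (past n) \<omega>)) \<in> M \<rightarrow>\<^sub>M count_space UNIV"
    by (rule measurable_compose[OF proj_measurable zf_measurable]) (simp add: past_def)
  then show ?thesis by (simp add: Z_eq_zf[of n "past n", symmetric])
qed

lemma joint_distr:
  "distr M (PiM (past n) cs \<Otimes>\<^sub>M PiM ({n} \<times> UNIV) cs) (\<lambda>\<omega>. (proj (past n) \<omega>, proj ({n} \<times> UNIV) \<omega>))
   = distr M (PiM (past n) cs) (proj (past n)) \<Otimes>\<^sub>M distr M (PiM ({n} \<times> UNIV) cs) (proj ({n} \<times> UNIV))"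
proof -
  have "indep_var (PiM (past n) cs) (\<lambda>\<omega>. restrict (\<lambda>i. (case i of (n, i) \<Rightarrow> X n i) \<omega>) (past n))
      (PiM ({n} \<times> UNIV) cs) (\<lambda>\<omega>. restrict (\<lambda>i. (case i of (n, i) \<Rightarrow> X n i) \<omega>) ({n} \<times> UNIV))"
    by (rule indep_var_restrict[OF indep]) (auto simp: past_def)
  moreover have "restrict (\<lambda>i. (case i of (n, i) \<Rightarrow> X n i) \<omega>) I = proj I \<omega>" for I \<omega>
    by (auto simp: proj_def fun_eq_iff restrict_def split: prod.split)
  ultimately show ?thesis unfolding indep_var_distribution_eq by simp
qed

text \<open>Independence in the form of freezing: the past is held fixed at \<omega> while the
  counts of generation n are averaged over a second variable \<omega>'.\<close>

lemma nn_integral_past_present: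
  assumes [measurable]: "G \<in> borel_measurable (PiM (past n) cs \<Otimes>\<^sub>M PiM ({n} \<times> UNIV) cs)"
  shows "(\<integral>\<^sup>+\<omega>. G (proj (past n) \<omega>, proj ({n} \<times> UNIV) \<omega>) \<partial>M)
     = (\<integral>\<^sup>+\<omega>. (\<integral>\<^sup>+\<omega>'. G (proj (past n) \<omega>, proj ({n} \<times> UNIV) \<omega>') \<partial>M) \<partial>M)"
proof -
  interpret B: prob_space "distr M (PiM ({n} \<times> UNIV) cs) (proj ({n} \<times> UNIV))"
    by (rule prob_space_distr) measurable
  have "(\<integral>\<^sup>+\<omega>. G (proj (past n) \<omega>, proj ({n} \<times> UNIV) \<omega>) \<partial>M) =
    (\<integral>\<^sup>+z. G z \<partial>(distr M (PiM (past n) cs) (proj (past n)) \<Otimes>\<^sub>M distr M (PiM ({n} \<times> UNIV) cs) (proj ({n} \<times> UNIV))))"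
    unfolding joint_distr[symmetric] by (subst nn_integral_distr) auto
  also have "\<dots> = (\<integral>\<^sup>+x. (\<integral>\<^sup>+y. G (x, y) \<partial>distr M (PiM ({n} \<times> UNIV) cs) (proj ({n} \<times> UNIV))) \<partial>distr M (PiM (past n) cs) (proj (past n)))"
    by (rule B.nn_integral_fst[symmetric]) simp
  also have "\<dots> = (\<integral>\<^sup>+\<omega>. (\<integral>\<^sup>+y. G (proj (past n) \<omega>, y) \<partial>distr M (PiM ({n} \<times> UNIV) cs) (proj ({n} \<times> UNIV))) \<partial>M)"
    by (subst nn_integral_distr) auto
  also have "\<dots> = (\<integral>\<^sup>+\<omega>. (\<integral>\<^sup>+\<omega>'. G (proj (past n) \<omega>, proj ({n} \<times> UNIV) \<omega>') \<partial>M) \<partial>M)"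
  proof (rule nn_integral_cong)
    fix \<omega> assume "\<omega> \<in> space M"
    then have [simp]: "proj (past n) \<omega> \<in> space (PiM (past n) cs)" by (rule measurable_space[OF proj_measurable])
    show "(\<integral>\<^sup>+y. G (proj (past n) \<omega>, y) \<partial>distr M (PiM ({n} \<times> UNIV) cs) (proj ({n} \<times> UNIV)))
      = (\<integral>\<^sup>+\<omega>'. G (proj (past n) \<omega>, proj ({n} \<times> UNIV) \<omega>') \<partial>M)"
      by (subst nn_integral_distr) auto
  qed
  finally show ?thesis .
qed

lemma integral_past_present:
  fixes G :: "_ \<Rightarrow> complex"
  assumes [measurable]: "G \<in> borel_measurable (PiM (past n) cs \<Otimes>\<^sub>M PiM ({n} \<times> UNIV) cs)"
    and bnd: "\<And>z. cmod (G z) \<le> 1"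
  shows "(\<integral>\<omega>. G (proj (past n) \<omega>, proj ({n} \<times> UNIV) \<omega>) \<partial>M)
     = (\<integral>\<omega>. (\<integral>\<omega>'. G (proj (past n) \<omega>, proj ({n} \<times> UNIV) \<omega>') \<partial>M) \<partial>M)"
proof -
  interpret B: prob_space "distr M (PiM ({n} \<times> UNIV) cs) (proj ({n} \<times> UNIV))"
    by (rule prob_space_distr) measurable
  interpret A: prob_space "distr M (PiM (past n) cs) (proj (past n))"
    by (rule prob_space_distr) measurable
  interpret AB: pair_prob_space "distr M (PiM (past n) cs) (proj (past n))" "distr M (PiM ({n} \<times> UNIV) cs) (proj ({n} \<times> UNIV))" ..
  have "(\<integral>\<omega>. G (proj (past n) \<omega>, proj ({n} \<times> UNIV) \<omega>) \<partial>M) =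
    (\<integral>z. G z \<partial>(distr M (PiM (past n) cs) (proj (past n)) \<Otimes>\<^sub>M distr M (PiM ({n} \<times> UNIV) cs) (proj ({n} \<times> UNIV))))"
    unfolding joint_distr[symmetric] by (subst integral_distr) auto
  also have "\<dots> = (\<integral>x. (\<integral>y. G (x, y) \<partial>distr M (PiM ({n} \<times> UNIV) cs) (proj ({n} \<times> UNIV))) \<partial>distr M (PiM (past n) cs) (proj (past n)))"
    by (rule AB.integral_fst'[symmetric], rule AB.integrable_const_bound[where B = 1]) (use bnd in auto)
  also have "\<dots> = (\<integral>\<omega>. (\<integral>y. G (proj (past n) \<omega>, y) \<partial>distr M (PiM ({n} \<times> UNIV) cs) (proj ({n} \<times> UNIV))) \<partial>M)"
    by (subst integral_distr) (auto intro!: B.borel_measurable_lebesgue_integral)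
  also have "\<dots> = (\<integral>\<omega>. (\<integral>\<omega>'. G (proj (past n) \<omega>, proj ({n} \<times> UNIV) \<omega>') \<partial>M) \<partial>M)"
  proof (rule Bochner_Integration.integral_cong[OF refl])
    fix \<omega> assume "\<omega> \<in> space M"
    then have [simp]: "proj (past n) \<omega> \<in> space (PiM (past n) cs)" by (rule measurable_space[OF proj_measurable])
    show "(\<integral>y. G (proj (past n) \<omega>, y) \<partial>distr M (PiM ({n} \<times> UNIV) cs) (proj ({n} \<times> UNIV)))
      = (\<integral>\<omega>'. G (proj (past n) \<omega>, proj ({n} \<times> UNIV) \<omega>') \<partial>M)"
      by (subst integral_distr) auto
  qed
  finally show ?thesis .
qed

lemma present_sum_measurable:
  "(\<lambda>z. \<Sum>i<zf n (fst z). snd z (n, i)) \<in> PiM (past n) cs \<Otimes>\<^sub>M PiM ({n} \<times> UNIV) cs \<rightarrow>\<^sub>M count_space UNIV"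
proof -
  have [measurable]: "zf n \<in> PiM (past n) cs \<rightarrow>\<^sub>M count_space UNIV" by (rule zf_measurable) (simp add: past_def)
  have *: "(\<lambda>x. x (n, i)) \<in> PiM ({n} \<times> UNIV) cs \<rightarrow>\<^sub>M count_space UNIV" for i
    by (rule measurable_component_singleton) auto
  have "(\<lambda>z. \<Sum>i<l. snd z (n, i)) \<in> PiM (past n) cs \<Otimes>\<^sub>M PiM ({n} \<times> UNIV) cs \<rightarrow>\<^sub>M count_space UNIV" for l
    by (intro measurable_nat_sum) (auto intro!: measurable_compose[OF measurable_snd *])
  then show ?thesis
    by (rule measurable_compose_countable[where g = "\<lambda>z. zf n (fst z)"]) measurable
qed

section \<open>Generating functions of the generation sizes at complex arguments\<close>

definition cpgf :: "complex \<Rightarrow> complex" where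
  "cpgf \<zeta> = measure_pmf.expectation p (\<lambda>n. \<zeta> ^ n)"

lemma cpgf_le_1: "cmod \<zeta> \<le> 1 \<Longrightarrow> cmod (cpgf \<zeta>) \<le> 1"
proof -
  assume "cmod \<zeta> \<le> 1"
  then have "cmod (cpgf \<zeta>) \<le> measure_pmf.expectation p (\<lambda>n. 1)"
    unfolding cpgf_def
    by (intro order_trans[OF integral_norm_bound] integral_mono measure_pmf.integrable_const_bound[where B = 1])
       (auto simp: norm_power intro!: power_le_one)
  then show ?thesis by simp
qed

lemma indep_row: "indep_vars (\<lambda>_. count_space UNIV) (\<lambda>i. X n i) (I :: nat set)"
proof -
  have "indep_vars (\<lambda>_. count_space UNIV) (\<lambda>j \<omega>. (\<lambda>x. x (n, j)) (restrict (\<lambda>k. (case k of (n, i) \<Rightarrow> X n i) \<omega>) {(n, j)})) I"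
    by (rule indep_vars_compose2[OF indep_vars_restrict[OF indep]])
       (auto simp: disjoint_family_on_def intro!: measurable_component_singleton)
  then show ?thesis by simp
qed

lemma expectation_prod_row:
  assumes "cmod \<zeta> \<le> 1"
  shows "expectation (\<lambda>\<omega>. \<zeta> ^ (\<Sum>i<l. X n i \<omega>)) = cpgf \<zeta> ^ l"
proof -
  have "expectation (\<lambda>\<omega>. \<Prod>i<l. \<zeta> ^ X n i \<omega>) = (\<Prod>i<l. expectation (\<lambda>\<omega>. \<zeta> ^ X n i \<omega>))"
  proof (rule indep_vars_lebesgue_integral)
    show "indep_vars (\<lambda>_. borel) (\<lambda>i \<omega>. \<zeta> ^ X n i \<omega>) {..<l}"
      by (rule indep_vars_compose2[OF indep_row]) auto
    show "integrable M (\<lambda>\<omega>. \<zeta> ^ X n i \<omega>)" for i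
      using assms by (intro integrable_const_bound[where B = 1]) (auto simp: norm_power power_le_one)
  qed simp
  then show ?thesis by (simp add: power_sum expectation_X cpgf_def)
qed

text \<open>The bound by 1 spares all integrability side conditions below.\<close>

definition adapted :: "nat \<Rightarrow> ('w \<Rightarrow> complex) \<Rightarrow> bool" where
  "adapted k h \<longleftrightarrow> (\<exists>g\<in>borel_measurable (PiM (past k) cs). (\<forall>x. cmod (g x) \<le> 1) \<and> h = (\<lambda>\<omega>. g (proj (past k) \<omega>)))"

lemma adapted_measurable: "adapted k h \<Longrightarrow> h \<in> borel_measurable M"
  unfolding adapted_def by auto

lemma adapted_bound: "adapted k h \<Longrightarrow> cmod (h \<omega>) \<le> 1"
  unfolding adapted_def by auto

lemma adapted_mono: assumes "adapted k h" "k \<le> n" shows "adapted n h"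
proof -
  have sub: "past k \<subseteq> past n" using assms by (auto simp: past_def)
  obtain g where g: "g \<in> borel_measurable (PiM (past k) cs)" "\<And>x. cmod (g x) \<le> 1" "h = (\<lambda>\<omega>. g (proj (past k) \<omega>))"
    using assms unfolding adapted_def by auto
  have "restrict (proj (past n) \<omega>) (past k) = proj (past k) \<omega>" for \<omega>
    using sub by (auto simp: proj_def restrict_def fun_eq_iff)
  then have "h = (\<lambda>\<omega>. (\<lambda>x. g (restrict x (past k))) (proj (past n) \<omega>))" using g(3) by simp
  moreover have "(\<lambda>x. g (restrict x (past k))) \<in> borel_measurable (PiM (past n) cs)"
    by (rule measurable_compose[OF measurable_restrict_subset[OF sub] g(1)])
  ultimately show ?thesis unfolding adapted_def
    using g(2) by (intro bexI[of _ "\<lambda>x. g (restrict x (past k))"]) auto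
qed

lemma adapted_event: assumes "k \<le> n" shows "adapted n (\<lambda>\<omega>. of_bool (Q (Z k \<omega>)))"
proof -
  have "adapted k (\<lambda>\<omega>. of_bool (Q (Z k \<omega>)))"
    unfolding adapted_def
  proof (intro bexI conjI)
    have [measurable]: "zf k \<in> PiM (past k) cs \<rightarrow>\<^sub>M count_space UNIV" by (rule zf_measurable) (simp add: past_def)
    show "(\<lambda>x. of_bool (Q (zf k x))) \<in> borel_measurable (PiM (past k) cs)"
      by (rule measurable_compose[of "zf k" _ "count_space UNIV"]) auto
  qed (auto simp: Z_eq_zf[of k "past k"])
  then show ?thesis by (rule adapted_mono) (rule assms)
qed

lemma adapted_1: "adapted k (\<lambda>\<omega>. 1)"
  unfolding adapted_def by (intro bexI[of _ "\<lambda>_. 1"]) auto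

text \<open>With the past frozen, the next generation is a sum of \<open>Z n\<close> independent
  counts, which turns \<zeta> into \<open>cpgf \<zeta>\<close>; the weight h depends on the past
  only and passes through.\<close>

lemma one_step:
  assumes h: "adapted n h" and \<zeta>: "cmod \<zeta> \<le> 1"
  shows "expectation (\<lambda>\<omega>. h \<omega> * \<zeta> ^ Z (Suc n) \<omega>) = expectation (\<lambda>\<omega>. h \<omega> * cpgf \<zeta> ^ Z n \<omega>)"
proof -
  obtain g where g[measurable]: "g \<in> borel_measurable (PiM (past n) cs)" and g2: "\<And>x. cmod (g x) \<le> 1" "h = (\<lambda>\<omega>. g (proj (past n) \<omega>))"
    using h unfolding adapted_def by auto
  have [measurable]: "zf n \<in> PiM (past n) cs \<rightarrow>\<^sub>M count_space UNIV" by (rule zf_measurable) (simp add: past_def)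
  define s where "s z = (\<Sum>i<zf n (fst z). snd z (n, i))" for z :: "(nat \<times> nat \<Rightarrow> nat) \<times> (nat \<times> nat \<Rightarrow> nat)"
  have [measurable]: "s \<in> PiM (past n) cs \<Otimes>\<^sub>M PiM ({n} \<times> UNIV) cs \<rightarrow>\<^sub>M count_space UNIV"
    unfolding s_def by (rule present_sum_measurable)
  have s: "s (proj (past n) \<omega>, proj ({n} \<times> UNIV) \<omega>') = (\<Sum>i<Z n \<omega>. X n i \<omega>')" for \<omega> \<omega>'
    by (simp add: s_def Z_eq_zf[of n "past n"] proj_def)
  define G where "G z = g (fst z) * \<zeta> ^ s z" for z
  have G[measurable]: "G \<in> borel_measurable (PiM (past n) cs \<Otimes>\<^sub>M PiM ({n} \<times> UNIV) cs)"
    unfolding G_def by measurable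
  have Gle: "cmod (G z) \<le> 1" for z
    unfolding G_def norm_mult norm_power using g2(1)[of "fst z"] \<zeta> by (intro mult_le_one power_le_one) auto
  have "expectation (\<lambda>\<omega>. h \<omega> * \<zeta> ^ Z (Suc n) \<omega>) = (\<integral>\<omega>. G (proj (past n) \<omega>, proj ({n} \<times> UNIV) \<omega>) \<partial>M)"
    by (simp add: G_def s g2(2))
  also have "\<dots> = (\<integral>\<omega>. (\<integral>\<omega>'. G (proj (past n) \<omega>, proj ({n} \<times> UNIV) \<omega>') \<partial>M) \<partial>M)"
    by (rule integral_past_present[OF G Gle])
  also have "\<dots> = expectation (\<lambda>\<omega>. h \<omega> * cpgf \<zeta> ^ Z n \<omega>)"
  proof (rule Bochner_Integration.integral_cong[OF refl])
    fix \<omega>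
    have "(\<integral>\<omega>'. G (proj (past n) \<omega>, proj ({n} \<times> UNIV) \<omega>') \<partial>M) = (\<integral>\<omega>'. h \<omega> * \<zeta> ^ (\<Sum>i<Z n \<omega>. X n i \<omega>') \<partial>M)"
      by (simp add: G_def s g2(2))
    also have "\<dots> = h \<omega> * cpgf \<zeta> ^ Z n \<omega>"
      by (simp add: expectation_prod_row[OF \<zeta>])
    finally show "(\<integral>\<omega>'. G (proj (past n) \<omega>, proj ({n} \<times> UNIV) \<omega>') \<partial>M) = h \<omega> * cpgf \<zeta> ^ Z n \<omega>" .
  qed
  finally show ?thesis .
qed

lemma cpgf_iterate_le_1: "cmod \<zeta> \<le> 1 \<Longrightarrow> cmod ((cpgf ^^ m) \<zeta>) \<le> 1"
  by (induction m) (auto intro: cpgf_le_1)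

text \<open>The last generation is integrated out in each step. This replaces \<zeta> by
  \<open>cpgf \<zeta>\<close>, so the induction must leave \<zeta> arbitrary.\<close>

lemma multi_step:
  assumes h: "adapted n h" and \<zeta>: "cmod \<zeta> \<le> 1"
  shows "expectation (\<lambda>\<omega>. h \<omega> * \<zeta> ^ Z (n + m) \<omega>) = expectation (\<lambda>\<omega>. h \<omega> * (cpgf ^^ m) \<zeta> ^ Z n \<omega>)"
  using \<zeta>
proof (induction m arbitrary: \<zeta>)
  case (Suc m)
  have "expectation (\<lambda>\<omega>. h \<omega> * \<zeta> ^ Z (Suc (n + m)) \<omega>) = expectation (\<lambda>\<omega>. h \<omega> * cpgf \<zeta> ^ Z (n + m) \<omega>)"
    by (rule one_step[OF adapted_mono[OF h] Suc.prems]) simp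
  also have "\<dots> = expectation (\<lambda>\<omega>. h \<omega> * (cpgf ^^ m) (cpgf \<zeta>) ^ Z n \<omega>)"
    by (rule Suc.IH[OF cpgf_le_1[OF Suc.prems]])
  finally show ?case by (simp add: funpow_swap1)
qed simp

lemma expectation_power_Z: "cmod \<zeta> \<le> 1 \<Longrightarrow> expectation (\<lambda>\<omega>. \<zeta> ^ Z m \<omega>) = (cpgf ^^ m) \<zeta>"
  using multi_step[OF adapted_1[of 0], of \<zeta> m] by (simp add: prob_space)

text \<open>Writing the iterate as an expectation over generation m gives a form in which m can tend
  to infinity on both sides.\<close>

lemma branching:
  assumes "adapted n h" "cmod \<zeta> \<le> 1"
  shows "expectation (\<lambda>\<omega>. h \<omega> * \<zeta> ^ Z (n + m) \<omega>) = expectation (\<lambda>\<omega>. h \<omega> * expectation (\<lambda>\<omega>. \<zeta> ^ Z m \<omega>) ^ Z n \<omega>)"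
  using multi_step[OF assms] expectation_power_Z[OF assms(2)] by simp

end

section \<open>Convergence of the normalised generation sizes\<close>

context galton_watson
begin

lemma nn_integral_Z_Suc:
  fixes g :: "nat \<Rightarrow> nat \<Rightarrow> ennreal"
  shows "(\<integral>\<^sup>+\<omega>. g (Z n \<omega>) (Z (Suc n) \<omega>) \<partial>M) = (\<integral>\<^sup>+\<omega>. (\<integral>\<^sup>+\<omega>'. g (Z n \<omega>) (\<Sum>i<Z n \<omega>. X n i \<omega>') \<partial>M) \<partial>M)"
proof -
  have [measurable]: "zf n \<in> PiM (past n) cs \<rightarrow>\<^sub>M count_space UNIV" by (rule zf_measurable) (simp add: past_def)
  note present_sum_measurable[of n, measurable]
  have [measurable]: "(\<lambda>x. (g (fst x) (snd x))) \<in> borel_measurable (count_space UNIV \<Otimes>\<^sub>M count_space UNIV)"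
    by (simp add: pair_measure_countable)
  have "(\<lambda>z. g (zf n (fst z)) (\<Sum>i<zf n (fst z). snd z (n, i))) \<in> borel_measurable (PiM (past n) cs \<Otimes>\<^sub>M PiM ({n} \<times> UNIV) cs)"
    using measurable_compose[of "\<lambda>z. (zf n (fst z), \<Sum>i<zf n (fst z). snd z (n, i))" "PiM (past n) cs \<Otimes>\<^sub>M PiM ({n} \<times> UNIV) cs"
      "count_space UNIV \<Otimes>\<^sub>M count_space UNIV" "\<lambda>x. (g (fst x) (snd x))" borel] by simp
  note nn_integral_past_present[OF this]
  moreover have "zf n (proj (past n) \<omega>) = Z n \<omega>" for \<omega> by (rule Z_eq_zf[symmetric]) simp
  moreover have "proj ({n} \<times> UNIV) \<omega> (n, i) = X n i \<omega>" for i \<omega> by (simp add: proj_def)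
  ultimately show ?thesis by simp
qed

lemma nn_expectation_X: "(\<integral>\<^sup>+\<omega>. g (X n i \<omega>) \<partial>M) = (\<integral>\<^sup>+k. g k \<partial>measure_pmf p)"
  unfolding distr_X[of n i, symmetric] by (subst nn_integral_distr) auto

lemma nn_integral_mean: "(\<integral>\<^sup>+k. ennreal (real k) \<partial>measure_pmf p) = ennreal a"
  unfolding a_def off_mean_def using integrable_mean by (subst nn_integral_eq_integral) auto

lemma nn_expectation_Z: "(\<integral>\<^sup>+\<omega>. ennreal (real (Z n \<omega>)) \<partial>M) = ennreal (a ^ n)"
proof (induction n)
  case 0
  then show ?case by (simp add: emeasure_space_1)
next
  case (Suc n)
  have "(\<integral>\<^sup>+\<omega>. ennreal (real (Z (Suc n) \<omega>)) \<partial>M) = (\<integral>\<^sup>+\<omega>. (\<integral>\<^sup>+\<omega>'. ennreal (real (\<Sum>i<Z n \<omega>. X n i \<omega>')) \<partial>M) \<partial>M)"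
    by (rule nn_integral_Z_Suc[of "\<lambda>_ k. ennreal (real k)"])
  also have "(\<lambda>\<omega>. (\<integral>\<^sup>+\<omega>'. ennreal (real (\<Sum>i<Z n \<omega>. X n i \<omega>')) \<partial>M)) = (\<lambda>\<omega>. ennreal (real (Z n \<omega>)) * ennreal a)"
  proof
    fix \<omega>
    have "(\<integral>\<^sup>+\<omega>'. ennreal (real (\<Sum>i<Z n \<omega>. X n i \<omega>')) \<partial>M) = (\<integral>\<^sup>+\<omega>'. (\<Sum>i<Z n \<omega>. ennreal (real (X n i \<omega>'))) \<partial>M)"
      by (simp add: sum_ennreal)
    also have "\<dots> = (\<Sum>i<Z n \<omega>. (\<integral>\<^sup>+\<omega>'. ennreal (real (X n i \<omega>')) \<partial>M))" by (rule nn_integral_sum) auto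
    also have "\<dots> = (\<Sum>i<Z n \<omega>. ennreal a)"
      by (simp only: nn_expectation_X[of "\<lambda>k. ennreal (real k)"] nn_integral_mean)
    also have "\<dots> = ennreal (real (Z n \<omega>)) * ennreal a" by (simp add: ennreal_of_nat_eq_real_of_nat)
    finally show "(\<integral>\<^sup>+\<omega>'. ennreal (real (\<Sum>i<Z n \<omega>. X n i \<omega>')) \<partial>M) = ennreal (real (Z n \<omega>)) * ennreal a" .
  qed
  also have "(\<integral>\<^sup>+\<omega>. ennreal (real (Z n \<omega>)) * ennreal a \<partial>M) = ennreal (a ^ n) * ennreal a"
    by (subst nn_integral_multc) (auto simp: Suc)
  also have "\<dots> = ennreal (a ^ Suc n)" using a_gt_1 by (simp add: ennreal_mult[symmetric] mult.commute)
  finally show ?case .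
qed

lemma integrable_Z: "integrable M (\<lambda>\<omega>. real (Z n \<omega>))" and expectation_Z: "expectation (\<lambda>\<omega>. real (Z n \<omega>)) = a ^ n"
proof -
  show i: "integrable M (\<lambda>\<omega>. real (Z n \<omega>))"
    by (rule integrableI_nonneg) (auto simp: nn_expectation_Z)
  have "ennreal (expectation (\<lambda>\<omega>. real (Z n \<omega>))) = ennreal (a ^ n)"
    using nn_integral_eq_integral[OF i] nn_expectation_Z[of n] by simp
  then show "expectation (\<lambda>\<omega>. real (Z n \<omega>)) = a ^ n" using a_gt_1 by (simp add: integral_nonneg_AE)
qed

lemma variance_row_sum:
  fixes g :: "nat \<Rightarrow> real"
  assumes bnd: "\<And>k. \<bar>g k\<bar> \<le> B" and mean: "measure_pmf.expectation p g = 0"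
  shows "expectation (\<lambda>\<omega>. (\<Sum>i<l. g (X n i \<omega>))\<^sup>2) = l * measure_pmf.expectation p (\<lambda>k. (g k)\<^sup>2)"
proof (induction l)
  case (Suc l)
  have B: "B \<ge> 0" using bnd[of 0] by linarith
  have ind: "indep_var borel (\<lambda>\<omega>. g (X n l \<omega>)) borel (\<lambda>\<omega>. \<Sum>i\<in>{..<l}. g (X n i \<omega>))"
    by (rule indep_vars_sum) (auto intro!: indep_vars_compose2[OF indep_row])
  have ig: "integrable M (\<lambda>\<omega>. g (X n i \<omega>))" for i
    by (rule integrable_const_bound[where B = B]) (auto simp: bnd)
  have ig2: "integrable M (\<lambda>\<omega>. (g (X n i \<omega>))\<^sup>2)" for i
  proof (rule integrable_const_bound[where B = "B\<^sup>2"])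
    show "AE \<omega> in M. norm ((g (X n i \<omega>))\<^sup>2) \<le> B\<^sup>2"
      using power_mono[OF bnd abs_ge_zero, of _ 2] by simp
  qed measurable
  have iS: "integrable M (\<lambda>\<omega>. \<Sum>i<l. g (X n i \<omega>))" using ig by simp
  have iS2: "integrable M (\<lambda>\<omega>. (\<Sum>i<l. g (X n i \<omega>))\<^sup>2)"
  proof (rule integrable_const_bound[where B = "(l * B)\<^sup>2"])
    have "\<bar>\<Sum>i<l. g (X n i \<omega>)\<bar> \<le> l * B" for \<omega>
      by (rule order_trans[OF sum_abs]) (use sum_mono[of "{..<l}" "\<lambda>i. \<bar>g (X n i \<omega>)\<bar>" "\<lambda>_. B"] bnd in simp)
    then show "AE \<omega> in M. norm ((\<Sum>i<l. g (X n i \<omega>))\<^sup>2) \<le> (l * B)\<^sup>2"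
      using power_mono[OF _ abs_ge_zero, of _ "l * B" 2] by simp
  qed measurable
  have "expectation (\<lambda>\<omega>. (\<Sum>i<Suc l. g (X n i \<omega>))\<^sup>2) =
    expectation (\<lambda>\<omega>. (\<Sum>i<l. g (X n i \<omega>))\<^sup>2 + 2 * (g (X n l \<omega>) * (\<Sum>i<l. g (X n i \<omega>))) + (g (X n l \<omega>))\<^sup>2)"
    by (simp add: power2_sum ac_simps)
  also have "\<dots> = expectation (\<lambda>\<omega>. (\<Sum>i<l. g (X n i \<omega>))\<^sup>2) + 2 * expectation (\<lambda>\<omega>. g (X n l \<omega>) * (\<Sum>i<l. g (X n i \<omega>))) + expectation (\<lambda>\<omega>. (g (X n l \<omega>))\<^sup>2)"
    using indep_var_integrable[OF ind ig iS] ig2[of l] iS2 by simp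
  also have "expectation (\<lambda>\<omega>. g (X n l \<omega>) * (\<Sum>i<l. g (X n i \<omega>))) = 0"
    using indep_var_lebesgue_integral[OF ind ig iS] expectation_X[of g n l] mean by simp
  also have "expectation (\<lambda>\<omega>. (g (X n l \<omega>))\<^sup>2) = measure_pmf.expectation p (\<lambda>k. (g k)\<^sup>2)"
    by (rule expectation_X)
  finally show ?case using Suc by (simp add: algebra_simps)
qed simp

definition "tailmean c = measure_pmf.expectation p (\<lambda>k. real k * of_bool (real k > c))"

lemma tailmean_integrable: "integrable (measure_pmf p) (\<lambda>k. real k * of_bool (real k > c))"
  by (rule Bochner_Integration.integrable_bound[OF integrable_mean]) auto

lemma tailmean_nonneg: "tailmean c \<ge> 0"
  unfolding tailmean_def by (rule integral_nonneg_AE) auto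

text \<open>Truncation at \<open>c\<close>: the small offspring counts are controlled in mean square, the large
  ones in the mean. With \<open>c = a powr (n/2)\<close> in generation \<open>n\<close> the first contribution decays
  geometrically, and the second one is summable because \<open>E(N log N)\<close> is finite. Hence the
  increments of \<open>Z\<^sub>n / a\<^sup>n\<close> are summable in \<open>L\<^sup>1\<close>, and no martingale convergence theorem is
  needed.\<close>

lemma row_deviation:
  assumes c: "c > 0" and \<theta>: "\<theta> > 0"
  shows "(\<integral>\<^sup>+\<omega>. ennreal \<bar>real (\<Sum>i<l. X n i \<omega>) - a * l\<bar> \<partial>M) \<le> ennreal ((\<theta> + l * (c * a) / \<theta>) / 2 + 2 * real l * tailmean c)"
proof -
  define y where "y k = real k * of_bool (real k \<le> c)" for k
  define r where "r k = real k * of_bool (real k > c)" for k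
  define m where "m = measure_pmf.expectation p y"
  have iy: "integrable (measure_pmf p) y"
    by (rule Bochner_Integration.integrable_bound[OF integrable_mean]) (auto simp: y_def)
  have ir: "integrable (measure_pmf p) r" using tailmean_integrable unfolding r_def .
  have yr: "real k = y k + r k" for k by (auto simp: y_def r_def)
  have am: "a = m + tailmean c"
    unfolding a_def off_mean_def m_def tailmean_def r_def[symmetric] using iy ir by (subst Bochner_Integration.integral_add[symmetric]) (auto simp: yr[symmetric])
  have y0: "0 \<le> y k" "y k \<le> c" for k using c by (auto simp: y_def)
  have m0: "0 \<le> m" "m \<le> c"
    unfolding m_def using y0 measure_pmf.integral_le_const[OF iy, of c] by (auto intro: integral_nonneg_AE)
  define g where "g k = y k - m" for k
  have gb: "\<bar>g k\<bar> \<le> c" for k using y0[of k] m0 by (simp add: g_def abs_le_iff)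
  have gm: "measure_pmf.expectation p g = 0" unfolding g_def using iy by (simp add: m_def)
  have iy2: "integrable (measure_pmf p) (\<lambda>k. (y k)\<^sup>2)"
  proof (rule measure_pmf.integrable_const_bound[where B = "c\<^sup>2"])
    show "AE k in measure_pmf p. norm ((y k)\<^sup>2) \<le> c\<^sup>2"
      using power_mono[OF y0(2) y0(1), of _ 2] by (intro AE_I2) simp
  qed simp
  have g2: "measure_pmf.expectation p (\<lambda>k. (g k)\<^sup>2) \<le> c * a"
  proof -
    have "measure_pmf.expectation p (\<lambda>k. (g k)\<^sup>2) = measure_pmf.expectation p (\<lambda>k. (y k)\<^sup>2) - m\<^sup>2"
      unfolding g_def using measure_pmf.variance_eq[OF iy iy2] by (simp add: m_def)
    also have "\<dots> \<le> measure_pmf.expectation p (\<lambda>k. (y k)\<^sup>2)" by simp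
    also have "\<dots> \<le> measure_pmf.expectation p (\<lambda>k. c * real k)"
    proof (rule integral_mono[OF iy2])
      fix k show "(y k)\<^sup>2 \<le> c * real k" using c by (auto simp: y_def power2_eq_square intro!: mult_right_mono)
    qed (use integrable_mean in simp)
    also have "\<dots> = c * a" by (simp add: a_def off_mean_def)
    finally show ?thesis .
  qed
  define S where "S \<omega> = (\<Sum>i<l. g (X n i \<omega>))" for \<omega>
  define R where "R \<omega> = (\<Sum>i<l. r (X n i \<omega>))" for \<omega>
  have [measurable]: "S \<in> borel_measurable M" unfolding S_def by measurable
  have iS2: "integrable M (\<lambda>\<omega>. (S \<omega>)\<^sup>2)"
  proof (rule integrable_const_bound[where B = "(l * c)\<^sup>2"])
    have "\<bar>S \<omega>\<bar> \<le> l * c" for \<omega> unfolding S_def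
      by (rule order_trans[OF sum_abs]) (use sum_mono[of "{..<l}" "\<lambda>i. \<bar>g (X n i \<omega>)\<bar>" "\<lambda>_. c"] gb in simp)
    then show "AE \<omega> in M. norm ((S \<omega>)\<^sup>2) \<le> (l * c)\<^sup>2"
      using power_mono[OF _ abs_ge_zero, of _ "l * c" 2] by simp
  qed measurable
  have iR: "integrable M R" unfolding R_def using integrable_X[of r] ir by simp
  have ER: "expectation R = l * tailmean c"
  proof -
    have "expectation (\<lambda>\<omega>. r (X n i \<omega>)) = tailmean c" for i
      unfolding expectation_X[of r] tailmean_def r_def[symmetric] ..
    then show ?thesis unfolding R_def using integrable_X[of r] ir by simp
  qed
  have R0: "R \<omega> \<ge> 0" for \<omega> unfolding R_def r_def by (intro sum_nonneg) auto
  have pt: "\<bar>real (\<Sum>i<l. X n i \<omega>) - a * l\<bar> \<le> (\<theta> + (S \<omega>)\<^sup>2 / \<theta>) / 2 + (R \<omega> + l * tailmean c)" for \<omega>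
  proof -
    have "real (\<Sum>i<l. X n i \<omega>) - a * l = S \<omega> + (R \<omega> - l * tailmean c)"
    proof -
      have "real (\<Sum>i<l. X n i \<omega>) = (\<Sum>i<l. y (X n i \<omega>)) + R \<omega>"
        unfolding R_def of_nat_sum sum.distrib[symmetric] by (rule sum.cong[OF refl yr])
      then show ?thesis unfolding S_def g_def am by (simp add: sum_subtractf algebra_simps)
    qed
    \<comment> \<open>This takes the place of the Cauchy-Schwarz inequality: with the free parameter
      \<theta> the bound stays affine in l, so that it can be averaged over the random number
      \<open>Z n\<close> of individuals through the mean of \<open>Z n\<close> alone.\<close>
    moreover have "\<bar>S \<omega>\<bar> \<le> (\<theta> + (S \<omega>)\<^sup>2 / \<theta>) / 2"
    proof -
      have "0 \<le> (\<theta> - \<bar>S \<omega>\<bar>)\<^sup>2" by simp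
      then have "2 * \<theta> * \<bar>S \<omega>\<bar> \<le> \<theta>\<^sup>2 + (S \<omega>)\<^sup>2" by (simp add: power2_diff)
      then show ?thesis using \<theta> by (simp add: field_simps power2_eq_square)
    qed
    moreover have "0 \<le> l * tailmean c" using tailmean_nonneg by simp
    ultimately show ?thesis using R0[of \<omega>] by linarith
  qed
  have "(\<integral>\<^sup>+\<omega>. ennreal \<bar>real (\<Sum>i<l. X n i \<omega>) - a * l\<bar> \<partial>M) \<le> (\<integral>\<^sup>+\<omega>. ennreal ((\<theta> + (S \<omega>)\<^sup>2 / \<theta>) / 2 + (R \<omega> + l * tailmean c)) \<partial>M)"
    using pt by (intro nn_integral_mono ennreal_leI) auto
  also have "\<dots> = ennreal (expectation (\<lambda>\<omega>. (\<theta> + (S \<omega>)\<^sup>2 / \<theta>) / 2 + (R \<omega> + l * tailmean c)))"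
    using iS2 iR R0 \<theta> tailmean_nonneg by (intro nn_integral_eq_integral) auto
  also have "expectation (\<lambda>\<omega>. (\<theta> + (S \<omega>)\<^sup>2 / \<theta>) / 2 + (R \<omega> + l * tailmean c)) = (\<theta> + expectation (\<lambda>\<omega>. (S \<omega>)\<^sup>2) / \<theta>) / 2 + 2 * real l * tailmean c"
    using iS2 iR by (simp add: ER prob_space)
  also have "ennreal \<dots> \<le> ennreal ((\<theta> + l * (c * a) / \<theta>) / 2 + 2 * real l * tailmean c)"
    unfolding S_def variance_row_sum[OF gb gm] using g2 \<theta>
    by (intro ennreal_leI add_right_mono divide_right_mono add_left_mono mult_left_mono) auto
  finally show ?thesis .
qed

lemma generation_deviation:
  assumes c: "c > 0" and \<theta>: "\<theta> > 0"
  shows "(\<integral>\<^sup>+\<omega>. ennreal \<bar>real (Z (Suc n) \<omega>) - a * Z n \<omega>\<bar> \<partial>M) \<le> ennreal (\<theta> / 2 + (c * a / \<theta> / 2 + 2 * tailmean c) * a ^ n)"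
proof -
  have "(\<integral>\<^sup>+\<omega>. ennreal \<bar>real (Z (Suc n) \<omega>) - a * Z n \<omega>\<bar> \<partial>M)
     = (\<integral>\<^sup>+\<omega>. (\<integral>\<^sup>+\<omega>'. ennreal \<bar>real (\<Sum>i<Z n \<omega>. X n i \<omega>') - a * Z n \<omega>\<bar> \<partial>M) \<partial>M)"
    by (rule nn_integral_Z_Suc[of "\<lambda>l k. ennreal \<bar>real k - a * l\<bar>"])
  also have "\<dots> \<le> (\<integral>\<^sup>+\<omega>. ennreal ((\<theta> + Z n \<omega> * (c * a) / \<theta>) / 2 + 2 * real (Z n \<omega>) * tailmean c) \<partial>M)"
    by (intro nn_integral_mono row_deviation[OF c \<theta>])
  also have "\<dots> = ennreal (expectation (\<lambda>\<omega>. \<theta> / 2 + (c * a / \<theta> / 2 + 2 * tailmean c) * real (Z n \<omega>)))"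
    using integrable_Z[of n] tailmean_nonneg[of c] \<theta> c a_gt_1
    by (subst nn_integral_eq_integral[symmetric]) (auto simp: algebra_simps add_divide_distrib intro!: nn_integral_cong)
  also have "expectation (\<lambda>\<omega>. \<theta> / 2 + (c * a / \<theta> / 2 + 2 * tailmean c) * real (Z n \<omega>)) = \<theta> / 2 + (c * a / \<theta> / 2 + 2 * tailmean c) * a ^ n"
    using integrable_Z[of n] by (simp add: expectation_Z prob_space)
  finally show ?thesis .
qed

section \<open>Summability of the increments and almost sure convergence\<close>

definition "Wn n \<omega> = real (Z n \<omega>) / a ^ n"

lemma Wn_measurable [measurable]: "Wn n \<in> borel_measurable M"
  unfolding Wn_def[abs_def] by measurable

text \<open>A fourth root, because truncation at c = a^(n/2) is combined with \<theta> = a^(3n/4):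
  then \<theta> / a^n and c / \<theta> both equal a^(-n/4), and all exponents are natural powers of
  \<open>rr\<close>.\<close>

definition "rr = a powr (1/4)"

lemma rr: "rr > 1" "rr ^ 4 = a"
proof -
  show "rr > 1" unfolding rr_def using a_gt_1 by (simp add: gr_one_powr)
  show "rr ^ 4 = a" unfolding rr_def using a_gt_1 by (simp add: powr_power)
qed

definition "incr n = ((1 + a) / 2 * (1 / rr) ^ n + 2 * tailmean (rr ^ (2 * n))) / a"

lemma Wn_increment: "(\<integral>\<^sup>+\<omega>. ennreal \<bar>Wn (Suc n) \<omega> - Wn n \<omega>\<bar> \<partial>M) \<le> ennreal (incr n)"
proof -
  have r0: "rr > 0" using rr by simp
  have eq: "\<bar>Wn (Suc n) \<omega> - Wn n \<omega>\<bar> = 1 / a ^ Suc n * \<bar>real (Z (Suc n) \<omega>) - a * Z n \<omega>\<bar>" for \<omega>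
  proof -
    have "Wn (Suc n) \<omega> - Wn n \<omega> = (real (Z (Suc n) \<omega>) - a * Z n \<omega>) / a ^ Suc n"
      using a_gt_1 by (simp add: Wn_def field_simps)
    then show ?thesis using a_gt_1 by (simp add: abs_divide)
  qed
  have "(\<integral>\<^sup>+\<omega>. ennreal \<bar>Wn (Suc n) \<omega> - Wn n \<omega>\<bar> \<partial>M) = ennreal (1 / a ^ Suc n) * (\<integral>\<^sup>+\<omega>. ennreal \<bar>real (Z (Suc n) \<omega>) - a * Z n \<omega>\<bar> \<partial>M)"
    unfolding eq using a_gt_1 by (subst nn_integral_cmult[symmetric]) (auto simp: ennreal_mult[symmetric] simp del: gw_size.simps)
  also have "\<dots> \<le> ennreal (1 / a ^ Suc n) * ennreal (rr ^ (3 * n) / 2 + (rr ^ (2 * n) * a / rr ^ (3 * n) / 2 + 2 * tailmean (rr ^ (2 * n))) * a ^ n)"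
    using r0 by (intro mult_left_mono generation_deviation) auto
  also have "\<dots> = ennreal (1 / a ^ Suc n * (rr ^ (3 * n) / 2 + (rr ^ (2 * n) * a / rr ^ (3 * n) / 2 + 2 * tailmean (rr ^ (2 * n))) * a ^ n))"
    using a_gt_1 r0 tailmean_nonneg by (intro ennreal_mult[symmetric]) (auto intro!: add_nonneg_nonneg)
  also have "1 / a ^ Suc n * (rr ^ (3 * n) / 2 + (rr ^ (2 * n) * a / rr ^ (3 * n) / 2 + 2 * tailmean (rr ^ (2 * n))) * a ^ n) = incr n"
  proof -
    define x where "x = rr ^ n"
    have x: "x > 0" using r0 by (simp add: x_def)
    have "rr ^ (3 * n) = x ^ 3" "rr ^ (2 * n) = x\<^sup>2" by (simp_all add: x_def power_mult[symmetric] mult.commute)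
    moreover have an: "a ^ n = x ^ 4" by (simp add: x_def rr(2)[symmetric] power_mult[symmetric] mult.commute)
    moreover have "(1 / rr) ^ n = 1 / x" by (simp add: x_def power_divide)
    ultimately show ?thesis unfolding incr_def power_Suc an using x a_gt_1
      by (simp add: field_simps power2_eq_square power3_eq_cube power4_eq_xxxx)
  qed
  finally show ?thesis .
qed

lemma incr_nonneg: "incr n \<ge> 0"
  unfolding incr_def using a_gt_1 rr tailmean_nonneg by (intro divide_nonneg_nonneg add_nonneg_nonneg) auto

text \<open>Sum and expectation are interchanged. For fixed k \<ge> 1 the number of n with rr^(2n) <
  k is at most 1 + ln k / (2 ln rr), so the sum of the tail means is bounded through the mean of N
  log N.\<close>

lemma summable_incr: "summable incr"
proof -
  define B where "B = measure_pmf.expectation p (\<lambda>k. real k + 1 / (2 * ln rr) * (real k * ln (real k)))"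
  have lr: "ln rr > 0" using rr by simp
  have "summable (\<lambda>n. tailmean (rr ^ (2 * n)))"
  proof (rule summableI_nonneg_bounded[where x = B])
    fix m
    have "(\<Sum>n<m. tailmean (rr ^ (2 * n))) = measure_pmf.expectation p (\<lambda>k. \<Sum>n<m. real k * of_bool (real k > rr ^ (2 * n)))"
      unfolding tailmean_def using tailmean_integrable by (intro Bochner_Integration.integral_sum[symmetric]) auto
    also have "\<dots> \<le> B" unfolding B_def
    proof (rule integral_mono)
      show "integrable (measure_pmf p) (\<lambda>k. \<Sum>n<m. real k * of_bool (real k > rr ^ (2 * n)))"
        by (intro Bochner_Integration.integrable_sum tailmean_integrable)
      show "integrable (measure_pmf p) (\<lambda>k. real k + 1 / (2 * ln rr) * (real k * ln (real k)))"
        using integrable_mean integrable_n_log_n by (intro Bochner_Integration.integrable_add integrable_mult_right) auto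
      fix k :: nat
      show "(\<Sum>n<m. real k * of_bool (real k > rr ^ (2 * n))) \<le> real k + 1 / (2 * ln rr) * (real k * ln (real k))"
      proof (cases "k = 0")
        case False
        define t where "t = ln (real k) / (2 * ln rr)"
        have t: "t \<ge> 0" using False lr by (simp add: t_def)
        have "{n \<in> {..<m}. real k > rr ^ (2 * n)} \<subseteq> {..nat \<lfloor>t\<rfloor>}"
        proof
          fix n assume "n \<in> {n \<in> {..<m}. real k > rr ^ (2 * n)}"
          then have "rr ^ (2 * n) < real k" by simp
          then have "ln (rr ^ (2 * n)) < ln (real k)" using rr False by (subst ln_less_cancel_iff) auto
          then have "n \<le> t" using lr rr by (simp add: ln_realpow t_def field_simps)
          then show "n \<in> {..nat \<lfloor>t\<rfloor>}" by (simp add: le_nat_floor)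
        qed
        then have "card {n \<in> {..<m}. real k > rr ^ (2 * n)} \<le> Suc (nat \<lfloor>t\<rfloor>)"
          using card_mono[of "{..nat \<lfloor>t\<rfloor>}"] by fastforce
        then have "real (card {n \<in> {..<m}. real k > rr ^ (2 * n)}) \<le> 1 + t" using t by linarith
        moreover have "(\<Sum>n<m. real k * of_bool (real k > rr ^ (2 * n))) = real k * card {n \<in> {..<m}. real k > rr ^ (2 * n)}"
          by (simp add: sum_distrib_left[symmetric] Int_def)
        ultimately have "(\<Sum>n<m. real k * of_bool (real k > rr ^ (2 * n))) \<le> real k * (1 + t)"
          by (simp only:) (intro mult_left_mono, auto)
        then show ?thesis by (simp add: t_def algebra_simps)
      qed simp
    qed
    finally show "(\<Sum>n<m. tailmean (rr ^ (2 * n))) \<le> B" .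
  qed (rule tailmean_nonneg)
  moreover have "summable (\<lambda>n. (1 / rr) ^ n)" using rr by (intro summable_geometric) auto
  ultimately show ?thesis unfolding incr_def[abs_def]
    by (intro summable_divide summable_add summable_mult)
qed

lemma AE_summable_increments: "AE \<omega> in M. summable (\<lambda>n. \<bar>Wn (Suc n) \<omega> - Wn n \<omega>\<bar>)"
proof -
  have "(\<integral>\<^sup>+\<omega>. (\<Sum>n. ennreal \<bar>Wn (Suc n) \<omega> - Wn n \<omega>\<bar>) \<partial>M) = (\<Sum>n. (\<integral>\<^sup>+\<omega>. ennreal \<bar>Wn (Suc n) \<omega> - Wn n \<omega>\<bar> \<partial>M))"
    by (rule nn_integral_suminf) measurable
  also have "\<dots> \<le> (\<Sum>n. ennreal (incr n))" by (intro suminf_le Wn_increment) auto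
  also have "\<dots> < \<infinity>" using suminf_ennreal2[OF incr_nonneg summable_incr] by simp
  finally have "AE \<omega> in M. (\<Sum>n. ennreal \<bar>Wn (Suc n) \<omega> - Wn n \<omega>\<bar>) \<noteq> \<infinity>"
    by (intro nn_integral_PInf_AE) auto
  then show ?thesis
    by eventually_elim (rule summable_suminf_not_top, auto)
qed

lemma Wn_telescope: "Wn (n + m) \<omega> - Wn n \<omega> = (\<Sum>i<m. Wn (Suc (n + i)) \<omega> - Wn (n + i) \<omega>)"
  by (induction m) auto

lemma AE_Wn_tendsto: "AE \<omega> in M. (\<lambda>n. Wn n \<omega>) \<longlonglongrightarrow> W \<omega>"
  using AE_summable_increments
proof eventually_elim
  case (elim \<omega>)
  then have "summable (\<lambda>n. Wn (Suc n) \<omega> - Wn n \<omega>)" by (rule summable_rabs_cancel)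
  then have "(\<lambda>m. \<Sum>i<m. Wn (Suc i) \<omega> - Wn i \<omega>) \<longlonglongrightarrow> (\<Sum>i. Wn (Suc i) \<omega> - Wn i \<omega>)" by (rule summable_LIMSEQ)
  then have "(\<lambda>m. (\<Sum>i<m. Wn (Suc i) \<omega> - Wn i \<omega>) + Wn 0 \<omega>) \<longlonglongrightarrow> (\<Sum>i. Wn (Suc i) \<omega> - Wn i \<omega>) + Wn 0 \<omega>"
    by (intro tendsto_intros)
  moreover have "(\<Sum>i<m. Wn (Suc i) \<omega> - Wn i \<omega>) + Wn 0 \<omega> = Wn m \<omega>" for m
    using Wn_telescope[of 0 m \<omega>] by simp
  ultimately have "convergent (\<lambda>n. Wn n \<omega>)" unfolding convergent_def by auto
  then show ?case unfolding gw_limit_def Wn_def a_def convergent_LIMSEQ_iff .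
qed

lemma W_measurable [measurable]: "W \<in> borel_measurable M"
  unfolding gw_limit_def[abs_def] by measurable

lemma AE_W_nonneg: "AE \<omega> in M. 0 \<le> W \<omega>"
  using AE_Wn_tendsto
  by eventually_elim (rule LIMSEQ_le_const, auto simp: Wn_def intro!: divide_nonneg_nonneg zero_le_power less_imp_le[OF a_gt_1(2)])

text \<open>All \<open>Wn n\<close> have mean 1. If W vanished almost surely, \<open>Wn n\<close>
  would be at most the sum of the absolute increments from n on, whose mean is below 1 for large
  n.\<close>

lemma W_not_AE_0: "\<not> (AE \<omega> in M. W \<omega> = 0)"
proof
  assume "AE \<omega> in M. W \<omega> = 0"
  with AE_Wn_tendsto have lim0: "AE \<omega> in M. (\<lambda>n. Wn n \<omega>) \<longlonglongrightarrow> 0" by eventually_elim simp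
  have EW: "(\<integral>\<^sup>+\<omega>. ennreal (Wn n \<omega>) \<partial>M) = 1" for n
  proof -
    have "(\<integral>\<^sup>+\<omega>. ennreal (Wn n \<omega>) \<partial>M) = (\<integral>\<^sup>+\<omega>. ennreal (1 / a ^ n) * ennreal (real (Z n \<omega>)) \<partial>M)"
      using a_gt_1 by (intro nn_integral_cong) (simp add: Wn_def ennreal_mult[symmetric])
    also have "\<dots> = ennreal (1 / a ^ n) * ennreal (a ^ n)" by (subst nn_integral_cmult) (auto simp: nn_expectation_Z)
    also have "\<dots> = 1" using a_gt_1 by (simp add: ennreal_mult[symmetric])
    finally show ?thesis .
  qed
  obtain n where n: "(\<Sum>i. incr (i + n)) < 1"
  proof -
    have "(\<lambda>n. \<Sum>i. incr (i + n)) \<longlonglongrightarrow> 0" by (rule suminf_exist_split2[OF summable_incr])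
    then have "\<forall>\<^sub>F n in sequentially. (\<Sum>i. incr (i + n)) < 1" by (auto elim: order_tendstoD)
    then show ?thesis using that by (auto simp: eventually_sequentially)
  qed
  have "(\<integral>\<^sup>+\<omega>. ennreal (Wn n \<omega>) \<partial>M) \<le> (\<integral>\<^sup>+\<omega>. (\<Sum>i. ennreal \<bar>Wn (Suc (i + n)) \<omega> - Wn (i + n) \<omega>\<bar>) \<partial>M)"
  proof (rule nn_integral_mono_AE)
    show "AE \<omega> in M. ennreal (Wn n \<omega>) \<le> (\<Sum>i. ennreal \<bar>Wn (Suc (i + n)) \<omega> - Wn (i + n) \<omega>\<bar>)"
      using lim0 AE_summable_increments
    proof eventually_elim
      case (elim \<omega>)
      have s: "summable (\<lambda>i. \<bar>Wn (Suc (i + n)) \<omega> - Wn (i + n) \<omega>\<bar>)"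
        using summable_ignore_initial_segment[OF elim(2), of n] by simp
      have "\<bar>Wn (n + m) \<omega> - Wn n \<omega>\<bar> \<le> (\<Sum>i. \<bar>Wn (Suc (i + n)) \<omega> - Wn (i + n) \<omega>\<bar>)" for m
      proof -
        have "\<bar>Wn (n + m) \<omega> - Wn n \<omega>\<bar> \<le> (\<Sum>i<m. \<bar>Wn (Suc (n + i)) \<omega> - Wn (n + i) \<omega>\<bar>)"
          unfolding Wn_telescope by (rule sum_abs)
        also have "\<dots> \<le> (\<Sum>i. \<bar>Wn (Suc (i + n)) \<omega> - Wn (i + n) \<omega>\<bar>)"
          using sum_le_suminf[OF s, of "{..<m}"] by (simp add: add.commute)
        finally show ?thesis .
      qed
      moreover have "(\<lambda>m. \<bar>Wn (n + m) \<omega> - Wn n \<omega>\<bar>) \<longlonglongrightarrow> \<bar>0 - Wn n \<omega>\<bar>"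
        using LIMSEQ_ignore_initial_segment[OF elim(1), of n] by (intro tendsto_intros) (simp add: add.commute)
      ultimately have "\<bar>0 - Wn n \<omega>\<bar> \<le> (\<Sum>i. \<bar>Wn (Suc (i + n)) \<omega> - Wn (i + n) \<omega>\<bar>)"
        by (intro LIMSEQ_le_const2) auto
      then have "ennreal (Wn n \<omega>) \<le> ennreal (\<Sum>i. \<bar>Wn (Suc (i + n)) \<omega> - Wn (i + n) \<omega>\<bar>)" by (intro ennreal_leI) simp
      also have "\<dots> = (\<Sum>i. ennreal \<bar>Wn (Suc (i + n)) \<omega> - Wn (i + n) \<omega>\<bar>)"
        using s by (intro suminf_ennreal2[symmetric]) auto
      finally show ?case .
    qed
  qed
  also have "\<dots> = (\<Sum>i. (\<integral>\<^sup>+\<omega>. ennreal \<bar>Wn (Suc (i + n)) \<omega> - Wn (i + n) \<omega>\<bar> \<partial>M))"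
    by (rule nn_integral_suminf) measurable
  also have "\<dots> \<le> (\<Sum>i. ennreal (incr (i + n)))" by (intro suminf_le Wn_increment) auto
  also have "\<dots> = ennreal (\<Sum>i. incr (i + n))"
    by (intro suminf_ennreal2 incr_nonneg summable_ignore_initial_segment summable_incr)
  also have "\<dots> < 1" using n by (metis ennreal_1 ennreal_less_iff incr_nonneg suminf_nonneg summable_ignore_initial_segment summable_incr)
  finally show False using EW[of n] by simp
qed

end

section \<open>The Laplace exponent of the limit\<close>

lemma complex_of_real_of_bool: "complex_of_real (of_bool P) = of_bool P"
  by (cases P) auto

context galton_watson
begin

sublocale Wrv: nonneg_rv M W
  by unfold_locales (auto intro: AE_W_nonneg)

sublocale Zrv: nonneg_rv M "\<lambda>\<omega>. real (Z n \<omega>)" for n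
  by unfold_locales auto

section \<open>The Laplace transform of W and its functional equation\<close>

definition "cphi w = expectation (\<lambda>\<omega>. exp (- (w * complex_of_real (W \<omega>))))"

text \<open>The identity expresses that beyond generation k the variable a^k W is a sum of
  \<open>Z k\<close> independent copies of W, but no copies are constructed: with s = exp (- w /
  a^m) the power of s by Z (k+m) is exp (- w a^k Wn (k+m)), and both sides of
  \<open>branching\<close> converge by dominated convergence. Complex w covers Laplace transforms
  and characteristic functions together.\<close>

lemma laplace_branching:
  assumes h: "adapted k h" and w: "0 \<le> Re w"
  shows "expectation (\<lambda>\<omega>. h \<omega> * exp (- (w * complex_of_real (a ^ k * W \<omega>)))) = expectation (\<lambda>\<omega>. h \<omega> * cphi w ^ Z k \<omega>)"
proof -
  note [measurable] = adapted_measurable[OF h]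
  define s where "s m = exp (- (w / complex_of_real (a ^ m)))" for m
  have s1: "cmod (s m) \<le> 1" for m
    unfolding s_def using w a_gt_1 by simp
  have sZ: "s m ^ Z (k + m) \<omega> = exp (- (w * complex_of_real (a ^ k * Wn (k + m) \<omega>)))" for k m \<omega>
  proof -
    have "s m ^ Z (k + m) \<omega> = exp (of_nat (Z (k + m) \<omega>) * - (w / complex_of_real (a ^ m)))"
      unfolding s_def by (rule exp_of_nat_mult[symmetric])
    also have "of_nat (Z (k + m) \<omega>) * - (w / complex_of_real (a ^ m)) = - (w * complex_of_real (a ^ k * Wn (k + m) \<omega>))"
      using a_gt_1 by (simp add: Wn_def power_add field_simps)
    finally show ?thesis .
  qed
  have L: "(\<lambda>m. expectation (\<lambda>\<omega>. g \<omega> * s m ^ Z (k + m) \<omega>)) \<longlonglongrightarrow> expectation (\<lambda>\<omega>. g \<omega> * exp (- (w * complex_of_real (a ^ k * W \<omega>))))"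
    if g[measurable]: "g \<in> borel_measurable M" and g1: "\<And>\<omega>. cmod (g \<omega>) \<le> 1" for g k
  proof (rule integral_dominated_convergence[where w = "\<lambda>_. 1"])
    show "AE \<omega> in M. (\<lambda>m. g \<omega> * s m ^ Z (k + m) \<omega>) \<longlonglongrightarrow> g \<omega> * exp (- (w * complex_of_real (a ^ k * W \<omega>)))"
      using AE_Wn_tendsto
    proof eventually_elim
      case (elim \<omega>)
      have "(\<lambda>m. Wn (k + m) \<omega>) \<longlonglongrightarrow> W \<omega>" using LIMSEQ_ignore_initial_segment[OF elim, of k] by (simp add: add.commute)
      then show ?case unfolding sZ by (intro tendsto_intros)
    qed
    show "AE \<omega> in M. cmod (g \<omega> * s m ^ Z (k + m) \<omega>) \<le> 1" for m
      unfolding norm_mult norm_power using g1 s1 by (intro AE_I2 mult_le_one power_le_one) auto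
  qed auto
  have c: "(\<lambda>m. expectation (\<lambda>\<omega>. s m ^ Z m \<omega>)) \<longlonglongrightarrow> cphi w"
    using L[of "\<lambda>_. 1" 0] by (simp add: cphi_def)
  have "(\<lambda>m. expectation (\<lambda>\<omega>. h \<omega> * expectation (\<lambda>\<omega>. s m ^ Z m \<omega>) ^ Z k \<omega>)) \<longlonglongrightarrow> expectation (\<lambda>\<omega>. h \<omega> * cphi w ^ Z k \<omega>)"
  proof (rule integral_dominated_convergence[where w = "\<lambda>_. 1"])
    show "AE \<omega> in M. (\<lambda>m. h \<omega> * expectation (\<lambda>\<omega>. s m ^ Z m \<omega>) ^ Z k \<omega>) \<longlonglongrightarrow> h \<omega> * cphi w ^ Z k \<omega>"
      by (intro AE_I2 tendsto_intros c)
    have "cmod (expectation (\<lambda>\<omega>. s m ^ Z m \<omega>)) \<le> 1" for m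
      using expectation_power_Z[OF s1] cpgf_iterate_le_1[OF s1] by simp
    then show "AE \<omega> in M. cmod (h \<omega> * expectation (\<lambda>\<omega>. s m ^ Z m \<omega>) ^ Z k \<omega>) \<le> 1" for m
      unfolding norm_mult norm_power using adapted_bound[OF h] by (intro AE_I2 mult_le_one power_le_one) auto
  qed auto
  moreover have "expectation (\<lambda>\<omega>. h \<omega> * expectation (\<lambda>\<omega>. s m ^ Z m \<omega>) ^ Z k \<omega>) = expectation (\<lambda>\<omega>. h \<omega> * s m ^ Z (k + m) \<omega>)" for m
    by (rule branching[OF h s1, symmetric])
  ultimately show ?thesis
    using LIMSEQ_unique[OF L[of h k]] adapted_bound[OF h] by simp
qed

definition "phi z = lap M W 0 z"
definition "om z = - ln (phi z)"

lemma phi_pos: "z > 0 \<Longrightarrow> phi z > 0" unfolding phi_def by (rule Wrv.lap0_pos)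

lemma phi_less_1: assumes z: "z > 0" shows "phi z < 1"
proof -
  have "phi z \<noteq> 1"
  proof
    assume "phi z = 1"
    then have "expectation (\<lambda>\<omega>. 1 - exp (- (z * W \<omega>))) = 0"
      using Wrv.integrable_lap0[OF z] by (simp add: phi_def lap_def prob_space)
    moreover have "AE \<omega> in M. 0 \<le> 1 - exp (- (z * W \<omega>))"
      using AE_W_nonneg z by (auto elim: eventually_mono)
    ultimately have "AE \<omega> in M. 1 - exp (- (z * W \<omega>)) = 0"
      using Wrv.integrable_lap0[OF z] by (subst integral_nonneg_eq_0_iff_AE[symmetric]) auto
    then have "AE \<omega> in M. W \<omega> = 0" by eventually_elim (use z in simp)
    then show False using W_not_AE_0 by simp
  qed
  then show ?thesis using Wrv.lap0_le_1[OF z] by (simp add: phi_def)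
qed

lemma om_pos: "z > 0 \<Longrightarrow> om z > 0"
  unfolding om_def using phi_pos[of z] phi_less_1[of z] by simp

lemma exp_om: "z > 0 \<Longrightarrow> exp (- om z) = phi z"
  unfolding om_def using phi_pos[of z] by simp

lemma cphi_of_real: "cphi (complex_of_real z) = complex_of_real (phi z)"
proof -
  have "cphi (complex_of_real z) = expectation (\<lambda>\<omega>. complex_of_real (exp (- (z * W \<omega>))))"
    unfolding cphi_def by (simp add: exp_of_real[symmetric])
  then show ?thesis by (simp add: phi_def lap_def integral_complex_of_real)
qed

lemma laplace_branching_event:
  assumes k: "k \<le> n" and z: "z > 0"
  shows "expectation (\<lambda>\<omega>. of_bool (Q (Z k \<omega>)) * exp (- (z * (a ^ n * W \<omega>)))) = expectation (\<lambda>\<omega>. of_bool (Q (Z k \<omega>)) * phi z ^ Z n \<omega>)"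
proof -
  have "complex_of_real (expectation (\<lambda>\<omega>. of_bool (Q (Z k \<omega>)) * exp (- (z * (a ^ n * W \<omega>))))) =
    expectation (\<lambda>\<omega>. of_bool (Q (Z k \<omega>)) * exp (- (complex_of_real z * complex_of_real (a ^ n * W \<omega>))))"
    by (simp add: integral_complex_of_real[symmetric] complex_of_real_of_bool exp_of_real[symmetric])
  also have "\<dots> = expectation (\<lambda>\<omega>. of_bool (Q (Z k \<omega>)) * complex_of_real (phi z) ^ Z n \<omega>)"
    using laplace_branching[OF adapted_event[OF k], of "complex_of_real z" Q] z by (simp add: cphi_of_real)
  also have "\<dots> = complex_of_real (expectation (\<lambda>\<omega>. of_bool (Q (Z k \<omega>)) * phi z ^ Z n \<omega>))"
    by (simp add: integral_complex_of_real[symmetric] complex_of_real_of_bool)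
  finally show ?thesis by (simp only: of_real_eq_iff)
qed

lemma cpgf_exp: "x > 0 \<Longrightarrow> cpgf (complex_of_real (exp (- x))) = complex_of_real (exp (- Lam x))"
proof -
  assume x: "x > 0"
  have "cpgf (complex_of_real (exp (- x))) = measure_pmf.expectation p (\<lambda>n. complex_of_real (exp (- (x * real n))))"
  proof -
    have "complex_of_real (exp (- x)) ^ n = complex_of_real (exp (- (x * real n)))" for n
      by (simp add: of_real_power[symmetric] exp_of_nat_mult[symmetric] mult.commute del: of_real_power)
    then show ?thesis unfolding cpgf_def by (intro Bochner_Integration.integral_cong refl)
  qed
  also have "\<dots> = complex_of_real (lap (measure_pmf p) real 0 x)"
    by (simp add: lap_def integral_complex_of_real)
  finally show ?thesis using exp_Lam[OF x] by simp
qed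

lemma cpgf_iterate_exp: "x > 0 \<Longrightarrow> (cpgf ^^ n) (complex_of_real (exp (- x))) = complex_of_real (exp (- Lm n x))"
  by (induction n) (auto simp: Lm_Suc cpgf_exp Lm_pos)

text \<open>Seen from generation k, tilting generation n by x amounts to tilting generation k by
  \<open>Lm (n - k) x\<close>.\<close>

lemma expectation_power_Z_event:
  assumes k: "k \<le> n" and x: "x > 0"
  shows "expectation (\<lambda>\<omega>. of_bool (Q (Z k \<omega>)) * exp (- x) ^ Z n \<omega>) = expectation (\<lambda>\<omega>. of_bool (Q (Z k \<omega>)) * exp (- Lm (n - k) x) ^ Z k \<omega>)"
proof -
  have "complex_of_real (expectation (\<lambda>\<omega>. of_bool (Q (Z k \<omega>)) * exp (- x) ^ Z n \<omega>)) =
    expectation (\<lambda>\<omega>. of_bool (Q (Z k \<omega>)) * complex_of_real (exp (- x)) ^ Z (k + (n - k)) \<omega>)"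
    using k by (simp add: integral_complex_of_real[symmetric] complex_of_real_of_bool)
  also have "\<dots> = expectation (\<lambda>\<omega>. of_bool (Q (Z k \<omega>)) * (cpgf ^^ (n - k)) (complex_of_real (exp (- x))) ^ Z k \<omega>)"
    using x by (intro multi_step adapted_event) auto
  also have "\<dots> = complex_of_real (expectation (\<lambda>\<omega>. of_bool (Q (Z k \<omega>)) * exp (- Lm (n - k) x) ^ Z k \<omega>))"
    unfolding cpgf_iterate_exp[OF x] by (simp add: integral_complex_of_real[symmetric] complex_of_real_of_bool)
  finally show ?thesis by (simp only: of_real_eq_iff)
qed

lemma lap_Z: "x > 0 \<Longrightarrow> lap M (\<lambda>\<omega>. real (Z n \<omega>)) 0 x = exp (- Lm n x)"
proof -
  assume x: "x > 0"
  have "lap M (\<lambda>\<omega>. real (Z n \<omega>)) 0 x = expectation (\<lambda>\<omega>. exp (- x) ^ Z n \<omega>)"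
    unfolding lap_def by (simp add: exp_of_nat_mult[symmetric] mult.commute)
  also have "\<dots> = exp (- Lm n x)"
    using expectation_power_Z_event[of 0 n x "\<lambda>_. True"] x by (simp add: prob_space)
  finally show ?thesis .
qed

lemma om_scale: assumes z: "z > 0" shows "om (a ^ n * z) = Lm n (om z)"
proof -
  have "phi (a ^ n * z) = expectation (\<lambda>\<omega>. exp (- (z * (a ^ n * W \<omega>))))"
    unfolding phi_def lap_def by (simp add: mult_ac)
  also have "\<dots> = expectation (\<lambda>\<omega>. phi z ^ Z n \<omega>)"
    using laplace_branching_event[of 0 n z "\<lambda>_. True"] z by simp
  also have "\<dots> = expectation (\<lambda>\<omega>. exp (- om z) ^ Z n \<omega>)" using exp_om[OF z] by simp
  also have "\<dots> = exp (- Lm n (om z))"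
    using expectation_power_Z_event[of 0 n "om z" "\<lambda>_. True"] om_pos[OF z] by (simp add: prob_space)
  finally show ?thesis unfolding om_def[of "a ^ n * z"] by simp
qed

text \<open>No moments are computed: minus the logarithm of the Laplace transform of
  \<open>Z n\<close> is \<open>Lm n\<close>, whose derivative is known in two ways. The second
  derivative identifies the variance likewise.\<close>

lemma tmean_Z: assumes x: "x > 0" shows "tmean M (\<lambda>\<omega>. real (Z n \<omega>)) x = Mm n x"
proof (rule DERIV_unique)
  show "(Lm n has_real_derivative Mm n x) (at x)" by (rule DERIV_Lm[OF x])
  show "(Lm n has_real_derivative tmean M (\<lambda>\<omega>. real (Z n \<omega>)) x) (at x)"
    by (rule has_field_derivative_transform_within_open[OF Zrv.DERIV_log_lap[OF x], of "{0<..}"])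
       (use x lap_Z in auto)
qed

lemma tvar_Z: assumes x: "x > 0" shows "tvar M (\<lambda>\<omega>. real (Z n \<omega>)) x = Vm n x"
proof -
  have "(Mm n has_real_derivative - tvar M (\<lambda>\<omega>. real (Z n \<omega>)) x) (at x)"
    by (rule has_field_derivative_transform_within_open[OF Zrv.DERIV_tmean[OF x], of "{0<..}"])
       (use x tmean_Z in auto)
  from DERIV_unique[OF this DERIV_Mm[OF x]] show ?thesis by simp
qed

section \<open>Minimal growth of the generations and nondegeneracy of W\<close>

lemma AE_X_ge_mu: "AE \<omega> in M. \<forall>n i. X n i \<omega> \<ge> mu"
  unfolding AE_all_countable using AE_X[of "\<lambda>k. k \<ge> mu"] AE_ge_mu by blast

lemma Z_Suc_ge: "\<forall>n i. X n i \<omega> \<ge> mu \<Longrightarrow> Z (Suc n) \<omega> \<ge> mu * Z n \<omega>"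
  using sum_mono[of "{..<Z n \<omega>}" "\<lambda>_. mu" "\<lambda>i. X n i \<omega>"] by (simp add: mult.commute)

lemma Z_ge: "\<forall>n i. X n i \<omega> \<ge> mu \<Longrightarrow> Z n \<omega> \<ge> mu ^ n"
proof (induction n)
  case (Suc n)
  have "mu * mu ^ n \<le> mu * Z n \<omega>" using Suc by (intro mult_left_mono) auto
  also have "\<dots> \<le> Z (Suc n) \<omega>" by (rule Z_Suc_ge[OF Suc.prems])
  finally show ?case by simp
qed simp

lemma AE_Z_ge: "AE \<omega> in M. Z n \<omega> \<ge> mu ^ n"
  using AE_X_ge_mu by eventually_elim (rule Z_ge)

text \<open>For constant W the exponent \<open>om\<close> is linear, and \<open>om_scale\<close>
  forces \<open>Lam x = a * x\<close>. Since a > \<mu>, this contradicts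
  \<open>Lam x \<le> mu * x + C0\<close> for large x; the chosen x makes (a - \<mu>) x equal to
  \<open>C0 + 1\<close>.\<close>

lemma W_nondegenerate: "\<not> (AE \<omega> in M. W \<omega> = c)"
proof
  assume Wc: "AE \<omega> in M. W \<omega> = c"
  then have "AE \<omega> in M. 0 \<le> c" using AE_W_nonneg by eventually_elim simp
  then have "c \<ge> 0" by simp
  moreover have "c \<noteq> 0" using Wc W_not_AE_0 by auto
  ultimately have c: "c > 0" by simp
  have phi: "phi z = exp (- (z * c))" for z
  proof -
    have "phi z = expectation (\<lambda>\<omega>. exp (- (z * c)))"
      unfolding phi_def lap_def by (rule integral_cong_AE) (use Wc in \<open>auto elim!: eventually_mono\<close>)
    then show ?thesis by (simp add: prob_space)
  qed
  define x where "x = (C0 + 1) / (a - mu)"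
  have am: "a - mu > 0" using mean_gt_mu by simp
  have x: "x > 0" using C0_nonneg am by (simp add: x_def)
  have "om (a ^ 1 * (x / c)) = Lam (om (x / c))" using om_scale[of "x / c" 1] x c by (simp add: Lm_Suc[of 0])
  then have "a * x = Lam x" using c by (simp add: om_def phi)
  also have "\<dots> \<le> real mu * x + C0" by (rule Lam_le[OF x])
  finally have "(a - mu) * x \<le> C0" by (simp add: algebra_simps)
  then show False using am by (simp add: x_def)
qed

section \<open>The saddle-point equation\<close>

definition "mW = tmean M W"
definition "vW = tvar M W"

lemma DERIV_om: "z > 0 \<Longrightarrow> (om has_real_derivative mW z) (at z)"
  unfolding om_def[abs_def] phi_def mW_def by (rule Wrv.DERIV_log_lap)

lemma DERIV_mW: "z > 0 \<Longrightarrow> (mW has_real_derivative - vW z) (at z)"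
  unfolding mW_def vW_def by (rule Wrv.DERIV_tmean)

lemma vW_pos: "z > 0 \<Longrightarrow> vW z > 0"
  unfolding vW_def by (rule Wrv.tvar_pos) (use W_nondegenerate in auto)

lemma mW_strict: "0 < x \<Longrightarrow> x < y \<Longrightarrow> mW y < mW x"
  unfolding mW_def by (rule Wrv.tmean_strict_antimono) (use W_nondegenerate in auto)

lemma mW_pos: assumes "z > 0" shows "mW z > 0"
proof -
  have "mW (z + 1) \<ge> 0" unfolding mW_def tmean_def using Wrv.lap_nonneg by (intro divide_nonneg_nonneg)
  then show ?thesis using mW_strict[OF assms, of "z + 1"] by simp
qed

text \<open>\<open>Bf\<close> is \<open>- b \<circ> \<phi>\<close> and \<open>yf\<close> its derivative, so that \<open>u\<^sub>1\<close> solves \<open>yf u\<^sub>1 = y\<close>.\<close>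

definition "Bf z = bt (om z)"
definition "yf z = Pf (om z) * mW z"

lemma DERIV_Bf: "z > 0 \<Longrightarrow> (Bf has_real_derivative yf z) (at z)"
  unfolding Bf_def[abs_def] yf_def by (rule DERIV_chain2[OF DERIV_bt[OF om_pos] DERIV_om])

lemma Bf_scale: "z > 0 \<Longrightarrow> Bf (a ^ n * z) = real mu ^ n * Bf z"
proof (induction n)
  case (Suc n)
  have "Bf (a ^ Suc n * z) = bt (Lam (om (a ^ n * z)))"
    using om_scale[OF Suc.prems, of "Suc n"] om_scale[OF Suc.prems, of n] by (simp add: Bf_def Lm_Suc)
  also have "\<dots> = mu * Bf (a ^ n * z)" unfolding Bf_def
    using Suc.prems a_gt_1 by (intro bt_Lam om_pos) simp
  finally show ?case using Suc by simp
qed simp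

lemma yf_scale: assumes z: "z > 0" shows "yf (a ^ n * z) = (mu / a) ^ n * yf z"
proof -
  have az: "a ^ n * z > 0" using z a_gt_1 by simp
  have "((\<lambda>z. Bf (a ^ n * z)) has_real_derivative yf (a ^ n * z) * a ^ n) (at z)"
    by (rule DERIV_chain2[where g = "\<lambda>z. a ^ n * z", OF DERIV_Bf[OF az]]) (auto intro!: derivative_eq_intros)
  moreover have "((\<lambda>z. Bf (a ^ n * z)) has_real_derivative real mu ^ n * yf z) (at z)"
    by (rule has_field_derivative_transform_within_open[OF DERIV_cmult[OF DERIV_Bf[OF z]], of "{0<..}"])
       (use z Bf_scale in auto)
  ultimately have "yf (a ^ n * z) * a ^ n = real mu ^ n * yf z" by (rule DERIV_unique)
  then show ?thesis using a_gt_1 by (simp add: power_divide field_simps)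
qed

lemma om_mono: "0 < x \<Longrightarrow> x \<le> y \<Longrightarrow> om x \<le> om y"
  by (rule DERIV_nonneg_imp_nondecreasing[of x y])
     (auto intro!: exI[of _ "mW _"] DERIV_om less_imp_le[OF mW_pos])

lemma yf_pos: "z > 0 \<Longrightarrow> yf z > 0"
  unfolding yf_def using Pf_ge_1[OF om_pos[of z]] mW_pos[of z] by (intro mult_pos_pos) auto

lemma yf_strict: assumes "0 < x" "x < y" shows "yf y < yf x"
proof -
  have "Pf (om y) \<le> Pf (om x)" using assms by (intro Pf_antimono om_pos om_mono) auto
  then have "yf y \<le> Pf (om x) * mW y" unfolding yf_def using mW_pos[of y] assms by (intro mult_right_mono) auto
  also have "\<dots> < yf x" unfolding yf_def using mW_strict[OF assms] Pf_ge_1[OF om_pos[of x]] assms by simp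
  finally show ?thesis .
qed

lemma isCont_yf: "z > 0 \<Longrightarrow> isCont yf z"
  unfolding yf_def[abs_def]
  by (intro isCont_mult isCont_o2[OF DERIV_isCont[OF DERIV_om] isCont_Pf] DERIV_isCont[OF DERIV_mW] om_pos)

text \<open>By the scaling relation \<open>yf\<close> is arbitrarily small at a^n and arbitrarily
  large at a^(-n), so y lies between these values for suitable n; continuity and strict monotonicity
  give the rest.\<close>

lemma yf_solution: assumes y: "y > 0" shows "\<exists>!u. u > 0 \<and> yf u = y"
proof -
  have q: "0 < mu / a" "mu / a < 1" using mean_gt_mu mu_pos a_gt_1 by auto
  obtain n where n: "(mu / a) ^ n < min (y / yf 1) (yf 1 / y)"
    using real_arch_pow_inv[of "min (y / yf 1) (yf 1 / y)" "mu / a"] q y yf_pos[of 1] by auto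
  have r: "(mu / a) ^ n < y / yf 1" "(mu / a) ^ n < yf 1 / y" using n by auto
  have hi: "yf (a ^ n) < y"
    using r(1) yf_scale[of 1 n] yf_pos[of 1] by (simp add: less_divide_eq)
  have lo: "yf (1 / a ^ n) > y"
  proof -
    have "yf 1 = (mu / a) ^ n * yf (1 / a ^ n)" using yf_scale[of "1 / a ^ n" n] a_gt_1 by simp
    then have "(mu / a) ^ n * y < (mu / a) ^ n * yf (1 / a ^ n)" using r(2) y by (simp add: less_divide_eq)
    then show ?thesis using q by (simp add: mult_less_cancel_left_pos)
  qed
  have "1 \<le> a ^ n" using a_gt_1 by (simp add: one_le_power less_imp_le)
  then have le: "1 / a ^ n \<le> a ^ n" by (smt (verit) divide_le_eq_1 le_divide_eq_1)
  have "\<exists>u\<ge>1 / a ^ n. u \<le> a ^ n \<and> yf u = y"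
    using hi lo le a_gt_1 by (intro IVT2) (auto intro!: isCont_yf intro: less_le_trans[of 0 "1 / a ^ n"])
  then obtain u where u: "u \<ge> 1 / a ^ n" "yf u = y" by blast
  have "u > 0" using u(1) a_gt_1 by (smt (verit) divide_pos_pos zero_less_power)
  moreover have "u' = u" if "u' > 0" "yf u' = y" for u'
    using yf_strict[of u u'] yf_strict[of u' u] that u \<open>u > 0\<close> by (cases u u' rule: linorder_cases) auto
  ultimately show ?thesis using u by blast
qed

end

section \<open>Local estimates for the limit\<close>

context prob_space
begin

text \<open>Change of measure with density w / e, followed by passage to the law of Y. With w an
  exponential times the indicator of an event it yields tilted laws restricted to that
  event.\<close>

lemma weighted_law:
  fixes w Y :: "'a \<Rightarrow> real"
  assumes w[measurable]: "w \<in> borel_measurable M" and w0: "\<And>\<omega>. w \<omega> \<ge> 0" and iw: "integrable M w"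
    and e: "expectation w = e" "e > 0" and Y[measurable]: "Y \<in> borel_measurable M"
  defines "Q \<equiv> distr (density M (\<lambda>\<omega>. ennreal (w \<omega> / e))) borel Y"
  shows "real_distribution Q"
    and "\<And>g :: real \<Rightarrow> real. g \<in> borel_measurable borel \<Longrightarrow> integral\<^sup>L Q g = expectation (\<lambda>\<omega>. w \<omega> * g (Y \<omega>)) / e"
    and "\<And>g :: real \<Rightarrow> complex. g \<in> borel_measurable borel \<Longrightarrow> integral\<^sup>L Q g = expectation (\<lambda>\<omega>. complex_of_real (w \<omega>) * g (Y \<omega>)) / complex_of_real e"
    and "\<And>g :: real \<Rightarrow> real. g \<in> borel_measurable borel \<Longrightarrow> integrable M (\<lambda>\<omega>. w \<omega> * g (Y \<omega>)) \<Longrightarrow> integrable Q g"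
    and "\<And>A. A \<in> sets borel \<Longrightarrow> measure Q A = expectation (\<lambda>\<omega>. w \<omega> * indicator A (Y \<omega>)) / e"
proof -
  have "emeasure (density M (\<lambda>\<omega>. ennreal (w \<omega> / e))) (space M) = (\<integral>\<^sup>+\<omega>. ennreal (w \<omega> / e) \<partial>M)"
    by (subst emeasure_density) (auto intro!: nn_integral_cong simp: indicator_def)
  also have "\<dots> = ennreal (expectation (\<lambda>\<omega>. w \<omega> / e))"
    using iw w0 e by (intro nn_integral_eq_integral) auto
  also have "\<dots> = 1" using e by simp
  finally interpret D: prob_space "density M (\<lambda>\<omega>. ennreal (w \<omega> / e))"
    by (intro prob_spaceI) simp
  have YD: "Y \<in> borel_measurable (density M (\<lambda>\<omega>. ennreal (w \<omega> / e)))" by simp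
  interpret Q: real_distribution Q
    unfolding Q_def real_distribution_def real_distribution_axioms_def using D.prob_space_distr[OF YD] by simp
  show "real_distribution Q" by unfold_locales
  show r: "integral\<^sup>L Q g = expectation (\<lambda>\<omega>. w \<omega> * g (Y \<omega>)) / e" if [measurable]: "g \<in> borel_measurable borel" for g :: "real \<Rightarrow> real"
  proof -
    have "integral\<^sup>L Q g = (\<integral>\<omega>. (w \<omega> / e) *\<^sub>R g (Y \<omega>) \<partial>M)"
      unfolding Q_def using w0 e(2) by (subst integral_distr[OF YD], simp, subst integral_density) auto
    also have "\<dots> = (\<integral>\<omega>. w \<omega> * g (Y \<omega>) / e \<partial>M)" by simp
    finally show ?thesis by simp
  qed
  show "integral\<^sup>L Q g = expectation (\<lambda>\<omega>. complex_of_real (w \<omega>) * g (Y \<omega>)) / complex_of_real e" if [measurable]: "g \<in> borel_measurable borel" for g :: "real \<Rightarrow> complex"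
  proof -
    have "integral\<^sup>L Q g = (\<integral>\<omega>. (w \<omega> / e) *\<^sub>R g (Y \<omega>) \<partial>M)"
      unfolding Q_def using w0 e by (subst integral_distr[OF YD]) (auto intro!: integral_density)
    also have "\<dots> = (\<integral>\<omega>. complex_of_real (w \<omega>) * g (Y \<omega>) / complex_of_real e \<partial>M)"
      by (simp add: scaleR_conv_of_real)
    finally show ?thesis by simp
  qed
  show "integrable Q g" if [measurable]: "g \<in> borel_measurable borel" and i: "integrable M (\<lambda>\<omega>. w \<omega> * g (Y \<omega>))" for g :: "real \<Rightarrow> real"
  proof -
    have "integrable M (\<lambda>\<omega>. w \<omega> * g (Y \<omega>) / e)" using i by simp
    then have "integrable M (\<lambda>\<omega>. (w \<omega> / e) *\<^sub>R g (Y \<omega>))" by simp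
    then show ?thesis
      unfolding Q_def using w0 e by (subst integrable_distr_eq[OF YD]) (auto simp: integrable_density)
  qed
  show "measure Q A = expectation (\<lambda>\<omega>. w \<omega> * indicator A (Y \<omega>)) / e" if [measurable]: "A \<in> sets borel" for A
  proof -
    have "measure Q A = integral\<^sup>L Q (indicator A)" using that by (simp add: Q_def)
    then show ?thesis by (subst (asm) r) auto
  qed
qed

end

context galton_watson
begin

section \<open>The centred characteristic function of W under the tilt\<close>

definition "psi u t = cphi (complex_of_real u - \<i> * t) / complex_of_real (phi u) * iexp (- t * mW u)"

text \<open>An upper bound for the third absolute central moment under the tilt, from |W - m|^3
  \<le> W^3 + m^3 for nonnegative W and m. In this form continuity in u is immediate.\<close>

definition "third u = lap M W 3 u / phi u + mW u ^ 3"

lemma W_le_exp_integrable: "u > 0 \<Longrightarrow> integrable M (\<lambda>\<omega>. exp (- (u * W \<omega>)) * (W \<omega> ^ k))"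
  using Wrv.integrable_lap[of u k] by (simp add: mult.commute)

lemma cphi_weighted:
  "expectation (\<lambda>\<omega>. complex_of_real (exp (- (u * W \<omega>))) * iexp (t * (W \<omega> - c))) = cphi (complex_of_real u - \<i> * t) * iexp (- t * c)"
proof -
  have "complex_of_real (exp (- (u * W \<omega>))) * iexp (t * (W \<omega> - c)) = exp (- ((complex_of_real u - \<i> * t) * complex_of_real (W \<omega>))) * iexp (- t * c)" for \<omega>
    by (simp add: exp_of_real[symmetric] exp_add[symmetric] algebra_simps)
  then show ?thesis unfolding cphi_def by simp
qed

lemma psi_approx:
  assumes u: "u > 0"
  shows "cmod (psi u t - complex_of_real (1 - vW u * t\<^sup>2 / 2)) \<le> third u / 6 * \<bar>t\<bar> ^ 3"
proof -
  define w where "w \<omega> = exp (- (u * W \<omega>))" for \<omega>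
  have [measurable]: "w \<in> borel_measurable M" unfolding w_def[abs_def] by measurable
  have iw: "integrable M w" unfolding w_def[abs_def] using Wrv.integrable_lap0[OF u] by simp
  have ew: "expectation w = phi u" unfolding w_def[abs_def] phi_def lap_def by simp
  have ph: "phi u > 0" by (rule phi_pos[OF u])
  define Q where "Q = distr (density M (\<lambda>\<omega>. ennreal (w \<omega> / phi u))) borel (\<lambda>\<omega>. W \<omega> - mW u)"
  note law = weighted_law[of w "phi u" "\<lambda>\<omega>. W \<omega> - mW u", folded Q_def, OF _ _ iw ew ph]
  interpret Q: real_distribution Q by (rule law) (auto simp: w_def)
  have m: "mW u = lap M W 1 u / phi u" by (simp add: mW_def tmean_def phi_def)
  have mp: "mW u > 0" by (rule mW_pos[OF u])
  have ch: "char Q t = psi u t"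
  proof -
    have "char Q t = expectation (\<lambda>\<omega>. complex_of_real (w \<omega>) * iexp (t * (W \<omega> - mW u))) / complex_of_real (phi u)"
      unfolding char_def by (rule law) (auto simp: w_def)
    then show ?thesis unfolding w_def cphi_weighted psi_def by simp
  qed
  have i1: "integrable M (\<lambda>\<omega>. w \<omega> * (W \<omega> - mW u))"
    using W_le_exp_integrable[OF u, of 1] W_le_exp_integrable[OF u, of 0] by (simp add: w_def right_diff_distrib)
  have e1: "expectation (\<lambda>\<omega>. w \<omega> * (W \<omega> - mW u)) = 0"
  proof -
    have "expectation (\<lambda>\<omega>. w \<omega> * (W \<omega> - mW u)) = lap M W 1 u - mW u * phi u"
      using W_le_exp_integrable[OF u, of 1] W_le_exp_integrable[OF u, of 0]
      by (simp add: w_def right_diff_distrib lap_def phi_def mult.commute)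
    then show ?thesis using m ph by simp
  qed
  have i2: "integrable M (\<lambda>\<omega>. w \<omega> * (W \<omega> - mW u)\<^sup>2)"
    using Wrv.second_moment_tilted(1)[OF u, of "mW u"] by (simp add: w_def mult.commute)
  have e2: "expectation (\<lambda>\<omega>. w \<omega> * (W \<omega> - mW u)\<^sup>2) / phi u = vW u"
    using Wrv.tvar_eq[OF u] by (simp add: w_def vW_def phi_def mW_def mult.commute)
  have q1: "integrable Q (\<lambda>x. x)" "Q.expectation (\<lambda>x. x) = 0"
    by (rule law(4)[of "\<lambda>x. x"], use i1 in \<open>simp_all add: w_def\<close>)
      (subst law(2), use e1 in \<open>simp_all add: w_def\<close>)
  have q2: "integrable Q (\<lambda>x. x\<^sup>2)" "Q.variance (\<lambda>x. x) = vW u"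
    by (rule law(4)[of "\<lambda>x. x\<^sup>2"], use i2 in \<open>simp_all add: w_def\<close>)
      (simp add: q1(2), subst law(2), use e2 in \<open>simp_all add: w_def\<close>)
  have cube: "\<bar>W \<omega> - mW u\<bar> ^ 3 \<le> W \<omega> ^ 3 + mW u ^ 3" if "W \<omega> \<ge> 0" for \<omega>
  proof (cases "W \<omega> \<ge> mW u")
    case True
    then have "\<bar>W \<omega> - mW u\<bar> ^ 3 \<le> W \<omega> ^ 3" using mp by (intro power_mono) auto
    then show ?thesis using mp by (simp add: add_increasing2)
  next
    case False
    then have "\<bar>W \<omega> - mW u\<bar> ^ 3 \<le> mW u ^ 3" using that by (intro power_mono) auto
    then show ?thesis using that by (simp add: add_increasing)
  qed
  have i3b: "integrable M (\<lambda>\<omega>. w \<omega> * (W \<omega> ^ 3 + mW u ^ 3))"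
    using W_le_exp_integrable[OF u, of 3] W_le_exp_integrable[OF u, of 0] by (simp add: w_def distrib_left)
  have i3: "integrable M (\<lambda>\<omega>. w \<omega> * \<bar>W \<omega> - mW u\<bar> ^ 3)"
  proof (rule Bochner_Integration.integrable_bound[OF i3b])
    show "AE \<omega> in M. norm (w \<omega> * \<bar>W \<omega> - mW u\<bar> ^ 3) \<le> norm (w \<omega> * (W \<omega> ^ 3 + mW u ^ 3))"
      using AE_W_nonneg
    proof eventually_elim
      case (elim \<omega>)
      then have "0 \<le> W \<omega> ^ 3 + mW u ^ 3" using mp by simp
      then show ?case using cube[OF elim] by (simp add: abs_mult w_def mult_left_mono)
    qed
  qed measurable
  have e3: "expectation (\<lambda>\<omega>. w \<omega> * \<bar>W \<omega> - mW u\<bar> ^ 3) / phi u \<le> third u"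
  proof -
    have "expectation (\<lambda>\<omega>. w \<omega> * \<bar>W \<omega> - mW u\<bar> ^ 3) \<le> expectation (\<lambda>\<omega>. w \<omega> * (W \<omega> ^ 3 + mW u ^ 3))"
      by (rule integral_mono_AE[OF i3 i3b]) (use AE_W_nonneg cube in \<open>auto elim!: eventually_mono intro!: mult_left_mono simp: w_def\<close>)
    also have "\<dots> = lap M W 3 u + mW u ^ 3 * phi u"
      using W_le_exp_integrable[OF u, of 3] W_le_exp_integrable[OF u, of 0]
      by (simp add: w_def distrib_left lap_def phi_def mult.commute)
    finally show ?thesis using ph by (simp add: third_def field_simps)
  qed
  have q3: "integrable Q (\<lambda>x. \<bar>x\<bar> ^ 3)" "Q.expectation (\<lambda>x. \<bar>x\<bar> ^ 3) \<le> third u"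
    by (rule law(4)[of "\<lambda>x. \<bar>x\<bar> ^ 3"], use i3 in \<open>simp_all add: w_def\<close>)
      (subst law(2), use e3 in \<open>simp_all add: w_def\<close>)
  have "cmod (char Q t - complex_of_real (1 - t\<^sup>2 * vW u / 2)) \<le> (t\<^sup>2 / 6) * Q.expectation (\<lambda>x. min (6 * x\<^sup>2) (\<bar>t\<bar> * \<bar>x\<bar> ^ 3))"
    using Q.char_approx3[OF q1 q2, of t] by simp
  also have "\<dots> \<le> (t\<^sup>2 / 6) * Q.expectation (\<lambda>x. \<bar>t\<bar> * \<bar>x\<bar> ^ 3)"
    using q2 q3 by (intro mult_left_mono integral_mono) (auto intro!: integrable_min)
  also have "\<dots> = t\<^sup>2 / 6 * \<bar>t\<bar> * Q.expectation (\<lambda>x. \<bar>x\<bar> ^ 3)" by simp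
  also have "\<dots> \<le> t\<^sup>2 / 6 * \<bar>t\<bar> * third u" using q3 by (intro mult_left_mono) auto
  also have "\<dots> = third u / 6 * \<bar>t\<bar> ^ 3" by (simp add: power3_eq_cube power2_eq_square abs_mult_self_eq)
  finally show ?thesis unfolding ch by (simp add: mult.commute)
qed

lemma isCont_vW: "u > 0 \<Longrightarrow> isCont vW u"
proof -
  assume u: "u > 0"
  have "isCont (\<lambda>u. lap M W 2 u / lap M W 0 u - (mW u)\<^sup>2) u"
    using Wrv.lap0_pos[OF u] u
    by (intro continuous_intros DERIV_isCont[OF Wrv.DERIV_lap] DERIV_isCont[OF DERIV_mW]) auto
  then show ?thesis unfolding vW_def tvar_def mW_def .
qed

lemma isCont_third: "u > 0 \<Longrightarrow> isCont third u"
  unfolding third_def phi_def using Wrv.lap0_pos[of u]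
  by (intro continuous_intros DERIV_isCont[OF Wrv.DERIV_lap] DERIV_isCont[OF DERIV_mW]) auto

text \<open>Compactness of the range of u makes the constants independent of u, and thereby of
  \<epsilon>.\<close>

lemma uniform_moment_bounds:
  assumes ul: "0 < ul" "ul \<le> ur"
  obtains v0 v1 \<rho> where "0 < v0" "v0 \<le> v1" "0 \<le> \<rho>"
    "\<And>u. u \<in> {ul..ur} \<Longrightarrow> v0 \<le> vW u \<and> vW u \<le> v1"
    "\<And>u t. u \<in> {ul..ur} \<Longrightarrow> cmod (psi u t - complex_of_real (1 - vW u * t\<^sup>2 / 2)) \<le> \<rho> * \<bar>t\<bar> ^ 3"
proof -
  have cv: "continuous_on {ul..ur} vW" "continuous_on {ul..ur} third"
    using ul by (auto intro!: continuous_at_imp_continuous_on isCont_vW isCont_third)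
  obtain x where x: "x \<in> {ul..ur}" "\<And>u. u \<in> {ul..ur} \<Longrightarrow> vW x \<le> vW u"
    using continuous_attains_inf[OF compact_Icc _ cv(1)] ul by auto
  obtain y where y: "y \<in> {ul..ur}" "\<And>u. u \<in> {ul..ur} \<Longrightarrow> vW u \<le> vW y"
    using continuous_attains_sup[OF compact_Icc _ cv(1)] ul by auto
  obtain z where z: "z \<in> {ul..ur}" "\<And>u. u \<in> {ul..ur} \<Longrightarrow> third u \<le> third z"
    using continuous_attains_sup[OF compact_Icc _ cv(2)] ul by auto
  show ?thesis
  proof (rule that[of "vW x" "vW y" "\<bar>third z\<bar> / 6"])
    show "0 < vW x" using x ul by (intro vW_pos) auto
    show "vW x \<le> vW y" using x y by auto
    show "vW x \<le> vW u \<and> vW u \<le> vW y" if "u \<in> {ul..ur}" for u using x y that by auto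
    fix u t assume u: "u \<in> {ul..ur}"
    have "cmod (psi u t - complex_of_real (1 - vW u * t\<^sup>2 / 2)) \<le> third u / 6 * \<bar>t\<bar> ^ 3"
      using u ul by (intro psi_approx) auto
    also have "\<dots> \<le> \<bar>third z\<bar> / 6 * \<bar>t\<bar> ^ 3" using z(2)[OF u] by (intro mult_right_mono) auto
    finally show "cmod (psi u t - complex_of_real (1 - vW u * t\<^sup>2 / 2)) \<le> \<bar>third z\<bar> / 6 * \<bar>t\<bar> ^ 3" .
  qed simp
qed

section \<open>Matching upper and lower bounds for the left tail of W\<close>

lemma cmod_cphi_eq_psi: "u > 0 \<Longrightarrow> cmod (cphi (complex_of_real u - \<i> * t)) = phi u * cmod (psi u t)"
  using phi_pos[of u] by (simp add: psi_def norm_mult norm_divide)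

lemma AE_scaled_W_nonneg: "AE \<omega> in M. 0 \<le> a ^ n * W \<omega>"
  using AE_W_nonneg a_gt_1 by (auto elim!: eventually_mono)

lemma integrable_weighted_event:
  assumes u: "u > 0"
  shows "integrable M (\<lambda>\<omega>. of_bool (Q (Z k \<omega>)) * exp (- (u * (a ^ n * W \<omega>))))"
proof (rule integrable_const_bound[where B = 1])
  show "AE \<omega> in M. norm (of_bool (Q (Z k \<omega>)) * exp (- (u * (a ^ n * W \<omega>)))) \<le> 1"
    using AE_scaled_W_nonneg[of n] by eventually_elim (use u in \<open>auto intro!: mult_le_one\<close>)
qed measurable

lemma char_weighted_event:
  assumes kn: "k \<le> n" and u: "u > 0"
  shows "expectation (\<lambda>\<omega>. complex_of_real (of_bool (Q (Z k \<omega>)) * exp (- (u * (a ^ n * W \<omega>)))) * iexp (t * (a ^ n * W \<omega> - c)))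
     = expectation (\<lambda>\<omega>. of_bool (Q (Z k \<omega>)) * cphi (complex_of_real u - \<i> * t) ^ Z n \<omega>) * iexp (- t * c)"
proof -
  have "complex_of_real (of_bool (Q (Z k \<omega>)) * exp (- (u * (a ^ n * W \<omega>)))) * iexp (t * (a ^ n * W \<omega> - c))
     = of_bool (Q (Z k \<omega>)) * exp (- ((complex_of_real u - \<i> * t) * complex_of_real (a ^ n * W \<omega>))) * iexp (- t * c)" for \<omega>
    by (simp add: exp_of_real[symmetric] exp_add[symmetric] algebra_simps complex_of_real_of_bool)
  then show ?thesis
    using laplace_branching[OF adapted_event[OF kn], of "complex_of_real u - \<i> * t" Q] u by simp
qed

text \<open>A Chernoff bound sharpened by the factor \<mu>^(-n/2). The indicator of a^n W < x is
  dominated by exp (u x) times the tilting weight times the test function of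
  \<open>concentration\<close>. The tilted law has a characteristic function of modulus at most
  r^(\<mu>^n) near 0, because generation n has at least \<mu>^n individuals.\<close>

lemma upper_estimate:
  assumes ul: "0 < ul" "ul \<le> ur"
  obtains C where "C > 0"
    "\<And>u k n x Q. u \<in> {ul..ur} \<Longrightarrow> k \<le> n \<Longrightarrow>
      expectation (\<lambda>\<omega>. of_bool (Q (Z k \<omega>)) * of_bool (a ^ n * W \<omega> < x))
       \<le> C * exp (u * x) / sqrt (real mu ^ n) * expectation (\<lambda>\<omega>. of_bool (Q (Z k \<omega>)) * phi u ^ Z n \<omega>)"
proof -
  obtain v0 v1 \<rho> where v: "0 < v0" "v0 \<le> v1" "0 \<le> \<rho>"
    "\<And>u. u \<in> {ul..ur} \<Longrightarrow> v0 \<le> vW u \<and> vW u \<le> v1"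
    "\<And>u t. u \<in> {ul..ur} \<Longrightarrow> cmod (psi u t - complex_of_real (1 - vW u * t\<^sup>2 / 2)) \<le> \<rho> * \<bar>t\<bar> ^ 3"
    by (rule uniform_moment_bounds[OF ul]) (rule that, assumption+)
  define d where "d = min (1 / (v1 + 1)) (v0 / (4 * (\<rho> + 1)))"
  have d: "d > 0" using v(1-3) by (auto simp: d_def intro!: divide_pos_pos)
  \<comment> \<open>The constant in (y + pi / d)^2 \<le> C1 exp (u y) for y > 0: the surplus
    exponential at distance y below x pays for the decay of the test function.\<close>
  define C1 where "C1 = 4 / ul\<^sup>2 + 2 * (pi / d)\<^sup>2"
  have C1: "C1 > 0" using ul by (auto simp: C1_def intro!: add_pos_nonneg)
  define C where "C = C1 * (d / 2 * sqrt (4 * pi / v0))"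
  show ?thesis
  proof (rule that[of C])
    show "C > 0" using C1 d v by (auto simp: C_def)
    fix u x :: real and k n :: nat and Q :: "nat \<Rightarrow> bool"
    assume u: "u \<in> {ul..ur}" and kn: "k \<le> n"
    have up: "u > 0" using u ul by auto
    define w where "w \<omega> = of_bool (Q (Z k \<omega>)) * exp (- (u * (a ^ n * W \<omega>)))" for \<omega>
    have wm[measurable]: "w \<in> borel_measurable M" unfolding w_def[abs_def] by measurable
    have w0: "w \<omega> \<ge> 0" for \<omega> by (simp add: w_def)
    have iw: "integrable M w" unfolding w_def[abs_def] by (rule integrable_weighted_event[OF up])
    define e where "e = expectation w"
    have e_eq: "e = expectation (\<lambda>\<omega>. of_bool (Q (Z k \<omega>)) * phi u ^ Z n \<omega>)"
      unfolding e_def w_def by (rule laplace_branching_event[OF kn up])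
    have e0: "e \<ge> 0" unfolding e_def using w0 by (intro integral_nonneg_AE) auto
    define N where "N = real mu ^ n"
    have N: "N > 0" using mu_pos by (simp add: N_def)
    have bnd: "of_bool (Q (Z k \<omega>)) * of_bool (a ^ n * W \<omega> < x) \<le> exp (u * x) * C1 * (w \<omega> * (1 / (\<bar>a ^ n * W \<omega> - x\<bar> + pi / d)\<^sup>2))" for \<omega>
    proof (cases "Q (Z k \<omega>) \<and> a ^ n * W \<omega> < x")
      case True
      define y where "y = x - a ^ n * W \<omega>"
      have y: "y > 0" using True by (simp add: y_def)
      have "(u * y)\<^sup>2 \<le> 2 * exp (u * y)" using power_le_fact_exp[of "u * y" 2] y up by (simp add: fact_2)
      then have "y\<^sup>2 \<le> 2 / u\<^sup>2 * exp (u * y)" using up by (simp add: power_mult_distrib field_simps)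
      also have "\<dots> \<le> 2 / ul\<^sup>2 * exp (u * y)"
        using u ul by (intro mult_right_mono divide_left_mono power_mono) auto
      finally have y2: "y\<^sup>2 \<le> 2 / ul\<^sup>2 * exp (u * y)" .
      have "(y + pi / d)\<^sup>2 \<le> 2 * y\<^sup>2 + 2 * (pi / d)\<^sup>2"
        using sum_squares_bound[of y "pi / d"] by (simp add: power2_sum)
      also have "\<dots> \<le> 4 / ul\<^sup>2 * exp (u * y) + 2 * (pi / d)\<^sup>2 * exp (u * y)"
      proof (rule add_mono)
        show "2 * y\<^sup>2 \<le> 4 / ul\<^sup>2 * exp (u * y)" using y2 by simp
        have "2 * (pi / d)\<^sup>2 * 1 \<le> 2 * (pi / d)\<^sup>2 * exp (u * y)" using y up by (intro mult_left_mono) auto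
        then show "2 * (pi / d)\<^sup>2 \<le> 2 * (pi / d)\<^sup>2 * exp (u * y)" by simp
      qed
      also have "\<dots> = C1 * exp (u * y)" by (simp add: C1_def algebra_simps)
      finally have "(y + pi / d)\<^sup>2 \<le> C1 * exp (u * y)" .
      moreover have "(y + pi / d)\<^sup>2 > 0" using y d by (intro zero_less_power add_pos_nonneg) auto
      ultimately have "1 \<le> C1 * exp (u * y) * (1 / (y + pi / d)\<^sup>2)" by (simp add: le_divide_eq)
      also have "exp (u * y) = exp (u * x) * w \<omega>"
        using True by (simp add: w_def y_def exp_add[symmetric] algebra_simps)
      finally show ?thesis using True y by (simp add: y_def mult_ac abs_minus_commute)
    next
      case False
      then show ?thesis using w0[of \<omega>] C1 by (auto intro!: mult_nonneg_nonneg)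
    qed
    have ig: "integrable M (\<lambda>\<omega>. w \<omega> * (1 / (\<bar>a ^ n * W \<omega> - x\<bar> + pi / d)\<^sup>2))"
    proof (rule Bochner_Integration.integrable_bound)
      show "integrable M (\<lambda>\<omega>. w \<omega> * (1 / (pi / d)\<^sup>2))" using iw by (rule integrable_mult_left)
      have "1 / (\<bar>y\<bar> + pi / d)\<^sup>2 \<le> 1 / (pi / d)\<^sup>2" for y
        using d by (intro divide_left_mono power_mono mult_pos_pos zero_less_power add_nonneg_pos) auto
      then show "AE \<omega> in M. norm (w \<omega> * (1 / (\<bar>a ^ n * W \<omega> - x\<bar> + pi / d)\<^sup>2)) \<le> norm (w \<omega> * (1 / (pi / d)\<^sup>2))"
        unfolding norm_mult by (intro AE_I2 mult_left_mono) auto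
    qed measurable
    \<comment> \<open>The event of generation k may be null; then \<open>e = 0\<close>, there is no
      tilted law, and both sides vanish.\<close>
    have main: "expectation (\<lambda>\<omega>. w \<omega> * (1 / (\<bar>a ^ n * W \<omega> - x\<bar> + pi / d)\<^sup>2)) \<le> d / 2 * sqrt (4 * pi / v0) / sqrt N * e"
    proof (cases "e = 0")
      case True
      then have "AE \<omega> in M. w \<omega> = 0"
        using integral_nonneg_eq_0_iff_AE[OF iw] w0 by (simp add: e_def)
      then have "expectation (\<lambda>\<omega>. w \<omega> * (1 / (\<bar>a ^ n * W \<omega> - x\<bar> + pi / d)\<^sup>2)) = expectation (\<lambda>\<omega>. 0)"
        by (intro integral_cong_AE) (auto elim: eventually_mono)
      then show ?thesis using True by simp
    next
      case False
      then have ep: "e > 0" using e0 by simp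
      define R where "R = distr (density M (\<lambda>\<omega>. ennreal (w \<omega> / e))) borel (\<lambda>\<omega>. a ^ n * W \<omega>)"
      note law = weighted_law[of w e "\<lambda>\<omega>. a ^ n * W \<omega>", folded R_def, OF wm w0 iw e_def[symmetric] ep]
      interpret R: real_distribution R by (rule law) auto
      have conc: "(\<integral>y. 1 / (\<bar>y - x\<bar> + pi / d)\<^sup>2 \<partial>R) \<le> d / 2 * sqrt (pi / (v0 * N / 4))"
      proof (rule R.concentration[OF d])
        show "v0 * N / 4 > 0" using v N by simp
        fix t assume t: "\<bar>t\<bar> \<le> d"
        define r where "r = exp (- (v0/4) * t\<^sup>2)"
        have r: "0 < r" "r \<le> 1" using v by (auto simp: r_def)
        have "cmod (psi u t) \<le> r" unfolding r_def
          by (rule char_quadratic_decay(1)[where v = "vW u" and ?v1.0 = v1 and \<rho> = \<rho>])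
             (use v u t in \<open>auto simp: d_def\<close>)
        then have cp: "cmod (cphi (complex_of_real u - \<i> * t)) \<le> phi u * r"
          unfolding cmod_cphi_eq_psi[OF up] using phi_pos[OF up] by (intro mult_left_mono) auto
        have "char R t = expectation (\<lambda>\<omega>. complex_of_real (w \<omega>) * iexp (t * (a ^ n * W \<omega>))) / complex_of_real e"
          unfolding char_def by (rule law) auto
        also have "expectation (\<lambda>\<omega>. complex_of_real (w \<omega>) * iexp (t * (a ^ n * W \<omega>)))
            = expectation (\<lambda>\<omega>. of_bool (Q (Z k \<omega>)) * cphi (complex_of_real u - \<i> * t) ^ Z n \<omega>)"
          using char_weighted_event[OF kn up, of Q t 0] by (simp add: w_def)
        finally have "cmod (char R t) = cmod (expectation (\<lambda>\<omega>. of_bool (Q (Z k \<omega>)) * cphi (complex_of_real u - \<i> * t) ^ Z n \<omega>)) / e"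
          using ep by (simp add: norm_divide)
        moreover have "cmod (expectation (\<lambda>\<omega>. of_bool (Q (Z k \<omega>)) * cphi (complex_of_real u - \<i> * t) ^ Z n \<omega>))
            \<le> expectation (\<lambda>\<omega>. of_bool (Q (Z k \<omega>)) * phi u ^ Z n \<omega> * r ^ (mu ^ n))"
        proof (rule integral_norm_bound[THEN order_trans], rule integral_mono_AE')
          have "phi u \<le> 1" using phi_less_1[OF up] by simp
          then show "integrable M (\<lambda>\<omega>. of_bool (Q (Z k \<omega>)) * phi u ^ Z n \<omega> * r ^ (mu ^ n))"
            using phi_pos[OF up] r
            by (intro integrable_mult_left integrable_const_bound[where B = 1]) (auto intro!: mult_le_one power_le_one)
          show "AE \<omega> in M. cmod (of_bool (Q (Z k \<omega>)) * cphi (complex_of_real u - \<i> * t) ^ Z n \<omega>) \<le> of_bool (Q (Z k \<omega>)) * phi u ^ Z n \<omega> * r ^ (mu ^ n)"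
            using AE_Z_ge[of n]
          proof eventually_elim
            case (elim \<omega>)
            have "cmod (cphi (complex_of_real u - \<i> * t)) ^ Z n \<omega> \<le> (phi u * r) ^ Z n \<omega>" using cp by (intro power_mono) auto
            also have "\<dots> \<le> phi u ^ Z n \<omega> * r ^ (mu ^ n)"
              unfolding power_mult_distrib using r elim phi_pos[OF up] by (intro mult_left_mono power_decreasing) auto
            finally show ?case by (auto simp: norm_power)
          qed
        qed (use phi_pos[OF up] r in auto)
        moreover have "expectation (\<lambda>\<omega>. of_bool (Q (Z k \<omega>)) * phi u ^ Z n \<omega> * r ^ (mu ^ n)) = e * r ^ (mu ^ n)"
          by (simp add: e_eq)
        moreover have "r ^ (mu ^ n) = exp (- (v0 * N / 4) * t\<^sup>2)"
          by (simp add: r_def N_def exp_of_nat_mult[symmetric])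
        ultimately show "cmod (char R t) \<le> exp (- (v0 * N / 4) * t\<^sup>2)"
          using ep by (simp add: pos_divide_le_eq mult.commute)
      qed
      have "pi / (v0 * N / 4) = (4 * pi / v0) / N" by simp
      then have sq: "sqrt (pi / (v0 * N / 4)) = sqrt (4 * pi / v0) / sqrt N" by (simp only: real_sqrt_divide)
      have "(\<integral>y. 1 / (\<bar>y - x\<bar> + pi / d)\<^sup>2 \<partial>R) = expectation (\<lambda>\<omega>. w \<omega> * (1 / (\<bar>a ^ n * W \<omega> - x\<bar> + pi / d)\<^sup>2)) / e"
        by (rule law(2)) measurable
      then have "expectation (\<lambda>\<omega>. w \<omega> * (1 / (\<bar>a ^ n * W \<omega> - x\<bar> + pi / d)\<^sup>2)) / e \<le> d / 2 * (sqrt (4 * pi / v0) / sqrt N)"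
        using conc unfolding sq by linarith
      then show ?thesis using ep by (simp add: pos_divide_le_eq)
    qed
    have "expectation (\<lambda>\<omega>. of_bool (Q (Z k \<omega>)) * of_bool (a ^ n * W \<omega> < x))
      \<le> expectation (\<lambda>\<omega>. exp (u * x) * C1 * (w \<omega> * (1 / (\<bar>a ^ n * W \<omega> - x\<bar> + pi / d)\<^sup>2)))"
      by (rule integral_mono'[OF integrable_mult_right[OF ig]])
        (use bnd C1 w0 in \<open>auto intro!: mult_nonneg_nonneg divide_nonneg_nonneg\<close>)
    also have "\<dots> = exp (u * x) * C1 * expectation (\<lambda>\<omega>. w \<omega> * (1 / (\<bar>a ^ n * W \<omega> - x\<bar> + pi / d)\<^sup>2))"
      by (rule integral_mult_right_zero)
    also have "\<dots> \<le> exp (u * x) * C1 * (d / 2 * sqrt (4 * pi / v0) / sqrt N * e)"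
      using main C1 by (intro mult_left_mono) auto
    also have "\<dots> = C * exp (u * x) / sqrt (real mu ^ n) * expectation (\<lambda>\<omega>. of_bool (Q (Z k \<omega>)) * phi u ^ Z n \<omega>)"
      unfolding e_eq[symmetric] C_def N_def by simp
    finally show "expectation (\<lambda>\<omega>. of_bool (Q (Z k \<omega>)) * of_bool (a ^ n * W \<omega> < x))
       \<le> C * exp (u * x) / sqrt (real mu ^ n) * expectation (\<lambda>\<omega>. of_bool (Q (Z k \<omega>)) * phi u ^ Z n \<omega>)" .
  qed
qed


text \<open>On a single generation size n the probability of that size cancels, so the centred
  tilted law has characteristic function \<open>psi u t ^ n\<close> exactly, and
  \<open>local_lower_bound\<close> applies with constants independent of u, k, n and x.\<close>

lemma generation_local_lower:
  assumes ul: "0 < ul" "ul \<le> ur"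
  obtains c n0 where "c > 0"
    "\<And>u k n x. u \<in> {ul..ur} \<Longrightarrow> n \<ge> (n0::nat) \<Longrightarrow> \<bar>x - n * mW u\<bar> \<le> D * sqrt n \<Longrightarrow>
      expectation (\<lambda>\<omega>. of_bool (Z k \<omega> = n) * of_bool (a ^ k * W \<omega> < x))
       \<ge> c * exp (u * x) / sqrt n * expectation (\<lambda>\<omega>. of_bool (Z k \<omega> = n) * phi u ^ Z k \<omega>)"
proof -
  obtain v0 v1 \<rho> where v: "0 < v0" "v0 \<le> v1" "0 \<le> \<rho>"
    "\<And>u. u \<in> {ul..ur} \<Longrightarrow> v0 \<le> vW u \<and> vW u \<le> v1"
    "\<And>u t. u \<in> {ul..ur} \<Longrightarrow> cmod (psi u t - complex_of_real (1 - vW u * t\<^sup>2 / 2)) \<le> \<rho> * \<bar>t\<bar> ^ 3"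
    by (rule uniform_moment_bounds[OF ul]) (rule that, assumption+)
  show ?thesis
  proof (rule local_lower_bound[OF v(1-3), of "D + 1"])
  fix A c :: real and n1 :: nat
  assume A: "A > 0" "c > 0"
    "\<And>Q n \<xi> v \<psi>. real_distribution Q \<Longrightarrow> n \<ge> n1 \<Longrightarrow> v0 \<le> v \<Longrightarrow> v \<le> v1
      \<Longrightarrow> (\<And>t. cmod (\<psi> t - complex_of_real (1 - v * t\<^sup>2 / 2)) \<le> \<rho> * \<bar>t\<bar> ^ 3)
      \<Longrightarrow> (\<And>t. char Q t = \<psi> t ^ n) \<Longrightarrow> \<bar>\<xi>\<bar> \<le> (D + 1) * sqrt n
      \<Longrightarrow> measure Q {\<xi> - A..\<xi> + A} \<ge> c / sqrt n"
  obtain n2 :: nat where n2: "real n2 \<ge> (A + 1)\<^sup>2" using real_arch_simple by blast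
  show ?thesis
  proof (rule that[of "c * exp (- (ur * (2 * A + 1)))" "max n1 (max n2 1)"])
    show "c * exp (- (ur * (2 * A + 1))) > 0" using A by auto
    fix u x :: real and k n :: nat
    assume u: "u \<in> {ul..ur}" and n: "n \<ge> max n1 (max n2 1)" and x: "\<bar>x - n * mW u\<bar> \<le> D * sqrt n"
    have up: "u > 0" using u ul by auto
    define Q where "Q = (\<lambda>m. m = n)"
    define w where "w \<omega> = of_bool (Q (Z k \<omega>)) * exp (- (u * (a ^ k * W \<omega>)))" for \<omega>
    have wm[measurable]: "w \<in> borel_measurable M" unfolding w_def[abs_def] by measurable
    have w0: "w \<omega> \<ge> 0" for \<omega> by (simp add: w_def)
    have iw: "integrable M w" unfolding w_def[abs_def] by (rule integrable_weighted_event[OF up])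
    define e where "e = expectation w"
    have e_eq: "e = expectation (\<lambda>\<omega>. of_bool (Q (Z k \<omega>)) * phi u ^ Z k \<omega>)"
      unfolding e_def w_def by (rule laplace_branching_event[OF order_refl up])
    define pr :: real where "pr = expectation (\<lambda>\<omega>. of_bool (Q (Z k \<omega>)))"
    have e_pr: "e = pr * phi u ^ n"
    proof -
      have "(\<lambda>\<omega>. of_bool (Q (Z k \<omega>)) * phi u ^ Z k \<omega>) = (\<lambda>\<omega>. of_bool (Q (Z k \<omega>)) * phi u ^ n)" by (auto simp: Q_def)
      then show ?thesis unfolding e_eq pr_def by (simp only: integral_mult_left_zero)
    qed
    have e0: "e \<ge> 0" unfolding e_def using w0 by (intro integral_nonneg_AE) auto
    show "c * exp (- (ur * (2 * A + 1))) * exp (u * x) / sqrt n * expectation (\<lambda>\<omega>. of_bool (Z k \<omega> = n) * phi u ^ Z k \<omega>)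
      \<le> expectation (\<lambda>\<omega>. of_bool (Z k \<omega> = n) * of_bool (a ^ k * W \<omega> < x))"
    proof (cases "e = 0")
      case True
      then show ?thesis unfolding e_eq Q_def by (auto intro!: integral_nonneg_AE)
    next
      case False
      then have ep: "e > 0" using e0 by simp
      then have prp: "pr > 0" using e_pr phi_pos[OF up] by (simp add: zero_less_mult_iff)
      define Y where "Y \<omega> = a ^ k * W \<omega> - n * mW u" for \<omega>
      have Ym[measurable]: "Y \<in> borel_measurable M" unfolding Y_def by measurable
      define R where "R = distr (density M (\<lambda>\<omega>. ennreal (w \<omega> / e))) borel Y"
      note law = weighted_law[of w e Y, folded R_def, OF wm w0 iw e_def[symmetric] ep Ym]
      have ch: "char R t = psi u t ^ n" for t
      proof -
        have "char R t = expectation (\<lambda>\<omega>. complex_of_real (w \<omega>) * iexp (t * Y \<omega>)) / complex_of_real e"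
          unfolding char_def by (rule law) auto
        also have "expectation (\<lambda>\<omega>. complex_of_real (w \<omega>) * iexp (t * Y \<omega>))
            = expectation (\<lambda>\<omega>. of_bool (Q (Z k \<omega>)) * cphi (complex_of_real u - \<i> * t) ^ Z k \<omega>) * iexp (- t * (n * mW u))"
          unfolding w_def Y_def by (rule char_weighted_event[OF order_refl up])
        also have "expectation (\<lambda>\<omega>. of_bool (Q (Z k \<omega>)) * cphi (complex_of_real u - \<i> * t) ^ Z k \<omega>)
            = complex_of_real pr * cphi (complex_of_real u - \<i> * t) ^ n"
        proof -
          have "(\<lambda>\<omega>. of_bool (Q (Z k \<omega>)) * cphi (complex_of_real u - \<i> * t) ^ Z k \<omega>)
            = (\<lambda>\<omega>. complex_of_real (of_bool (Q (Z k \<omega>))) * cphi (complex_of_real u - \<i> * t) ^ n)" by (auto simp: Q_def)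
          then show ?thesis unfolding pr_def by (simp only: integral_mult_left_zero integral_complex_of_real)
        qed
        also have "complex_of_real pr * cphi (complex_of_real u - \<i> * t) ^ n * iexp (- t * (n * mW u)) / complex_of_real e = psi u t ^ n"
        proof -
          have "iexp (- t * (n * mW u)) = iexp (- t * mW u) ^ n"
            by (simp add: exp_of_nat_mult[symmetric] mult_ac)
          then show ?thesis using prp phi_pos[OF up]
            by (simp add: psi_def power_mult_distrib power_divide e_pr)
        qed
        finally show ?thesis .
      qed
      \<comment> \<open>The window of half-width A around \<xi> corresponds to values of a^k W
        between x - (2A + 1) and x - 1: it lies below x, and the tilting weight there costs at most
        the factor exp (u (2A + 1)). The shift by A + 1 is at most sqrt n, hence the constant D + 1
        above.\<close>
      define \<xi> where "\<xi> = x - n * mW u - (A + 1)"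
      have sn: "A + 1 \<le> sqrt n"
      proof (rule real_le_rsqrt)
        show "(A + 1)\<^sup>2 \<le> real n" using n2 n by linarith
      qed
      have "\<bar>\<xi>\<bar> \<le> \<bar>x - n * mW u\<bar> + (A + 1)" unfolding \<xi>_def using A by linarith
      also have "\<dots> \<le> (D + 1) * sqrt n" using x sn by (simp add: algebra_simps)
      finally have \<xi>: "\<bar>\<xi>\<bar> \<le> (D + 1) * sqrt n" .
      have "c / sqrt n \<le> measure R {\<xi> - A..\<xi> + A}"
        by (rule A(3)[OF law(1), of _ "vW u" "psi u"]) (use n v(4,5) u ch \<xi> in auto)
      also have "\<dots> = expectation (\<lambda>\<omega>. w \<omega> * indicator {\<xi> - A..\<xi> + A} (Y \<omega>)) / e"
        by (rule law(5)) auto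
      finally have 1: "c / sqrt n * e \<le> expectation (\<lambda>\<omega>. w \<omega> * indicator {\<xi> - A..\<xi> + A} (Y \<omega>))"
        using ep by (simp only: pos_le_divide_eq)
      have "exp (u * x - u * (2 * A + 1)) * (c / sqrt n * e) \<le> exp (u * x - u * (2 * A + 1)) * expectation (\<lambda>\<omega>. w \<omega> * indicator {\<xi> - A..\<xi> + A} (Y \<omega>))"
        using 1 by (intro mult_left_mono) auto
      also have "\<dots> = expectation (\<lambda>\<omega>. exp (u * x - u * (2 * A + 1)) * (w \<omega> * indicator {\<xi> - A..\<xi> + A} (Y \<omega>)))" by simp
      also have "\<dots> \<le> expectation (\<lambda>\<omega>. of_bool (Z k \<omega> = n) * of_bool (a ^ k * W \<omega> < x))"
      proof (rule integral_mono')
        show "integrable M (\<lambda>\<omega>. of_bool (Z k \<omega> = n) * of_bool (a ^ k * W \<omega> < x) :: real)"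
          by (rule integrable_const_bound[where B = 1]) auto
        fix \<omega>
        show "exp (u * x - u * (2 * A + 1)) * (w \<omega> * indicator {\<xi> - A..\<xi> + A} (Y \<omega>)) \<le> of_bool (Z k \<omega> = n) * of_bool (a ^ k * W \<omega> < x)"
        proof (cases "Z k \<omega> = n \<and> Y \<omega> \<in> {\<xi> - A..\<xi> + A}")
          case True
          then have b: "a ^ k * W \<omega> \<le> x - 1" "x - (2 * A + 1) \<le> a ^ k * W \<omega>" by (auto simp: Y_def \<xi>_def)
          have "u * (x - (2 * A + 1)) \<le> u * (a ^ k * W \<omega>)" using b up by (intro mult_left_mono) auto
          then have "exp (u * x - u * (2 * A + 1)) * exp (- (u * (a ^ k * W \<omega>))) \<le> 1"
            unfolding exp_add[symmetric] by (simp add: right_diff_distrib)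
          then show ?thesis using True b by (simp add: w_def Q_def)
        qed (auto simp: w_def Q_def)
      qed simp
      finally have 2: "exp (u * x - u * (2 * A + 1)) * (c / sqrt n * e) \<le> expectation (\<lambda>\<omega>. of_bool (Z k \<omega> = n) * of_bool (a ^ k * W \<omega> < x))" .
      have "c * exp (- (ur * (2 * A + 1))) * exp (u * x) / sqrt n * e \<le> exp (u * x - u * (2 * A + 1)) * (c / sqrt n * e)"
      proof -
        have "u * (2 * A + 1) \<le> ur * (2 * A + 1)" using u A by (intro mult_right_mono) auto
        then have "exp (- (ur * (2 * A + 1))) * exp (u * x) \<le> exp (u * x - u * (2 * A + 1))"
          unfolding exp_add[symmetric] by simp
        then have "exp (- (ur * (2 * A + 1))) * exp (u * x) * (c / sqrt n * e) \<le> exp (u * x - u * (2 * A + 1)) * (c / sqrt n * e)"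
          using A ep by (intro mult_right_mono) auto
        then show ?thesis by (simp add: mult_ac)
      qed
      with 2 show ?thesis unfolding e_eq Q_def by linarith
    qed
  qed
  qed
qed

text \<open>Under the tilt by \<open>phi u\<close> the size of generation k has mean
  \<open>Mm k (om u)\<close> and variance of order \<mu>^k, so by Chebyshev's inequality the sizes
  in \<open>J\<close> carry at least half of the tilted mass. For these n the threshold \<mu>^k
  \<open>yf u\<close> differs from the tilted mean n \<open>mW u\<close> by a multiple of sqrt n at
  most, and \<open>generation_local_lower\<close> can be summed over \<open>J\<close>.\<close>

lemma lower_estimate:
  assumes ul: "0 < ul" "ul \<le> ur"
  obtains c k0 where "c > 0"
    "\<And>u k. u \<in> {ul..ur} \<Longrightarrow> k \<ge> (k0::nat) \<Longrightarrow>
      expectation (\<lambda>\<omega>. of_bool (a ^ k * W \<omega> < real mu ^ k * yf u))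
       \<ge> c * exp (u * (real mu ^ k * yf u)) / sqrt (real mu ^ k) * expectation (\<lambda>\<omega>. phi u ^ Z k \<omega>)"
proof -
  define z0 where "z0 = om ul"
  have z0: "z0 > 0" unfolding z0_def by (rule om_pos[OF ul(1)])
  obtain C where C: "C > 0" "\<And>z m. z \<ge> z0 \<Longrightarrow> \<bar>Pf z - Pm m z\<bar> \<le> C * exp (- Lm m z)"
    "\<And>z m. z \<ge> z0 \<Longrightarrow> Pm m z \<le> C"
    by (rule Pf_error[OF z0]) (rule that, assumption+)
  obtain V where V: "V > 0" "\<And>z m. z \<ge> z0 \<Longrightarrow> Vm m z \<le> V * real mu ^ m"
    by (rule Vm_le[OF z0]) (rule that, assumption+)
  define D1 where "D1 = sqrt (2 * V)"
  have D1: "D1 > 0" using V by (simp add: D1_def)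
  define m1 where "m1 = mW ul"
  have m1: "m1 > 0" unfolding m1_def by (rule mW_pos[OF ul(1)])
  \<comment> \<open>The first part is the cost of replacing \<open>Pm\<close> by its limit
    \<open>Pf\<close>, which stays bounded after multiplication by \<mu>^k; the second comes from
    the fluctuation of the generation size.\<close>
  define D where "D = m1 * (C / z0) + m1 * D1"
  obtain c n0 where A: "c > 0"
    "\<And>u k n x. u \<in> {ul..ur} \<Longrightarrow> n \<ge> (n0::nat) \<Longrightarrow> \<bar>x - n * mW u\<bar> \<le> D * sqrt n \<Longrightarrow>
      expectation (\<lambda>\<omega>. of_bool (Z k \<omega> = n) * of_bool (a ^ k * W \<omega> < x))
       \<ge> c * exp (u * x) / sqrt n * expectation (\<lambda>\<omega>. of_bool (Z k \<omega> = n) * phi u ^ Z k \<omega>)"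
    by (rule generation_local_lower[OF ul, of D]) (rule that, assumption+)
  define C3 where "C3 = C + D1"
  show ?thesis
  proof (rule that[of "c / sqrt C3 / 2" n0])
    show "c / sqrt C3 / 2 > 0" using A C D1 by (simp add: C3_def)
    fix u :: real and k :: nat assume u: "u \<in> {ul..ur}" and k: "k \<ge> n0"
    have up: "u > 0" using u ul by auto
    define N where "N = real mu ^ k"
    have N1: "N \<ge> 1" unfolding N_def using mu_pos by (intro one_le_power) simp
    then have sN: "sqrt N \<ge> 1" "sqrt N \<le> N" by (auto intro!: real_le_lsqrt simp: power2_eq_square)
    define z where "z = om u"
    have z: "z \<ge> z0" "z > 0" using om_mono[of ul u] u ul om_pos[OF up] by (auto simp: z_def z0_def)
    define x where "x = N * yf u"
    define Mk where "Mk = Mm k z"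
    have Mk: "Mk = N * Pm k z" using mu_pos by (simp add: Mk_def Pm_def N_def)
    define J where "J = {n. mu ^ k \<le> n \<and> \<bar>real n - Mk\<bar> \<le> D1 * sqrt N}"
    have Jup: "real n \<le> C3 * N" if "n \<in> J" for n
    proof -
      have "real n \<le> Mk + D1 * sqrt N" using that by (auto simp: J_def)
      also have "\<dots> \<le> N * C + D1 * N" unfolding Mk using C(3)[OF z(1), of k] N1 sN D1 by (intro add_mono mult_left_mono) auto
      finally show ?thesis by (simp add: C3_def algebra_simps)
    qed
    have finJ: "finite J"
    proof -
      obtain m :: nat where "C3 * N \<le> real m" using real_arch_simple by blast
      then have "J \<subseteq> {..m}" using Jup by (metis atMost_iff of_nat_le_iff order_trans subsetI)
      then show ?thesis by (rule finite_subset) simp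
    qed
    have mu_u: "0 < mW u" "mW u \<le> m1"
      using mW_pos[OF up] mW_strict[of ul u] u ul by (auto simp: m1_def less_eq_real_def)
    have kn: "k \<le> mu ^ k"
    proof -
      have "real (Suc k) \<le> real (mu ^ k)" using Suc_le_mu_power[of k] by simp
      then show ?thesis by linarith
    qed
    have xn: "\<bar>x - n * mW u\<bar> \<le> D * sqrt n" "n \<ge> n0" if n: "n \<in> J" for n
    proof -
      have nN: "N \<le> real n" using n by (auto simp: J_def N_def)
      have "mu ^ k \<le> n" using n by (simp add: J_def)
      then show "n \<ge> n0" using k kn by linarith
      have sn: "sqrt N \<le> sqrt n" "1 \<le> sqrt n" using nN N1 by auto
      have "x - n * mW u = mW u * (N * (Pf z - Pm k z)) + mW u * (Mk - n)"
        unfolding x_def yf_def Mk z_def by (simp add: algebra_simps)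
      then have "\<bar>x - n * mW u\<bar> \<le> mW u * \<bar>N * (Pf z - Pm k z)\<bar> + mW u * \<bar>real n - Mk\<bar>"
        using mu_u by (metis abs_minus_commute abs_mult abs_of_pos abs_triangle_ineq)
      also have "\<dots> \<le> m1 * (C / z0) + m1 * (D1 * sqrt N)"
      proof (intro add_mono mult_mono)
        have "\<bar>N * (Pf z - Pm k z)\<bar> = N * \<bar>Pf z - Pm k z\<bar>" using N1 by (simp add: abs_mult)
        also have "\<dots> \<le> N * (C * exp (- Lm k z))" using C(2)[OF z(1), of k] N1 by (intro mult_left_mono) auto
        also have "\<dots> \<le> N * (C * exp (- (N * z0)))"
        proof -
          have "N * z0 \<le> N * z" using z N1 by (intro mult_left_mono) auto
          also have "\<dots> \<le> Lm k z" unfolding N_def by (rule Lm_ge[OF z(2)])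
          finally show ?thesis using N1 C by (intro mult_left_mono) auto
        qed
        also have "\<dots> = C / z0 * (N * z0 * exp (- (N * z0)))" using z0 by simp
        also have "\<dots> \<le> C / z0 * 1" using C z0 mult_exp_minus_le[of "N * z0"] by (intro mult_left_mono) auto
        finally show "\<bar>N * (Pf z - Pm k z)\<bar> \<le> C / z0" by simp
        show "\<bar>real n - Mk\<bar> \<le> D1 * sqrt N" using n by (simp add: J_def)
      qed (use mu_u m1 in auto)
      also have "\<dots> \<le> m1 * (C / z0) * sqrt n + m1 * (D1 * sqrt n)"
      proof (intro add_mono mult_left_mono)
        show "m1 * (C / z0) \<le> m1 * (C / z0) * sqrt n"
          using mult_left_mono[OF sn(2), of "m1 * (C / z0)"] m1 C z0 by simp
      qed (use sn m1 D1 in auto)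
      also have "\<dots> = D * sqrt n" by (simp add: D_def algebra_simps)
      finally show "\<bar>x - n * mW u\<bar> \<le> D * sqrt n" .
    qed
    have phi01: "0 < phi u" "phi u \<le> 1" using phi_pos[OF up] phi_less_1[OF up] by auto
    have intb: "integrable M (\<lambda>\<omega>. of_bool (R \<omega>) * phi u ^ Z k \<omega>)" if "Measurable.pred M R" for R
      using phi01 that by (intro integrable_const_bound[where B = 1]) (auto intro!: mult_le_one power_le_one)
    have half: "(\<Sum>n\<in>J. expectation (\<lambda>\<omega>. of_bool (Z k \<omega> = n) * phi u ^ Z k \<omega>)) \<ge> expectation (\<lambda>\<omega>. phi u ^ Z k \<omega>) / 2"
    proof -
      have pe: "phi u ^ Z k \<omega> = exp (- z * real (Z k \<omega>))" for \<omega>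
        unfolding z_def exp_om[OF up, symmetric] by (simp add: exp_of_nat_mult[symmetric] mult.commute)
      have "lap M (\<lambda>\<omega>. real (Z k \<omega>)) 0 z / 2 \<le> expectation (\<lambda>\<omega>. exp (- z * real (Z k \<omega>)) * indicator {\<omega>. \<bar>real (Z k \<omega>) - tmean M (\<lambda>\<omega>. real (Z k \<omega>)) z\<bar> \<le> D1 * sqrt N} \<omega>)"
      proof (rule Zrv.tilted_chebyshev[OF z(2)])
        show "D1 * sqrt N > 0" using D1 N1 by simp
        have "2 * tvar M (\<lambda>\<omega>. real (Z k \<omega>)) z \<le> 2 * V * N" unfolding tvar_Z[OF z(2)] using V(2)[OF z(1), of k] by (simp add: N_def)
        also have "\<dots> = (D1 * sqrt N)\<^sup>2" using V N1 by (simp add: D1_def power_mult_distrib)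
        finally show "2 * tvar M (\<lambda>\<omega>. real (Z k \<omega>)) z \<le> (D1 * sqrt N)\<^sup>2" .
      qed
      also have "\<dots> \<le> expectation (\<lambda>\<omega>. of_bool (Z k \<omega> \<in> J) * phi u ^ Z k \<omega>)"
      proof (rule integral_mono_AE')
        show "integrable M (\<lambda>\<omega>. of_bool (Z k \<omega> \<in> J) * phi u ^ Z k \<omega>)" by (rule intb) measurable
        show "AE \<omega> in M. exp (- z * real (Z k \<omega>)) * indicator {\<omega>. \<bar>real (Z k \<omega>) - tmean M (\<lambda>\<omega>. real (Z k \<omega>)) z\<bar> \<le> D1 * sqrt N} \<omega>
           \<le> of_bool (Z k \<omega> \<in> J) * phi u ^ Z k \<omega>"
          using AE_Z_ge[of k] by eventually_elim (auto simp: pe J_def tmean_Z[OF z(2)] Mk_def indicator_def)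
      qed (use phi01 in auto)
      also have "\<dots> = expectation (\<lambda>\<omega>. \<Sum>n\<in>J. of_bool (Z k \<omega> = n) * phi u ^ Z k \<omega>)"
      proof (rule Bochner_Integration.integral_cong[OF refl])
        fix \<omega>
        show "of_bool (Z k \<omega> \<in> J) * phi u ^ Z k \<omega> = (\<Sum>n\<in>J. of_bool (Z k \<omega> = n) * phi u ^ Z k \<omega>)"
          unfolding sum_distrib_right[symmetric] of_bool_def using finJ by (simp add: sum.delta')
      qed
      also have "\<dots> = (\<Sum>n\<in>J. expectation (\<lambda>\<omega>. of_bool (Z k \<omega> = n) * phi u ^ Z k \<omega>))"
        by (rule Bochner_Integration.integral_sum) (rule intb, measurable)
      finally show ?thesis by (simp add: lap_def pe)
    qed
    have "c / sqrt C3 / 2 * exp (u * x) / sqrt N * expectation (\<lambda>\<omega>. phi u ^ Z k \<omega>)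
       = c * exp (u * x) / (sqrt C3 * sqrt N) * (expectation (\<lambda>\<omega>. phi u ^ Z k \<omega>) / 2)"
      by simp
    also have "\<dots> \<le> c * exp (u * x) / (sqrt C3 * sqrt N) * (\<Sum>n\<in>J. expectation (\<lambda>\<omega>. of_bool (Z k \<omega> = n) * phi u ^ Z k \<omega>))"
      using half A C D1 N1 by (intro mult_left_mono) (auto simp: C3_def)
    also have "\<dots> = (\<Sum>n\<in>J. c * exp (u * x) / (sqrt C3 * sqrt N) * expectation (\<lambda>\<omega>. of_bool (Z k \<omega> = n) * phi u ^ Z k \<omega>))"
      by (rule sum_distrib_left)
    also have "\<dots> \<le> (\<Sum>n\<in>J. expectation (\<lambda>\<omega>. of_bool (Z k \<omega> = n) * of_bool (a ^ k * W \<omega> < x)))"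
    proof (rule sum_mono)
      fix n assume n: "n \<in> J"
      have "N \<le> real n" using n by (auto simp: J_def N_def)
      then have n1: "1 \<le> real n" using N1 by linarith
      have "sqrt n \<le> sqrt (C3 * N)" using Jup[OF n] by simp
      then have "c * exp (u * x) / (sqrt C3 * sqrt N) \<le> c * exp (u * x) / sqrt n"
        using A n1 C D1 N1 by (intro divide_left_mono mult_pos_pos) (auto simp: real_sqrt_mult C3_def)
      moreover have "0 \<le> expectation (\<lambda>\<omega>. of_bool (Z k \<omega> = n) * phi u ^ Z k \<omega>)"
        using phi01 by (intro integral_nonneg_AE) auto
      ultimately have "c * exp (u * x) / (sqrt C3 * sqrt N) * expectation (\<lambda>\<omega>. of_bool (Z k \<omega> = n) * phi u ^ Z k \<omega>)
        \<le> c * exp (u * x) / sqrt n * expectation (\<lambda>\<omega>. of_bool (Z k \<omega> = n) * phi u ^ Z k \<omega>)"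
        by (rule mult_right_mono)
      also have "\<dots> \<le> expectation (\<lambda>\<omega>. of_bool (Z k \<omega> = n) * of_bool (a ^ k * W \<omega> < x))"
        by (rule A(2)[OF u xn(2)[OF n] xn(1)[OF n]])
      finally show "c * exp (u * x) / (sqrt C3 * sqrt N) * expectation (\<lambda>\<omega>. of_bool (Z k \<omega> = n) * phi u ^ Z k \<omega>)
         \<le> expectation (\<lambda>\<omega>. of_bool (Z k \<omega> = n) * of_bool (a ^ k * W \<omega> < x))" .
    qed
    also have "\<dots> = expectation (\<lambda>\<omega>. \<Sum>n\<in>J. of_bool (Z k \<omega> = n) * of_bool (a ^ k * W \<omega> < x))"
      by (rule Bochner_Integration.integral_sum[symmetric], rule integrable_const_bound[where B = 1]) auto
    also have "\<dots> \<le> expectation (\<lambda>\<omega>. of_bool (a ^ k * W \<omega> < x))"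
    proof (rule integral_mono')
      show "integrable M (\<lambda>\<omega>. of_bool (a ^ k * W \<omega> < x) :: real)"
        by (rule integrable_const_bound[where B = 1]) auto
      fix \<omega>
      show "(\<Sum>n\<in>J. of_bool (Z k \<omega> = n) * of_bool (a ^ k * W \<omega> < x)) \<le> (of_bool (a ^ k * W \<omega> < x) :: real)"
        unfolding sum_distrib_right[symmetric] of_bool_def using finJ by (simp add: sum.delta')
    qed simp
    finally show "c / sqrt C3 / 2 * exp (u * (real mu ^ k * yf u)) / sqrt (real mu ^ k) * expectation (\<lambda>\<omega>. phi u ^ Z k \<omega>)
      \<le> expectation (\<lambda>\<omega>. of_bool (a ^ k * W \<omega> < real mu ^ k * yf u))"
      unfolding N_def x_def .
  qed
qed

end

section \<open>The first generation exceeding the minimal size\<close>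

context galton_watson
begin

section \<open>Identification of the defined quantities with their analytic counterparts\<close>

lemma gw_laplace_eq: "gw_laplace M p X z = phi z"
  by (simp add: gw_laplace_def phi_def lap_def)

lemma log_boettcher_phi: assumes z: "z > 0" shows "log_boettcher p (phi z) = - Bf z"
proof -
  have "(\<lambda>m. - (Lm m (om z) / real mu ^ m)) \<longlonglongrightarrow> - bt (om z)"
    by (intro tendsto_minus bt_tendsto om_pos z)
  moreover have "ln ((off_pgf p ^^ m) (phi z)) / real (off_min p) ^ m = - (Lm m (om z) / real mu ^ m)" for m
    using off_pgf_iterate[OF om_pos[OF z], of m] exp_om[OF z] by (simp add: mu_def)
  ultimately show ?thesis unfolding log_boettcher_def Bf_def by (simp add: limI)
qed

lemma deriv_log_boettcher: assumes z: "z > 0" shows "deriv (log_boettcher p \<circ> gw_laplace M p X) z = - yf z"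
proof (rule DERIV_imp_deriv)
  show "((log_boettcher p \<circ> gw_laplace M p X) has_real_derivative - yf z) (at z)"
    by (rule has_field_derivative_transform_within_open[OF DERIV_minus[OF DERIV_Bf[OF z]], of "{0<..}"])
       (use z in \<open>auto simp: gw_laplace_eq log_boettcher_phi\<close>)
qed

text \<open>The saddle point as a function on the whole half line and not only on the fundamental
  interval of y, so that it obeys a scaling relation.\<close>

definition "Uf y = (THE u. u > 0 \<and> yf u = y)"

lemma Uf_pos: "y > 0 \<Longrightarrow> Uf y > 0" and yf_Uf: "y > 0 \<Longrightarrow> yf (Uf y) = y"
  using theI'[OF yf_solution, of y] unfolding Uf_def by auto

lemma Uf_yf: "u > 0 \<Longrightarrow> Uf (yf u) = u"
  unfolding Uf_def using yf_solution[OF yf_pos, of u] by (auto intro!: the1_equality)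

lemma gw_u1_eq: "gw_u1 M p X \<epsilon> = Uf (gw_y p \<epsilon>)"
  unfolding gw_u1_def Uf_def
  by (rule arg_cong[where f = The]) (auto simp: fun_eq_iff deriv_log_boettcher)

lemma Uf_antimono: assumes "0 < x" "x \<le> y" shows "Uf y \<le> Uf x"
proof (rule ccontr)
  assume "\<not> Uf y \<le> Uf x"
  then have "yf (Uf y) < yf (Uf x)" using assms by (intro yf_strict Uf_pos) auto
  then show False using assms by (simp add: yf_Uf)
qed

lemma Uf_scale: assumes y: "y > 0" shows "Uf ((mu / a) ^ n * y) = a ^ n * Uf y"
proof -
  have "yf (a ^ n * Uf y) = (mu / a) ^ n * y" using yf_scale[OF Uf_pos[OF y]] yf_Uf[OF y] by simp
  then show ?thesis using Uf_yf[of "a ^ n * Uf y"] Uf_pos[OF y] a_gt_1 by simp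
qed

lemma isCont_Uf: assumes y: "y > 0" shows "isCont Uf y"
proof -
  have up: "Uf y > 0" by (rule Uf_pos[OF y])
  have pos: "z > 0" if "\<bar>z - Uf y\<bar> \<le> Uf y / 2" for z
    using that up by arith
  have "isCont Uf (yf (Uf y))"
    by (rule isCont_inverse_function[where f = yf and g = Uf and x = "Uf y" and d = "Uf y / 2"])
       (use up pos in \<open>auto intro!: Uf_yf isCont_yf\<close>)
  then show ?thesis by (simp add: yf_Uf[OF y])
qed

section \<open>Periodicity and continuity of H\<close>

definition "al = gw_alpha p"

lemma al_eq: "al = ln mu / ln (a / mu)" and al_pos: "al > 0"
proof -
  have la: "ln a > ln mu" "ln mu > 0" using mean_gt_mu mu_pos by auto
  have "al = (ln mu / ln a) / (1 - ln mu / ln a)"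
    unfolding al_def gw_alpha_def gw_beta_def mu_def a_def ..
  also have "\<dots> = ln mu / (ln a - ln mu)" using la by (simp add: field_simps)
  also have "ln a - ln mu = ln (a / mu)" using a_gt_1 mu_pos by (simp add: ln_div)
  finally show "al = ln mu / ln (a / mu)" .
  then show "al > 0" using a_gt_1 mu_pos by simp
qed

lemma mu_a_powr_al: "(mu / a) powr al = 1 / mu"
proof -
  have "ln (a / mu) > 0" using a_gt_1 by simp
  then have "al * ln (mu / a) = - ln mu" using a_gt_1 mu_pos by (simp add: al_eq ln_div field_simps)
  then show ?thesis using a_gt_1 mu_pos by (simp add: powr_def exp_minus inverse_eq_divide)
qed

text \<open>The formula for \<open>H\<close> with \<open>\<epsilon>\<close> in place of \<open>y(\<epsilon>)\<close>: it is invariant under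
  \<open>\<epsilon> \<mapsto> \<epsilon> a / \<mu>\<close>, so the reduction of \<open>\<epsilon>\<close> to a fundamental interval is immaterial.\<close>

definition "Ht \<epsilon> = 1 / ln mu * ln (Bf (Uf \<epsilon>) * \<epsilon> powr al * (real la - real mu) / al)"

text \<open>Multiplying \<epsilon> by a/\<mu> divides \<open>Uf \<epsilon>\<close> by a and hence
  \<open>Bf (Uf \<epsilon>)\<close> by \<mu>, while \<open>\<epsilon> powr al\<close> gains the
  factor \<mu>.\<close>

lemma Ht_period: assumes e: "\<epsilon> > 0" shows "Ht (\<epsilon> * (a / mu)) = Ht \<epsilon>"
proof -
  define \<delta> where "\<delta> = \<epsilon> * (a / mu)"
  have d: "\<delta> > 0" "\<epsilon> = (mu / a) ^ 1 * \<delta>" using e a_gt_1 mu_pos by (auto simp: \<delta>_def)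
  have "Bf (Uf \<epsilon>) = mu * Bf (Uf \<delta>)"
    using Uf_scale[OF d(1), of 1] Bf_scale[OF Uf_pos[OF d(1)], of 1] d(2) by simp
  moreover have "\<epsilon> powr al = \<delta> powr al / mu"
  proof -
    have "\<epsilon> powr al = (mu / a) powr al * \<delta> powr al"
      unfolding d(2) using d a_gt_1 mu_pos by (subst powr_mult[symmetric]) auto
    then show ?thesis by (simp add: mu_a_powr_al)
  qed
  ultimately show ?thesis unfolding Ht_def \<delta>_def[symmetric] using mu_pos by simp
qed

lemma Ht_power: "\<epsilon> > 0 \<Longrightarrow> Ht (\<epsilon> * (a / mu) ^ n) = Ht \<epsilon>"
proof (induction n)
  case (Suc n)
  have "Ht (\<epsilon> * (a / mu) ^ n * (a / mu)) = Ht (\<epsilon> * (a / mu) ^ n)"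
    using Suc.prems a_gt_1 mu_pos by (intro Ht_period) simp
  then show ?case using Suc by (simp add: mult_ac)
qed simp

text \<open>Integer exponents are required because \<kappa>(\<epsilon>) is negative for large
  \<epsilon>, and the properties of H are claimed on the whole half line.\<close>

lemma Ht_powi: assumes e: "\<epsilon> > 0" shows "Ht (\<epsilon> * (a / mu) powi i) = Ht \<epsilon>"
proof (cases "i \<ge> 0")
  case True
  then show ?thesis using Ht_power[OF e, of "nat i"] by (simp add: power_int_def)
next
  case False
  define q where "q = a / mu"
  have q: "q > 0" using a_gt_1 mu_pos by (simp add: q_def)
  have "q powi i = inverse q ^ nat (- i)" using False by (simp add: power_int_def)
  then have eq: "\<epsilon> * q powi i * q ^ nat (- i) = \<epsilon>" using q by (simp add: power_inverse)
  have "\<epsilon> * q powi i > 0" using e q by simp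
  from Ht_power[OF this, of "nat (- i)", folded q_def, unfolded eq]
  show ?thesis unfolding q_def by simp
qed

lemma gw_y_eq: "gw_y p \<epsilon> = \<epsilon> * (a / mu) powi gw_kappa p \<epsilon>"
  unfolding gw_y_def mu_def a_def ..

lemma gw_H_eq: assumes e: "\<epsilon> > 0" shows "gw_H M p X \<epsilon> = Ht \<epsilon>"
proof -
  have y: "gw_y p \<epsilon> > 0" unfolding gw_y_eq using e a_gt_1 mu_pos by simp
  have "gw_H M p X \<epsilon> = Ht (gw_y p \<epsilon>)"
    unfolding gw_H_def gw_u1_eq gw_laplace_eq log_boettcher_phi[OF Uf_pos[OF y]] Ht_def
    by (simp add: mu_def la_def al_def)
  then show ?thesis unfolding gw_y_eq Ht_powi[OF e] .
qed

lemma Bf_pos: "z > 0 \<Longrightarrow> Bf z > 0"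
  unfolding Bf_def using bt_bounds(1)[OF om_pos[of z]] om_pos[of z] by auto

lemma isCont_Ht: assumes e: "\<epsilon> > 0" shows "isCont Ht \<epsilon>"
proof -
  have "isCont (\<lambda>\<epsilon>. Bf (Uf \<epsilon>)) \<epsilon>"
    by (rule isCont_o2[OF isCont_Uf[OF e] DERIV_isCont[OF DERIV_Bf[OF Uf_pos[OF e]]]])
  moreover have "Bf (Uf \<epsilon>) * \<epsilon> powr al * (real la - real mu) / al > 0"
    using Bf_pos[OF Uf_pos[OF e]] e la_properties(1) al_pos by simp
  ultimately show ?thesis
    unfolding Ht_def using mu_pos e al_pos by (intro continuous_intros) auto
qed

lemma continuous_on_gw_H: "continuous_on {0<..} (gw_H M p X)"
proof -
  have "continuous_on {0<..} Ht" by (intro continuous_at_imp_continuous_on) (auto intro: isCont_Ht)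
  then show ?thesis by (rule continuous_on_cong[THEN iffD1, rotated 2]) (auto simp: gw_H_eq)
qed

lemma gw_H_period: "\<epsilon> > 0 \<Longrightarrow> gw_H M p X (\<epsilon> * off_mean p / real (off_min p)) = gw_H M p X \<epsilon>"
  using Ht_period[of \<epsilon>] gw_H_eq[of \<epsilon>] gw_H_eq[of "\<epsilon> * (a / mu)"] a_gt_1 mu_pos
  by (simp add: mu_def a_def)

section \<open>Conditional probability of minimal growth up to a given generation\<close>

definition "kap \<epsilon> = nat \<lfloor>ln (1 / \<epsilon>) / ln (a / mu)\<rfloor>"

lemma kap_properties:
  assumes e: "0 < \<epsilon>" "\<epsilon> < 1"
  shows "ln (1 / \<epsilon>) / ln (a / mu) - 1 \<le> kap \<epsilon>" "mu / a \<le> \<epsilon> * (a / mu) ^ kap \<epsilon>" "\<epsilon> * (a / mu) ^ kap \<epsilon> \<le> 1"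
proof -
  define l where "l = ln (a / mu)"
  have l: "l > 0" using a_gt_1 by (simp add: l_def)
  have L: "ln (1 / \<epsilon>) > 0" using e by simp
  define k where "k = kap \<epsilon>"
  have k0: "real k = \<lfloor>ln (1 / \<epsilon>) / l\<rfloor>"
    unfolding k_def kap_def l_def[symmetric] using L l by simp
  have k: "real k \<le> ln (1 / \<epsilon>) / l" "ln (1 / \<epsilon>) / l < real k + 1" unfolding k0 by linarith+
  then show "ln (1 / \<epsilon>) / ln (a / mu) - 1 \<le> kap \<epsilon>" by (simp add: l_def k_def)
  have y: "\<epsilon> * (a / mu) ^ k = exp (- ln (1 / \<epsilon>) + k * l)"
  proof -
    have "exp l = a / mu" using a_gt_1 by (simp add: l_def)
    then show ?thesis using e by (simp add: exp_add ln_div exp_of_nat_mult)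
  qed
  have "k * l \<le> ln (1 / \<epsilon>)" using k(1) l by (simp add: pos_le_divide_eq)
  then show "\<epsilon> * (a / mu) ^ kap \<epsilon> \<le> 1" using y by (simp add: k_def)
  have "ln (1 / \<epsilon>) \<le> k * l + l" using k(2) l by (simp add: pos_divide_less_eq algebra_simps)
  then have "- l \<le> - ln (1 / \<epsilon>) + k * l" by simp
  then have "exp (- l) \<le> \<epsilon> * (a / mu) ^ k" unfolding y by simp
  moreover have "exp (- l) = mu / a" using a_gt_1 mu_pos by (simp add: l_def exp_minus)
  ultimately show "mu / a \<le> \<epsilon> * (a / mu) ^ kap \<epsilon>" by (simp add: k_def)
qed

text \<open>The value is p_\<mu> to the power 1 + \<mu> + ... + \<mu>^(k-1). It is obtained by
  letting t tend to infinity in the expectation of exp (- t (Z k - \<mu>^k)), which selects the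
  minimal size; the closed form of this expectation contains \<open>Ggap k t\<close>, which vanishes
  in the limit.\<close>

lemma prob_Z_minimal: "expectation (\<lambda>\<omega>. of_bool (Z k \<omega> = mu ^ k)) = exp (- C0 * (\<Sum>i<k. real mu ^ i))"
proof -
  have "(\<lambda>n. expectation (\<lambda>\<omega>. exp (- (real (Suc n) * (real (Z k \<omega>) - real mu ^ k))))) \<longlonglongrightarrow> expectation (\<lambda>\<omega>. of_bool (Z k \<omega> = mu ^ k))"
  proof (rule integral_dominated_convergence[where w = "\<lambda>_. 1"])
    show "AE \<omega> in M. (\<lambda>n. exp (- (real (Suc n) * (real (Z k \<omega>) - real mu ^ k)))) \<longlonglongrightarrow> of_bool (Z k \<omega> = mu ^ k)"
      using AE_Z_ge[of k]
    proof eventually_elim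
      case (elim \<omega>)
      show ?case
      proof (cases "Z k \<omega> = mu ^ k")
        case False
        then have "mu ^ k < Z k \<omega>" using elim by simp
        then have "real (mu ^ k) < real (Z k \<omega>)" by (simp only: of_nat_less_iff)
        then have g: "exp (- (real (Z k \<omega>) - real mu ^ k)) < 1" by simp
        have "(\<lambda>n. exp (- (real (Z k \<omega>) - real mu ^ k)) ^ Suc n) \<longlonglongrightarrow> 0"
          by (intro LIMSEQ_Suc LIMSEQ_realpow_zero g) simp
        moreover have "exp (- (real (Z k \<omega>) - real mu ^ k)) ^ Suc n = exp (- (real (Suc n) * (real (Z k \<omega>) - real mu ^ k)))" for n
          unfolding exp_of_nat_mult[symmetric] by (simp add: algebra_simps)
        ultimately have "(\<lambda>n. exp (- (real (Suc n) * (real (Z k \<omega>) - real mu ^ k)))) \<longlonglongrightarrow> 0" by (simp only:)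
        then show ?thesis using False by simp
      qed simp
    qed
    show "AE \<omega> in M. norm (exp (- (real (Suc n) * (real (Z k \<omega>) - real mu ^ k)))) \<le> 1" for n
      using AE_Z_ge[of k]
    proof eventually_elim
      case (elim \<omega>)
      then have "real (mu ^ k) \<le> real (Z k \<omega>)" by (simp only: of_nat_le_iff)
      then have "0 \<le> real (Suc n) * (real (Z k \<omega>) - real mu ^ k)" by simp
      then show ?case by simp
    qed
  qed auto
  moreover have "expectation (\<lambda>\<omega>. exp (- (real (Suc n) * (real (Z k \<omega>) - real mu ^ k)))) = exp (Ggap k (real (Suc n)) - C0 * (\<Sum>i<k. real mu ^ i))" for n
  proof -
    have "exp (- (real (Suc n) * (real (Z k \<omega>) - real mu ^ k))) = exp (real mu ^ k * real (Suc n)) * exp (- (real (Suc n)) * real (Z k \<omega>))" for \<omega>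
      unfolding exp_add[symmetric] by (simp add: algebra_simps)
    then have "expectation (\<lambda>\<omega>. exp (- (real (Suc n) * (real (Z k \<omega>) - real mu ^ k)))) = exp (real mu ^ k * real (Suc n)) * lap M (\<lambda>\<omega>. real (Z k \<omega>)) 0 (real (Suc n))"
      unfolding lap_def by simp
    also have "\<dots> = exp (Ggap k (real (Suc n)) - C0 * (\<Sum>i<k. real mu ^ i))"
    proof -
      have "lap M (\<lambda>\<omega>. real (Z k \<omega>)) 0 (real (Suc n)) = exp (- Lm k (real (Suc n)))" by (rule lap_Z) simp
      then show ?thesis by (simp only: exp_add[symmetric] Ggap_def) simp
    qed
    finally show ?thesis .
  qed
  moreover have "(\<lambda>n. Ggap k (real (Suc n))) \<longlonglongrightarrow> 0"
  proof (rule real_tendsto_sandwich)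
    show "\<forall>\<^sub>F n in sequentially. 0 \<le> Ggap k (real (Suc n))"
      using Ggap_nonneg by simp
    show "\<forall>\<^sub>F n in sequentially. Ggap k (real (Suc n)) \<le> real mu ^ k / pmf p mu * exp (- (real la - mu)) ^ Suc n"
    proof (rule always_eventually, rule allI)
      fix n
      define E where "E = exp (- ((real la - mu) * real (Suc n))) / pmf p mu"
      have "E \<ge> 0" using pmf_mu_pos by (simp add: E_def)
      have "Ggap k (real (Suc n)) \<le> (real mu ^ k - 1) * E" unfolding E_def by (rule Ggap_upper) simp
      also have "\<dots> \<le> real mu ^ k * E" using \<open>E \<ge> 0\<close> by (intro mult_right_mono) auto
      also have "\<dots> = real mu ^ k / pmf p mu * exp (- (real la - mu)) ^ Suc n"
        unfolding E_def exp_of_nat_mult[symmetric] by (simp add: algebra_simps)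
      finally show "Ggap k (real (Suc n)) \<le> real mu ^ k / pmf p mu * exp (- (real la - mu)) ^ Suc n" .
    qed
    have "(\<lambda>n. real mu ^ k / pmf p mu * exp (- (real la - mu)) ^ Suc n) \<longlonglongrightarrow> real mu ^ k / pmf p mu * 0"
      using la_properties(1) by (intro tendsto_mult tendsto_const LIMSEQ_Suc LIMSEQ_realpow_zero) auto
    then show "(\<lambda>n. real mu ^ k / pmf p mu * exp (- (real la - mu)) ^ Suc n) \<longlonglongrightarrow> 0" by simp
  qed simp
  then have "(\<lambda>n. exp (Ggap k (real (Suc n)) - C0 * (\<Sum>i<k. real mu ^ i))) \<longlonglongrightarrow> exp (0 - C0 * (\<Sum>i<k. real mu ^ i))"
    by (intro tendsto_intros)
  ultimately show ?thesis using LIMSEQ_unique by fastforce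
qed

lemma tilted_minimal:
  assumes s: "s > 0"
  shows "expectation (\<lambda>\<omega>. of_bool (Z k \<omega> = mu ^ k) * exp (- s) ^ Z k \<omega>) = exp (- Lm k s) * exp (- Ggap k s)"
proof -
  have "(\<lambda>\<omega>. of_bool (Z k \<omega> = mu ^ k) * exp (- s) ^ Z k \<omega>) = (\<lambda>\<omega>. of_bool (Z k \<omega> = mu ^ k) * exp (- s) ^ (mu ^ k))" by auto
  then have "expectation (\<lambda>\<omega>. of_bool (Z k \<omega> = mu ^ k) * exp (- s) ^ Z k \<omega>) = exp (- C0 * (\<Sum>i<k. real mu ^ i)) * exp (- s) ^ (mu ^ k)"
    by (simp only: integral_mult_left_zero prob_Z_minimal)
  also have "\<dots> = exp (- Lm k s) * exp (- Ggap k s)"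
    unfolding exp_of_nat_mult[symmetric] exp_add[symmetric] by (simp add: Ggap_def)
  finally show ?thesis .
qed

lemma tilted_nonminimal:
  assumes s: "s > 0"
  shows "expectation (\<lambda>\<omega>. of_bool (Z k \<omega> \<noteq> mu ^ k) * exp (- s) ^ Z k \<omega>) \<le> exp (- Lm k s) * Ggap k s"
proof -
  have i: "integrable M (\<lambda>\<omega>. of_bool (Z k \<omega> = mu ^ k) * exp (- s) ^ Z k \<omega>)" "integrable M (\<lambda>\<omega>. exp (- s) ^ Z k \<omega>)"
    using s by (auto intro!: integrable_const_bound[where B = 1] mult_le_one power_le_one AE_I2)
  have "(\<lambda>\<omega>. of_bool (Z k \<omega> \<noteq> mu ^ k) * exp (- s) ^ Z k \<omega>) = (\<lambda>\<omega>. exp (- s) ^ Z k \<omega> - of_bool (Z k \<omega> = mu ^ k) * exp (- s) ^ Z k \<omega>)" by auto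
  then have "expectation (\<lambda>\<omega>. of_bool (Z k \<omega> \<noteq> mu ^ k) * exp (- s) ^ Z k \<omega>)
    = expectation (\<lambda>\<omega>. exp (- s) ^ Z k \<omega>) - exp (- Lm k s) * exp (- Ggap k s)"
    by (simp only: Bochner_Integration.integral_diff[OF i(2,1)] tilted_minimal[OF s])
  also have "expectation (\<lambda>\<omega>. exp (- s) ^ Z k \<omega>) = exp (- Lm k s)"
    using expectation_power_Z_event[of 0 k s "\<lambda>_. True"] s by (simp add: prob_space)
  also have "exp (- Lm k s) - exp (- Lm k s) * exp (- Ggap k s) = exp (- Lm k s) * (1 - exp (- Ggap k s))" by (simp add: algebra_simps)
  also have "\<dots> \<le> exp (- Lm k s) * Ggap k s"
    using exp_ge_add_one_self[of "- Ggap k s"] by (intro mult_left_mono) auto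
  finally show ?thesis .
qed

lemma bt_Lm: "z > 0 \<Longrightarrow> bt (Lm k z) = real mu ^ k * bt z"
  by (induction k) (auto simp: Lm_Suc bt_Lam Lm_pos)

text \<open>An explicit substitute for \<open>Ggap k s\<close>. In the leading form \<mu>^k exp (-
  (\<lambda> - \<mu>) s) the argument s is replaced by \<open>bt s\<close>, which by scaling equals
  \<open>Bf (Uf \<epsilon>) / real mu ^ k\<close> and no longer refers to
  \<kappa>(\<epsilon>).\<close>

definition "Ek \<epsilon> k = real mu ^ k * exp (- ((real la - real mu) * (Bf (Uf \<epsilon>) / real mu ^ k)))"

lemma conditional_bounds:
  obtains K c1 k0 where "K > 0" "c1 > 0"
    "\<And>\<epsilon> k. 0 < \<epsilon> \<Longrightarrow> \<epsilon> < 1 \<Longrightarrow> (k0::nat) \<le> kap \<epsilon> \<Longrightarrow> k \<le> kap \<epsilon> \<Longrightarrow> 1 \<le> k \<Longrightarrow>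
      expectation (\<lambda>\<omega>. of_bool (W \<omega> < \<epsilon>)) > (0::real) \<and>
      expectation (\<lambda>\<omega>. of_bool (Z k \<omega> \<noteq> mu ^ k) * of_bool (W \<omega> < \<epsilon>)) \<le> K * Ek \<epsilon> k * expectation (\<lambda>\<omega>. of_bool (W \<omega> < \<epsilon>)) \<and>
      expectation (\<lambda>\<omega>. of_bool (Z k \<omega> = mu ^ k) * of_bool (W \<omega> < \<epsilon>)) \<le> K * exp (- (c1 * Ek \<epsilon> k)) * expectation (\<lambda>\<omega>. of_bool (W \<omega> < \<epsilon>))"
proof -
  \<comment> \<open>Since y lies in [\<mu>/a, 1] and \<open>Uf\<close> is decreasing, all saddle
    points that occur lie in [ul, ur].\<close>
  define ul where "ul = Uf 1"
  define ur where "ur = Uf (mu / a)"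
  have ul: "0 < ul" "ul \<le> ur" unfolding ul_def ur_def using a_gt_1 mu_pos mean_gt_mu by (auto intro!: Uf_pos Uf_antimono)
  obtain C where C: "C > 0"
    "\<And>u k n x Q. u \<in> {ul..ur} \<Longrightarrow> k \<le> n \<Longrightarrow>
      expectation (\<lambda>\<omega>. of_bool (Q (Z k \<omega>)) * of_bool (a ^ n * W \<omega> < x))
       \<le> C * exp (u * x) / sqrt (real mu ^ n) * expectation (\<lambda>\<omega>. of_bool (Q (Z k \<omega>)) * phi u ^ Z n \<omega>)"
    by (rule upper_estimate[OF ul]) (rule that, assumption+)
  obtain c k0 where c: "c > 0"
    "\<And>u k. u \<in> {ul..ur} \<Longrightarrow> k \<ge> (k0::nat) \<Longrightarrow>
      expectation (\<lambda>\<omega>. of_bool (a ^ k * W \<omega> < real mu ^ k * yf u))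
       \<ge> c * exp (u * (real mu ^ k * yf u)) / sqrt (real mu ^ k) * expectation (\<lambda>\<omega>. phi u ^ Z k \<omega>)"
    by (rule lower_estimate[OF ul]) (rule that, assumption+)
  define r where "r = pmf p la / pmf p mu"
  have r: "r > 0" using la_properties(2) pmf_mu_pos by (simp add: r_def)
  define g where "g = real la - real mu"
  have g: "g > 0" using la_properties(1) by (simp add: g_def)
  define K where "K = C / c * (1 + exp (g * C0) / pmf p mu)"
  \<comment> \<open>The factor r / (1 + r) stems from ln (1 + t) \<ge> t / (1 + t) with t \<le> r,
    the factor 1/\<mu> from the multiplicity \<mu>^(k-1) in \<open>Ggap_lower\<close>.\<close>
  define c1 where "c1 = r / (1 + r) / mu"
  show ?thesis
  proof (rule that[of K c1 k0])
    show "K > 0" "c1 > 0" using C(1) c(1) r mu_pos pmf_mu_pos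
      by (auto simp: K_def c1_def intro!: mult_pos_pos divide_pos_pos add_pos_nonneg)
    fix \<epsilon> :: real and k :: nat
    assume e: "0 < \<epsilon>" "\<epsilon> < 1" and k0: "k0 \<le> kap \<epsilon>" and k: "k \<le> kap \<epsilon>" "1 \<le> k"
    define n where "n = kap \<epsilon>"
    define y where "y = \<epsilon> * (a / mu) ^ n"
    have y: "mu / a \<le> y" "y \<le> 1" "y > 0"
      using kap_properties[OF e] e a_gt_1 mu_pos by (auto simp: y_def n_def)
    define u where "u = Uf y"
    have u: "u \<in> {ul..ur}" unfolding u_def ul_def ur_def using y a_gt_1 mu_pos by (auto intro!: Uf_antimono)
    have up: "u > 0" using u ul by auto
    have yfu: "yf u = y" unfolding u_def by (rule yf_Uf[OF y(3)])
    define x where "x = a ^ n * \<epsilon>"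
    have x: "x = real mu ^ n * yf u" unfolding yfu x_def y_def using mu_pos a_gt_1 by (simp add: power_divide)
    have ev: "a ^ n * W \<omega> < x \<longleftrightarrow> W \<omega> < \<epsilon>" for \<omega> unfolding x_def using a_gt_1 by simp
    define G where "G = exp (u * x) / sqrt (real mu ^ n)"
    have G: "G > 0" using mu_pos by (simp add: G_def)
    define F :: real where "F = expectation (\<lambda>\<omega>. of_bool (W \<omega> < \<epsilon>))"
    define s where "s = Lm (n - k) (om u)"
    have s: "s > 0" unfolding s_def by (rule Lm_pos[OF om_pos[OF up]])
    have kn: "k \<le> n" using k by (simp add: n_def)
    have full: "expectation (\<lambda>\<omega>. phi u ^ Z n \<omega>) = exp (- Lm k s)"
    proof -
      have "expectation (\<lambda>\<omega>. phi u ^ Z n \<omega>) = exp (- Lm n (om u))"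
        using expectation_power_Z_event[of 0 n "om u" "\<lambda>_. True"] om_pos[OF up] exp_om[OF up] by (simp add: prob_space)
      also have "Lm n (om u) = Lm k s" unfolding s_def Lm_add[symmetric] using kn by simp
      finally show ?thesis .
    qed
    have FG: "c * G * exp (- Lm k s) \<le> F"
      using c(2)[OF u, of n] k0 unfolding n_def[symmetric] full x[symmetric] ev by (simp add: F_def G_def)
    have Fp: "F > 0"
    proof -
      have "0 < c * G * exp (- Lm k s)" using c(1) G by simp
      then show ?thesis using FG by linarith
    qed
    have up_est: "expectation (\<lambda>\<omega>. of_bool (Q (Z k \<omega>)) * of_bool (W \<omega> < \<epsilon>)) \<le> C * G * expectation (\<lambda>\<omega>. of_bool (Q (Z k \<omega>)) * exp (- s) ^ Z k \<omega>)" for Q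
    proof -
      have "expectation (\<lambda>\<omega>. of_bool (Q (Z k \<omega>)) * phi u ^ Z n \<omega>) = expectation (\<lambda>\<omega>. of_bool (Q (Z k \<omega>)) * exp (- s) ^ Z k \<omega>)"
        using expectation_power_Z_event[OF kn om_pos[OF up], of Q] exp_om[OF up] by (simp add: s_def)
      then show ?thesis using C(2)[OF u kn, of Q x] unfolding ev by (simp add: G_def)
    qed
    \<comment> \<open>\<open>G\<close> and exp (- Lm k s) occur both in the upper estimate and in
      the lower one for \<open>F\<close>; dividing leaves the constant C / c.\<close>
    have ratio: "C * G * (exp (- Lm k s) * q) \<le> C / c * q * F" if "q \<ge> 0" for q
    proof -
      have "C / c * q * (c * G * exp (- Lm k s)) \<le> C / c * q * F"
        using FG C(1) c(1) that by (intro mult_left_mono) auto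
      then show ?thesis using c(1) by (simp add: mult_ac)
    qed
    \<comment> \<open>Scaling determines \<open>bt s\<close> exactly, and \<open>bt_bounds\<close>
      then confines s up to \<open>C0\<close>. This error reappears as the factor exp (g C0) in
      \<open>K\<close>.\<close>
    have sb: "Bf (Uf \<epsilon>) / real mu ^ k - C0 \<le> s" "s \<le> Bf (Uf \<epsilon>) / real mu ^ k"
    proof -
      have "Uf \<epsilon> = a ^ n * u"
      proof -
        have "(mu / a) ^ n * y = \<epsilon>" unfolding y_def using mu_pos a_gt_1 by (simp add: power_divide)
        then show ?thesis using Uf_scale[OF y(3), of n] by (simp add: u_def)
      qed
      then have "Bf (Uf \<epsilon>) = real mu ^ n * Bf u" using Bf_scale[OF up, of n] by simp
      moreover have "bt s = real mu ^ (n - k) * Bf u" unfolding s_def Bf_def by (rule bt_Lm[OF om_pos[OF up]])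
      moreover have "real mu ^ n = real mu ^ k * real mu ^ (n - k)" using kn by (simp add: power_add[symmetric])
      ultimately have "bt s = Bf (Uf \<epsilon>) / real mu ^ k" using mu_pos by simp
      then show "Bf (Uf \<epsilon>) / real mu ^ k - C0 \<le> s" "s \<le> Bf (Uf \<epsilon>) / real mu ^ k"
        using bt_bounds[OF s] by auto
    qed
    have Ek0: "Ek \<epsilon> k \<ge> 0" unfolding Ek_def by simp
    have Gup: "Ggap k s \<le> exp (g * C0) / pmf p mu * Ek \<epsilon> k"
    proof -
      have "Ggap k s \<le> (real mu ^ k - 1) * (exp (- (g * s)) / pmf p mu)" unfolding g_def by (rule Ggap_upper[OF s])
      also have "\<dots> \<le> real mu ^ k * (exp (- (g * s)) / pmf p mu)"
        using pmf_mu_pos by (intro mult_right_mono) auto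
      also have "\<dots> \<le> real mu ^ k * (exp (g * C0) * exp (- (g * (Bf (Uf \<epsilon>) / real mu ^ k))) / pmf p mu)"
      proof (intro mult_left_mono divide_right_mono)
        have "g * (Bf (Uf \<epsilon>) / real mu ^ k - C0) \<le> g * s" using sb g by (intro mult_left_mono) auto
        then show "exp (- (g * s)) \<le> exp (g * C0) * exp (- (g * (Bf (Uf \<epsilon>) / real mu ^ k)))"
          unfolding exp_add[symmetric] by (simp add: algebra_simps)
      qed (use pmf_mu_pos in auto)
      also have "\<dots> = exp (g * C0) / pmf p mu * Ek \<epsilon> k" by (simp add: Ek_def g_def mult_ac)
      finally show ?thesis .
    qed
    have Glow: "c1 * Ek \<epsilon> k \<le> Ggap k s"
    proof -
      obtain j where j: "k = Suc j" using k(2) by (cases k) auto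
      define t where "t = r * exp (- (g * s))"
      have t: "0 < t" "t \<le> r" using r g s by (auto simp: t_def intro!: mult_left_le)
      have "t / (1 + r) \<le> t / (1 + t)" using t r by (intro divide_left_mono mult_pos_pos) auto
      also have "\<dots> \<le> ln (1 + t)"
      proof -
        have "1 - 1 / (1 + t) \<le> ln (1 + t)"
          using ln_le_minus_one[of "1 / (1 + t)"] t by (simp add: ln_div)
        moreover have "1 - 1 / (1 + t) = t / (1 + t)" using t by (simp add: field_simps)
        ultimately show ?thesis by simp
      qed
      also have "\<dots> \<le> Lgap s" unfolding t_def r_def g_def using Lgap_bounds(1)[OF s] by simp
      finally have "real mu ^ j * (t / (1 + r)) \<le> real mu ^ j * Lgap s" by (intro mult_left_mono) auto
      also have "\<dots> \<le> Ggap k s" unfolding j by (rule Ggap_lower[OF s])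
      finally have 1: "real mu ^ j * (t / (1 + r)) \<le> Ggap k s" .
      have "c1 * Ek \<epsilon> k = real mu ^ j * (r * exp (- (g * (Bf (Uf \<epsilon>) / real mu ^ k))) / (1 + r))"
        using mu_pos by (simp add: c1_def Ek_def g_def j)
      also have "\<dots> \<le> real mu ^ j * (t / (1 + r))"
      proof -
        have "g * s \<le> g * (Bf (Uf \<epsilon>) / real mu ^ k)" using sb g by (intro mult_left_mono) auto
        then show ?thesis unfolding t_def using r by (intro mult_left_mono divide_right_mono) auto
      qed
      finally show ?thesis using 1 by linarith
    qed
    have G0: "Ggap k s \<ge> 0" by (rule Ggap_nonneg[OF s])
    have K1: "C / c \<le> K" "C / c * (exp (g * C0) / pmf p mu) \<le> K"
      unfolding K_def distrib_left using C(1) c(1) pmf_mu_pos by auto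
    have Kn: "K \<ge> 0"
    proof -
      have "0 < C / c" using C(1) c(1) by simp
      then show ?thesis using K1(1) by linarith
    qed
    have non: "expectation (\<lambda>\<omega>. of_bool (Z k \<omega> \<noteq> mu ^ k) * of_bool (W \<omega> < \<epsilon>)) \<le> K * Ek \<epsilon> k * F"
    proof -
      have "expectation (\<lambda>\<omega>. of_bool (Z k \<omega> \<noteq> mu ^ k) * of_bool (W \<omega> < \<epsilon>)) \<le> C * G * expectation (\<lambda>\<omega>. of_bool (Z k \<omega> \<noteq> mu ^ k) * exp (- s) ^ Z k \<omega>)"
        by (rule up_est[of "\<lambda>m. m \<noteq> mu ^ k"])
      also have "\<dots> \<le> C * G * (exp (- Lm k s) * Ggap k s)"
        using tilted_nonminimal[OF s, of k] C(1) G by (intro mult_left_mono) auto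
      also have "\<dots> \<le> C / c * Ggap k s * F" by (rule ratio[OF G0])
      also have "\<dots> \<le> C / c * (exp (g * C0) / pmf p mu * Ek \<epsilon> k) * F"
        using Gup C(1) c(1) Fp by (intro mult_right_mono mult_left_mono) auto
      also have "\<dots> = C / c * (exp (g * C0) / pmf p mu) * (Ek \<epsilon> k * F)" by simp
      also have "\<dots> \<le> K * (Ek \<epsilon> k * F)" using K1(2) Ek0 Fp by (intro mult_right_mono) auto
      finally show ?thesis by (simp add: mult_ac)
    qed
    have mini: "expectation (\<lambda>\<omega>. of_bool (Z k \<omega> = mu ^ k) * of_bool (W \<omega> < \<epsilon>)) \<le> K * exp (- (c1 * Ek \<epsilon> k)) * F"
    proof -
      have "expectation (\<lambda>\<omega>. of_bool (Z k \<omega> = mu ^ k) * of_bool (W \<omega> < \<epsilon>)) \<le> C * G * (exp (- Lm k s) * exp (- Ggap k s))"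
        using up_est[of "\<lambda>m. m = mu ^ k"] unfolding tilted_minimal[OF s] .
      also have "\<dots> \<le> C / c * exp (- Ggap k s) * F" by (rule ratio) simp
      also have "\<dots> \<le> K * exp (- (c1 * Ek \<epsilon> k)) * F"
        using Glow K1(1) Kn C(1) c(1) Fp by (intro mult_right_mono mult_mono) auto
      finally show ?thesis .
    qed
    show "expectation (\<lambda>\<omega>. of_bool (W \<omega> < \<epsilon>)) > (0::real) \<and>
      expectation (\<lambda>\<omega>. of_bool (Z k \<omega> \<noteq> mu ^ k) * of_bool (W \<omega> < \<epsilon>)) \<le> K * Ek \<epsilon> k * expectation (\<lambda>\<omega>. of_bool (W \<omega> < \<epsilon>)) \<and>
      expectation (\<lambda>\<omega>. of_bool (Z k \<omega> = mu ^ k) * of_bool (W \<omega> < \<epsilon>)) \<le> K * exp (- (c1 * Ek \<epsilon> k)) * expectation (\<lambda>\<omega>. of_bool (W \<omega> < \<epsilon>))"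
      using Fp non mini unfolding F_def by blast
  qed
qed


section \<open>Size of \<open>Ek\<close> on both sides of \<gamma>\<close>

lemma Ht_bounded:
  obtains H where "\<And>\<epsilon>. 0 < \<epsilon> \<Longrightarrow> \<epsilon> < 1 \<Longrightarrow> \<bar>ln mu * Ht \<epsilon>\<bar> \<le> H"
proof -
  have "compact (Ht ` {mu / a..1})"
    using a_gt_1 mu_pos by (intro compact_continuous_image continuous_at_imp_continuous_on ballI isCont_Ht)
      (auto intro: less_le_trans[of 0 "mu / a"])
  then obtain B where B: "\<forall>y\<in>{mu / a..1}. \<bar>Ht y\<bar> \<le> B"
    by (auto dest!: compact_imp_bounded simp: bounded_iff)
  show ?thesis
  proof (rule that[of "ln mu * B"])
    fix \<epsilon> :: real assume e: "0 < \<epsilon>" "\<epsilon> < 1"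
    have "\<bar>Ht (\<epsilon> * (a / mu) ^ kap \<epsilon>)\<bar> \<le> B" using kap_properties[OF e] by (intro B[rule_format]) auto
    then have "\<bar>Ht \<epsilon>\<bar> \<le> B" by (simp add: Ht_power[OF e(1)])
    then show "\<bar>ln mu * Ht \<epsilon>\<bar> \<le> ln mu * B" using mu_pos by (simp add: abs_mult mult_left_mono)
  qed
qed

definition "gam \<epsilon> = gw_gamma M p X \<epsilon>"

text \<open>The third identity shows how H is built. With L = log (1/\<epsilon>), the term L / log
  (a/\<mu>) of \<gamma> is cancelled by the power of \<epsilon> in H, the term log L / log \<mu>
  produces the factor L, and the remaining constants of H supply the left-hand side.\<close>

lemma gam_eq: assumes e: "0 < \<epsilon>" "\<epsilon> < 1"
  shows "gam \<epsilon> = ln (1 / \<epsilon>) / ln (a / mu) - ln (ln (1 / \<epsilon>)) / ln mu + Ht \<epsilon>"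
    and "ln mu * gam \<epsilon> = al * ln (1 / \<epsilon>) - ln (ln (1 / \<epsilon>)) + ln mu * Ht \<epsilon>"
    and "(real la - real mu) * Bf (Uf \<epsilon>) = al * ln (1 / \<epsilon>) * mu powr gam \<epsilon>"
proof -
  define L where "L = ln (1 / \<epsilon>)"
  have L: "L > 0" using e by (simp add: L_def)
  show 1: "gam \<epsilon> = ln (1 / \<epsilon>) / ln (a / mu) - ln (ln (1 / \<epsilon>)) / ln mu + Ht \<epsilon>"
    unfolding gam_def gw_gamma_def gw_H_eq[OF e(1)] mu_def a_def ..
  have lm: "ln mu > 0" using mu_pos by simp
  show 2: "ln mu * gam \<epsilon> = al * ln (1 / \<epsilon>) - ln (ln (1 / \<epsilon>)) + ln mu * Ht \<epsilon>"
    unfolding 1 al_eq using lm by (simp add: algebra_simps)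
  define T where "T = Bf (Uf \<epsilon>) * (real la - real mu) / al"
  have T: "T > 0" using Bf_pos[OF Uf_pos[OF e(1)]] la_properties(1) al_pos by (simp add: T_def)
  have "ln mu * Ht \<epsilon> = ln (T * \<epsilon> powr al)"
    unfolding Ht_def T_def using lm by (simp add: mult_ac)
  also have "\<dots> = ln T + al * ln \<epsilon>" using T e by (simp add: ln_mult ln_powr)
  also have "ln \<epsilon> = - L" using e by (simp add: L_def ln_div)
  finally have "ln mu * gam \<epsilon> = ln T - ln L" unfolding 2 L_def[symmetric] by simp
  then have "mu powr gam \<epsilon> = T / L" using mu_pos T L by (simp add: powr_def exp_diff mult.commute)
  then have "al * L * mu powr gam \<epsilon> = al * T" using L by simp
  then show "(real la - real mu) * Bf (Uf \<epsilon>) = al * ln (1 / \<epsilon>) * mu powr gam \<epsilon>"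
    unfolding L_def[symmetric] using al_pos by (simp add: T_def)
qed

lemma Ek_eq: assumes e: "0 < \<epsilon>" "\<epsilon> < 1"
  shows "Ek \<epsilon> k = exp (k * ln mu - al * ln (1 / \<epsilon>) * mu powr (gam \<epsilon> - k))"
proof -
  have "(real la - real mu) * (Bf (Uf \<epsilon>) / real mu ^ k) = al * ln (1 / \<epsilon>) * mu powr (gam \<epsilon> - k)"
    using gam_eq(3)[OF e] mu_pos by (simp add: powr_diff powr_realpow)
  moreover have "real mu ^ k = exp (k * ln mu)" using mu_pos by (simp add: exp_of_nat_mult)
  ultimately show ?thesis unfolding Ek_def by (simp add: exp_diff exp_minus divide_inverse)
qed

text \<open>For k \<le> \<gamma> the power \<mu>^(\<gamma>-k) is at least 1, so at least \<alpha> L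
  is subtracted, while k log \<mu> is at most \<alpha> L - log L + H. What remains is H - log L,
  hence the order 1/L.\<close>

lemma Ek_upper: assumes e: "0 < \<epsilon>" "\<epsilon> < 1" and H: "\<bar>ln mu * Ht \<epsilon>\<bar> \<le> H" and k: "k \<le> gam \<epsilon>"
  shows "Ek \<epsilon> k \<le> exp H / ln (1 / \<epsilon>)"
proof -
  define L where "L = ln (1 / \<epsilon>)"
  have L: "L > 0" using e by (simp add: L_def)
  have "al * L * 1 \<le> al * L * mu powr (gam \<epsilon> - k)"
    using al_pos L k mu_pos by (intro mult_left_mono ge_one_powr_ge_zero) auto
  moreover have "k * ln mu \<le> ln mu * gam \<epsilon>" using k mu_pos by (simp add: mult.commute mult_left_mono)
  ultimately have "k * ln mu - al * L * mu powr (gam \<epsilon> - k) \<le> H - ln L"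
    using gam_eq(2)[OF e] H unfolding L_def[symmetric] by linarith
  then have "Ek \<epsilon> k \<le> exp (H - ln L)" unfolding Ek_eq[OF e] L_def by simp
  then show ?thesis using L by (simp add: exp_diff L_def)
qed

text \<open>For k \<ge> \<gamma> + 1 the power is at most 1/2, so half of \<alpha> L survives in the
  exponent. The growth exp (\<alpha> L / 2) / L is weakened by exp x \<ge> x^2 / 2 to a linear one,
  which gives the factor \<alpha>^2 / 8.\<close>

lemma Ek_lower: assumes e: "0 < \<epsilon>" "\<epsilon> < 1" and H: "\<bar>ln mu * Ht \<epsilon>\<bar> \<le> H" and k: "gam \<epsilon> + 1 \<le> k"
  shows "Ek \<epsilon> k \<ge> al\<^sup>2 * exp (- H) / 8 * ln (1 / \<epsilon>)"
proof -
  define L where "L = ln (1 / \<epsilon>)"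
  have L: "L > 0" using e by (simp add: L_def)
  have "mu powr (gam \<epsilon> - k) \<le> mu powr (- 1)" using k mu_pos by (intro powr_mono) auto
  also have "\<dots> \<le> 1 / 2" using mu_pos by (simp add: powr_minus inverse_eq_divide)
  finally have "al * L * mu powr (gam \<epsilon> - k) \<le> al * L * (1 / 2)" using al_pos L by (intro mult_left_mono) auto
  moreover have "ln mu * gam \<epsilon> \<le> k * ln mu"
    using mult_left_mono[of "gam \<epsilon>" "real k" "ln mu"] k mu_pos by (simp add: mult.commute)
  ultimately have "al * L / 2 - ln L - H \<le> k * ln mu - al * L * mu powr (gam \<epsilon> - k)"
    using gam_eq(2)[OF e] H unfolding L_def[symmetric] by linarith
  then have "exp (al * L / 2 - ln L - H) \<le> Ek \<epsilon> k" unfolding Ek_eq[OF e] L_def by simp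
  moreover have "exp (al * L / 2 - ln L - H) = exp (al * L / 2) * exp (- H) / L"
  proof -
    have "al * L / 2 - ln L - H = (al * L / 2 + (- H)) + (- ln L)" by simp
    then have "exp (al * L / 2 - ln L - H) = exp (al * L / 2) * exp (- H) * exp (- ln L)" by (simp only: exp_add)
    moreover have "exp (- ln L) = 1 / L" using L by (simp add: exp_minus inverse_eq_divide)
    ultimately show ?thesis by simp
  qed
  moreover have "(al * L / 2)\<^sup>2 / 2 \<le> exp (al * L / 2)"
    using power_le_fact_exp[of "al * L / 2" 2] al_pos L by (simp add: fact_2)
  then have "(al * L / 2)\<^sup>2 / 2 * exp (- H) / L \<le> exp (al * L / 2) * exp (- H) / L"
    using L by (intro divide_right_mono mult_right_mono) auto
  moreover have "(al * L / 2)\<^sup>2 / 2 * exp (- H) / L = al\<^sup>2 * exp (- H) / 8 * L"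
    using L by (simp add: power2_eq_square)
  ultimately show ?thesis unfolding L_def by linarith
qed

section \<open>From minimal sizes to the first excess\<close>

lemma first_excess_measurable [measurable]: "first_excess p X \<in> M \<rightarrow>\<^sub>M count_space UNIV"
  unfolding first_excess_def[abs_def] by measurable

text \<open>An excess is never lost, since Z (i+j) is at least \<mu>^j Z i. The first excess can
  therefore be located by testing two generations only.\<close>

lemma Z_monotone_excess:
  assumes X: "\<forall>n i. X n i \<omega> \<ge> mu" and le: "i \<le> k" and min: "Z k \<omega> = mu ^ k"
  shows "Z i \<omega> = mu ^ i"
proof -
  have "Z (i + j) \<omega> \<ge> mu ^ j * Z i \<omega>" for j
  proof (induction j)
    case (Suc j)
    have "mu * (mu ^ j * Z i \<omega>) \<le> mu * Z (i + j) \<omega>" using Suc by (rule mult_left_mono) simp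
    also have "\<dots> \<le> Z (Suc (i + j)) \<omega>" by (rule Z_Suc_ge[OF X])
    finally show ?case by (simp add: mult.assoc del: gw_size.simps)
  qed simp
  from this[of "k - i"] have "mu ^ (k - i) * Z i \<omega> \<le> mu ^ k" using le min by simp
  also have "mu ^ k = mu ^ (k - i) * mu ^ i" using le by (simp add: power_add[symmetric])
  finally have "Z i \<omega> \<le> mu ^ i" using mu_ge_2 by simp
  with Z_ge[OF X, of i] show ?thesis by simp
qed

lemma first_excess_between:
  assumes X: "\<forall>n i. X n i \<omega> \<ge> mu" and k1: "Z k1 \<omega> = mu ^ k1" and k2: "Z k2 \<omega> \<noteq> mu ^ k2"
  shows "k1 < first_excess p X \<omega>" "first_excess p X \<omega> \<le> k2"
proof -
  have ex: "Z k2 \<omega> > mu ^ k2" using Z_ge[OF X, of k2] k2 by simp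
  show "first_excess p X \<omega> \<le> k2"
    unfolding first_excess_def mu_def[symmetric] by (rule Least_le) (rule ex)
  have "Z (first_excess p X \<omega>) \<omega> > mu ^ first_excess p X \<omega>"
    unfolding first_excess_def mu_def[symmetric] by (rule LeastI) (rule ex)
  then show "k1 < first_excess p X \<omega>"
    using Z_monotone_excess[OF X _ k1, of "first_excess p X \<omega>"] by (cases "first_excess p X \<omega> \<le> k1") auto
qed

lemma prob_eq_expectation: "Measurable.pred M Q \<Longrightarrow> \<P>(\<omega> in M. Q \<omega>) = expectation (\<lambda>\<omega>. of_bool (Q \<omega>))"
proof -
  assume [measurable]: "Measurable.pred M Q"
  have "expectation (\<lambda>\<omega>. of_bool (Q \<omega>)) = expectation (indicator {\<omega> \<in> space M. Q \<omega>})"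
    by (rule Bochner_Integration.integral_cong) (auto simp: indicator_def)
  also have "\<dots> = \<P>(\<omega> in M. Q \<omega>)" by simp
  finally show ?thesis by simp
qed

lemma conditional_limit:
  "((\<lambda>\<epsilon>. cond_prob M
        (\<lambda>\<omega>. int (first_excess p X \<omega>) = \<lceil>gam \<epsilon>\<rceil> \<or> int (first_excess p X \<omega>) = \<lceil>gam \<epsilon>\<rceil> + 1)
        (\<lambda>\<omega>. W \<omega> < \<epsilon>)) \<longlongrightarrow> 1) (at_right 0)"
    (is "(?cond \<longlongrightarrow> 1) _")
proof -
  obtain K c1 k0 where K: "K > 0" "c1 > 0"
    "\<And>\<epsilon> k. 0 < \<epsilon> \<Longrightarrow> \<epsilon> < 1 \<Longrightarrow> (k0::nat) \<le> kap \<epsilon> \<Longrightarrow> k \<le> kap \<epsilon> \<Longrightarrow> 1 \<le> k \<Longrightarrow>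
      expectation (\<lambda>\<omega>. of_bool (W \<omega> < \<epsilon>)) > (0::real) \<and>
      expectation (\<lambda>\<omega>. of_bool (Z k \<omega> \<noteq> mu ^ k) * of_bool (W \<omega> < \<epsilon>)) \<le> K * Ek \<epsilon> k * expectation (\<lambda>\<omega>. of_bool (W \<omega> < \<epsilon>)) \<and>
      expectation (\<lambda>\<omega>. of_bool (Z k \<omega> = mu ^ k) * of_bool (W \<omega> < \<epsilon>)) \<le> K * exp (- (c1 * Ek \<epsilon> k)) * expectation (\<lambda>\<omega>. of_bool (W \<omega> < \<epsilon>))"
    by (rule conditional_bounds) (rule that, assumption, assumption, assumption)
  obtain H where H: "\<And>\<epsilon>. 0 < \<epsilon> \<Longrightarrow> \<epsilon> < 1 \<Longrightarrow> \<bar>ln mu * Ht \<epsilon>\<bar> \<le> H"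
    by (rule Ht_bounded) (rule that, assumption)
  define g where "g = al\<^sup>2 * exp (- H) / 8"
  have g: "g > 0" using al_pos by (simp add: g_def)
  define R where "R = K * exp H + K / (c1 * g)"
  have Linf: "filterlim (\<lambda>\<epsilon>::real. ln (1 / \<epsilon>)) at_top (at_right 0)"
    unfolding divide_inverse mult_1
    by (rule filterlim_compose[OF ln_at_top filterlim_inverse_at_top_right])
  have lm: "ln mu > 0" using mu_pos by simp
  define lq where "lq = ln (a / mu)"
  have lq: "lq > 0" using a_gt_1 by (simp add: lq_def)
  define c where "c = ln mu"
  have c: "c > 0" using lm by (simp add: c_def)
  \<comment> \<open>The second condition yields
    \<open>gam \<epsilon> + 2 \<le> kap \<epsilon>\<close>, where 3 is this 2 plus 1 for the floor
    in \<open>kap\<close>; the third yields \<open>gam \<epsilon> \<ge> 2\<close>, the fourth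
    \<open>k0 \<le> kap \<epsilon>\<close>. The two generations tested below then lie between 1 and
    \<kappa>(\<epsilon>).\<close>
  have evL: "\<forall>\<^sub>F L in at_top. L > 1 \<and> ln L / c - H / c - 3 \<ge> 0 \<and> al * L - ln L - H \<ge> 2 * c \<and> L / lq - 1 \<ge> real k0"
    using al_pos lq c by (intro eventually_conj; real_asymp)
  have bound: "\<forall>\<^sub>F \<epsilon> in at_right 0. 1 - R / ln (1 / \<epsilon>) \<le> ?cond \<epsilon> \<and> ?cond \<epsilon> \<le> 1"
    using eventually_compose_filterlim[OF evL Linf] eventually_at_right_less[of 0]
  proof eventually_elim
    case (elim \<epsilon>)
    define L where "L = ln (1 / \<epsilon>)"
    have e0: "\<epsilon> > 0" using elim by simp
    have L: "L > 1" "ln L / c - H / c - 3 \<ge> 0" "al * L - ln L - H \<ge> 2 * c" "L / lq - 1 \<ge> real k0"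
      using elim by (auto simp: L_def)
    have e1: "\<epsilon> < 1"
    proof (rule ccontr)
      assume "\<not> \<epsilon> < 1"
      then have "ln (1 / \<epsilon>) \<le> 0" using e0 by (simp add: ln_div)
      then show False using L by (simp add: L_def)
    qed
    note e = e0 e1
    have Hb: "\<bar>c * Ht \<epsilon>\<bar> \<le> H" using H[OF e] by (simp add: c_def)
    have gam2: "gam \<epsilon> \<ge> 2"
    proof -
      have "2 * c \<le> c * gam \<epsilon>" using gam_eq(2)[OF e] L(3) Hb unfolding L_def[symmetric] c_def[symmetric] by linarith
      then show ?thesis using c by (simp add: mult.commute)
    qed
    have gk: "gam \<epsilon> + 2 \<le> kap \<epsilon>"
    proof -
      have "Ht \<epsilon> \<le> H / c" using Hb c by (simp add: pos_le_divide_eq mult.commute)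
      then show ?thesis
        using gam_eq(1)[OF e] kap_properties(1)[OF e] L(2)
        unfolding L_def[symmetric] c_def[symmetric] lq_def[symmetric] by linarith
    qed
    have k0: "k0 \<le> kap \<epsilon>"
      using kap_properties(1)[OF e] L(4) unfolding L_def[symmetric] lq_def[symmetric] by linarith
    \<comment> \<open>\<open>k1\<close>, one below the ceiling, is at most \<gamma>, and
      \<open>k2\<close>, one above it, is at least \<gamma> + 1, as the two estimates of
      \<open>Ek\<close> require. If generation \<open>k1\<close> is minimal and generation
      \<open>k2\<close> is not, then k1 < K \<le> k2, which leaves exactly the two values of the
      claim.\<close>
    define k1 where "k1 = nat (\<lceil>gam \<epsilon>\<rceil> - 1)"
    define k2 where "k2 = nat (\<lceil>gam \<epsilon>\<rceil> + 1)"
    have ik: "int k1 = \<lceil>gam \<epsilon>\<rceil> - 1" "int k2 = \<lceil>gam \<epsilon>\<rceil> + 1" using gam2 by (auto simp: k1_def k2_def)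
    have rk: "real k1 = of_int \<lceil>gam \<epsilon>\<rceil> - 1" "real k2 = of_int \<lceil>gam \<epsilon>\<rceil> + 1"
      using ik by (metis of_int_1 of_int_diff of_int_of_nat_eq, metis of_int_1 of_int_add of_int_of_nat_eq)
    have k1: "1 \<le> k1" "real k1 \<le> gam \<epsilon>" "k1 \<le> kap \<epsilon>" using rk gam2 gk by linarith+
    have k2: "1 \<le> k2" "gam \<epsilon> + 1 \<le> real k2" "k2 \<le> kap \<epsilon>" using rk gam2 gk by linarith+
    define F :: real where "F = expectation (\<lambda>\<omega>. of_bool (W \<omega> < \<epsilon>))"
    define Ev where "Ev \<omega> \<longleftrightarrow> int (first_excess p X \<omega>) = \<lceil>gam \<epsilon>\<rceil> \<or> int (first_excess p X \<omega>) = \<lceil>gam \<epsilon>\<rceil> + 1" for \<omega>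
    have [measurable]: "Measurable.pred M Ev" unfolding Ev_def[abs_def] by measurable
    note K1 = K(3)[OF e k0 k1(3,1), folded F_def]
    note K2 = K(3)[OF e k0 k2(3,1), folded F_def]
    have F: "F > 0" using K1 by simp
    have ib: "integrable M (\<lambda>\<omega>. of_bool (A \<omega>) * of_bool (W \<omega> < \<epsilon>) :: real)" if "Measurable.pred M A" for A
      using that by (intro integrable_const_bound[where B = 1]) auto
    have iF: "integrable M (\<lambda>\<omega>. of_bool (W \<omega> < \<epsilon>) :: real)"
      by (intro integrable_const_bound[where B = 1]) auto
    define P :: real where "P = expectation (\<lambda>\<omega>. of_bool (Ev \<omega>) * of_bool (W \<omega> < \<epsilon>))"
    have "F - P \<le> expectation (\<lambda>\<omega>. of_bool (Z k1 \<omega> \<noteq> mu ^ k1) * of_bool (W \<omega> < \<epsilon>)) + expectation (\<lambda>\<omega>. of_bool (Z k2 \<omega> = mu ^ k2) * of_bool (W \<omega> < \<epsilon>))"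
    proof -
      have i1: "integrable M (\<lambda>\<omega>. of_bool (Z k1 \<omega> \<noteq> mu ^ k1) * of_bool (W \<omega> < \<epsilon>) :: real)"
        and i2: "integrable M (\<lambda>\<omega>. of_bool (Z k2 \<omega> = mu ^ k2) * of_bool (W \<omega> < \<epsilon>) :: real)"
        and i3: "integrable M (\<lambda>\<omega>. of_bool (Ev \<omega>) * of_bool (W \<omega> < \<epsilon>) :: real)"
        by (rule ib, measurable)+
      have "F - P = expectation (\<lambda>\<omega>. of_bool (W \<omega> < \<epsilon>) - of_bool (Ev \<omega>) * of_bool (W \<omega> < \<epsilon>))"
        unfolding F_def P_def by (rule Bochner_Integration.integral_diff[OF iF i3, symmetric])
      also have "\<dots> \<le> expectation (\<lambda>\<omega>. of_bool (Z k1 \<omega> \<noteq> mu ^ k1) * of_bool (W \<omega> < \<epsilon>) + of_bool (Z k2 \<omega> = mu ^ k2) * of_bool (W \<omega> < \<epsilon>))"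
      proof (rule integral_mono_AE)
        show "AE \<omega> in M. of_bool (W \<omega> < \<epsilon>) - of_bool (Ev \<omega>) * of_bool (W \<omega> < \<epsilon>)
          \<le> (of_bool (Z k1 \<omega> \<noteq> mu ^ k1) * of_bool (W \<omega> < \<epsilon>) + of_bool (Z k2 \<omega> = mu ^ k2) * of_bool (W \<omega> < \<epsilon>) :: real)"
          using AE_X_ge_mu
        proof eventually_elim
          case (elim \<omega>)
          have "Ev \<omega>" if "Z k1 \<omega> = mu ^ k1" "Z k2 \<omega> \<noteq> mu ^ k2"
            using first_excess_between[OF elim that] ik unfolding Ev_def by linarith
          then show ?case by auto
        qed
      qed (intro Bochner_Integration.integrable_add Bochner_Integration.integrable_diff iF i1 i2 i3)+
      also have "\<dots> = expectation (\<lambda>\<omega>. of_bool (Z k1 \<omega> \<noteq> mu ^ k1) * of_bool (W \<omega> < \<epsilon>)) + expectation (\<lambda>\<omega>. of_bool (Z k2 \<omega> = mu ^ k2) * of_bool (W \<omega> < \<epsilon>))"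
        by (rule Bochner_Integration.integral_add[OF i1 i2])
      finally show ?thesis .
    qed
    also have "\<dots> \<le> K * Ek \<epsilon> k1 * F + K * exp (- (c1 * Ek \<epsilon> k2)) * F"
      using K1 K2 by linarith
    also have "\<dots> \<le> K * (exp H / L) * F + K * (1 / (c1 * (g * L))) * F"
    proof (intro add_mono mult_right_mono mult_left_mono)
      show "Ek \<epsilon> k1 \<le> exp H / L" unfolding L_def by (rule Ek_upper[OF e H[OF e] k1(2)])
      have cg: "c1 * (g * L) > 0" using K(2) g L(1) by simp
      have "g * L \<le> Ek \<epsilon> k2" unfolding L_def g_def by (rule Ek_lower[OF e H[OF e] k2(2)])
      then have "exp (- (c1 * Ek \<epsilon> k2)) \<le> exp (- (c1 * (g * L)))" using K(2) by simp
      also have "\<dots> \<le> 1 / (c1 * (g * L))"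
        using mult_exp_minus_le[of "c1 * (g * L)"] cg by (simp only: pos_le_divide_eq mult.commute)
      finally show "exp (- (c1 * Ek \<epsilon> k2)) \<le> 1 / (c1 * (g * L))" .
    qed (use K F in auto)
    also have "\<dots> = R / L * F" by (simp add: R_def add_divide_distrib distrib_left mult_ac)
    finally have FP: "F - P \<le> R / L * F" .
    have PF: "P \<le> F" unfolding P_def F_def by (rule integral_mono[OF ib iF]) auto
    have cond: "?cond \<epsilon> = P / F"
    proof -
      have "\<P>(\<omega> in M. Ev \<omega> \<and> W \<omega> < \<epsilon>) = P"
        unfolding P_def by (subst prob_eq_expectation) (auto simp: of_bool_conj)
      moreover have "\<P>(\<omega> in M. W \<omega> < \<epsilon>) = F"
        unfolding F_def by (subst prob_eq_expectation) auto
      ultimately show ?thesis unfolding cond_prob_def Ev_def by simp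
    qed
    have "1 - R / L \<le> P / F"
      using FP F by (subst pos_le_divide_eq) (auto simp: algebra_simps)
    moreover have "P / F \<le> 1" using PF F by simp
    ultimately show ?case unfolding cond L_def by blast
  qed
  have "((\<lambda>\<epsilon>. R / ln (1 / \<epsilon>)) \<longlongrightarrow> 0) (at_right 0)"
    by (rule tendsto_divide_0[OF tendsto_const filterlim_at_top_imp_at_infinity[OF Linf]])
  then have "((\<lambda>\<epsilon>. 1 - R / ln (1 / \<epsilon>)) \<longlongrightarrow> 1 - 0) (at_right 0)" by (intro tendsto_intros)
  then have lim: "((\<lambda>\<epsilon>. 1 - R / ln (1 / \<epsilon>)) \<longlongrightarrow> 1) (at_right 0)" by simp
  have "\<forall>\<^sub>F \<epsilon> in at_right 0. 1 - R / ln (1 / \<epsilon>) \<le> ?cond \<epsilon>" "\<forall>\<^sub>F \<epsilon> in at_right 0. ?cond \<epsilon> \<le> 1"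
    by (rule eventually_mono[OF bound], erule conjunct1, rule eventually_mono[OF bound], erule conjunct2)
  then show ?thesis by (rule tendsto_sandwich[OF _ _ lim tendsto_const])
qed

end

theorem theorem2:
  fixes M :: "'w measure" and p :: "nat pmf" and X :: "nat \<Rightarrow> nat \<Rightarrow> 'w \<Rightarrow> nat"
  assumes "prob_space M"
    and "prob_space.indep_vars M (\<lambda>_. count_space UNIV) (\<lambda>(n, i). X n i) UNIV"
    and "\<And>n i. distr M (count_space UNIV) (X n i) = measure_pmf p"
    and "\<not> (\<exists>c. AE n in measure_pmf p. n = c)"
    and "pmf p 0 = 0"
    and "integrable (measure_pmf p) (\<lambda>n. real n * ln (real n))"
    and "off_min p \<ge> 2"
  shows "continuous_on {0<..} (gw_H M p X) \<and>
    (\<forall>\<epsilon>>0. gw_H M p X (\<epsilon> * off_mean p / real (off_min p)) = gw_H M p X \<epsilon>) \<and>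
    ((\<lambda>\<epsilon>. cond_prob M
        (\<lambda>\<omega>. int (first_excess p X \<omega>) = \<lceil>gw_gamma M p X \<epsilon>\<rceil> \<or>
             int (first_excess p X \<omega>) = \<lceil>gw_gamma M p X \<epsilon>\<rceil> + 1)
        (\<lambda>\<omega>. gw_limit p X \<omega> < \<epsilon>)) \<longlongrightarrow> 1) (at_right 0)"
proof -
  interpret prob_space M by (rule assms(1))
  interpret galton_watson M p X "off_min p" "off_next p" "off_mean p"
    by unfold_locales (use assms in auto)
  show ?thesis
    using continuous_on_gw_H gw_H_period conditional_limit unfolding gam_def by blast
qed

end
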